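(* Let the data $(\ell_i)_{i}$, $\ell_*$, $(g_i)_i$, $g_*$ satisfy the standing assumptions listed in the context. Let $(x_n)_{n\in\mathbb N}$ be a sequence in $\mathcal G$ converging to $x\in\mathcal G$ as $n\to\infty$, and let $y_n\in\Gamma^{\rm opt}[x_n]$ for every $n\in\mathbb N$. Assume that $y_n$ converges uniformly on $[0,T]$ to $y$ as $n\to\infty$. Then $y\in\Gamma^{\rm opt}[x]$.
   Context: Junction: $N>1$ is an integer, $(e_i)_{1\le i\le N}$ is the canonical basis of $\mathbb R^N$, $\mathbb R_+=[0,\infty)$, $J_i=\mathbb R_+e_i$ are the edges, $\mathcal G=\bigcup_{i=1}^N J_i\subset\mathbb R^N$, and the origin $0$ is the vertex. Fix $T>0$ and $p>1$. Trajectories: for $x\in\mathcal G$, $\Gamma[x]$ is the set of $y\in C([0,T];\mathcal G)\cap W^{1,p}(0,T;\mathbb R^N)$ with $y(0)=x$. For such $y$ set $\bar y=|y|\in W^{1,p}(0,T)$; then for a.e. $s$, $y'(s)=\bar y'(s)e_i$ if $y(s)\in J_i\setminus\{0\}$ and $y'(s)=0$ if $y(s)=0$. Data: $g_*\in\mathbb R$; $g_i\in C_b(\mathbb R_+)$ (bounded continuous); $\ell_*\in C([0,T])$; $\ell_i\in C(\mathbb R_+\times\mathbb R\times[0,T])$, $(y,a,s)\mapsto\ell_i(y,a,s)$, differentiable in $(y,a)$ with $\partial_y\ell_i,\partial_a\ell_i$ continuous in $(y,a,s)$. Standing assumptions (for all $i$): (H1) there is $C_0>0$ with $\ell_i(y,a,s)\ge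 C_0(|a|^p-1)$ and $\ell_*(s)\ge -C_0$ for all $(y,a,s)\in\mathbb R_+\times\mathbb R\times[0,T]$; (H2) for any $r>0$ there is a modulus of continuity $\omega_r$ with $|\ell_i(y,a,t_1)-\ell_i(y,a,t_2)|\le(1+|a|^p)\omega_r(|t_1-t_2|)$ for $y\in[0,r]$, $a\in\mathbb R$, $t_1,t_2\in[0,T]$; (H3) for any $r>0$ there is $\tilde c(r)\ge0$ with $|\partial_y\ell_i(y,a,s)|\le\tilde c(r)(|a|^p+1)$ and $|\partial_a\ell_i(y,a,s)|\le\tilde c(r)(|a|^{p-1}+1)$ for $(y,a,s)\in[0,r]\times\mathbb R\times[0,T]$; (H4) $a\mapsto\ell_i(y,a,s)$ is strictly convex. Costs: $g(y)=\sum_i g_i(|y|)\mathbf 1_{y\in J_i\setminus\{0\}}+\min\{g_*,\min_i g_i(0)\}\mathbf 1_{y=0}$; $\ell_0(\tau)=\min\{\ell_*(\tau),\min_i\ell_i(0,0,\tau)\}$; $L(y(\tau),y'(\tau),\tau)=\sum_i\ell_i(\bar y(\tau),\bar y'(\tau),\tau)\mathbf 1_{y(\tau)\in J_i\setminus\{0\}}+\ell_0(\tau)\mathbf 1_{y(\tau)=0}$; $J(x;y)=\int_0^TL(y(\tau),y'(\tau),\tau)\,d\tau+g(y(T))$ for $y\in\Gamma[x]$. Optimal trajectories: $\Gamma^{\rm opt}[x]=\{y\in\Gamma[x]:J(x;y)=\inf_{\hat y\in\Gamma[x]}J(x;\hat y)\}$. *)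

theory Defs
  imports "HOL-Analysis.Analysis"
begin

definition edge :: "'n::finite \<Rightarrow> (real ^ 'n) set" where
  "edge i = {t *\<^sub>R axis i 1 | t. t \<ge> 0}"

definition junction :: "(real ^ 'n::finite) set" where
  "junction = (\<Union>i. edge i)"

definition Lp :: "real \<Rightarrow> real \<Rightarrow> (real \<Rightarrow> 'a::euclidean_space) set" where
  "Lp T p = {u. u \<in> borel_measurable (lebesgue_on {0<..<T}) \<and>
                integrable (lebesgue_on {0<..<T}) (\<lambda>t. norm (u t) powr p)}"

definition test_functions :: "real \<Rightarrow> (real \<Rightarrow> real) set" where
  "test_functions T = {\<phi>. (\<forall>k. (deriv ^^ k) \<phi> differentiable_on UNIV) \<and>
     compact (closure {t. \<phi> t \<noteq> 0}) \<and> closure {t. \<phi> t \<noteq> 0} \<subseteq> {0<..<T}}"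

definition is_weak_deriv ::
    "real \<Rightarrow> real \<Rightarrow> (real \<Rightarrow> 'a::euclidean_space) \<Rightarrow> (real \<Rightarrow> 'a) \<Rightarrow> bool" where
  "is_weak_deriv T p u v \<longleftrightarrow> v \<in> Lp T p \<and>
     (\<forall>\<phi> \<in> test_functions T.
        (\<integral>t. deriv \<phi> t *\<^sub>R u t \<partial>lebesgue_on {0<..<T}) =
        - (\<integral>t. \<phi> t *\<^sub>R v t \<partial>lebesgue_on {0<..<T}))"

definition W1p :: "real \<Rightarrow> real \<Rightarrow> (real \<Rightarrow> 'a::euclidean_space) set" where
  "W1p T p = {u \<in> Lp T p. \<exists>v. is_weak_deriv T p u v}"

text \<open>For \<open>u\<close> in \<open>W1p T p\<close> this is determined almost everywhere on the open interval from
  0 to \<open>T\<close>, so integrals of expressions in it do not depend on the choice.\<close>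

definition weak_deriv ::
    "real \<Rightarrow> real \<Rightarrow> (real \<Rightarrow> 'a::euclidean_space) \<Rightarrow> real \<Rightarrow> 'a" where
  "weak_deriv T p u = (SOME v. is_weak_deriv T p u v)"

text \<open>Trajectories are total functions; only their values on \<open>{0..T}\<close> matter.\<close>

definition trajectories :: "real \<Rightarrow> real \<Rightarrow> real ^ 'n \<Rightarrow> (real \<Rightarrow> real ^ 'n::finite) set" where
  "trajectories T p x =
     {y. continuous_on {0..T} y \<and> y ` {0..T} \<subseteq> junction \<and> y \<in> W1p T p \<and> y 0 = x}"

text \<open>Throughout, \<open>l i\<close> and \<open>g i\<close> are the running and terminal costs on the edge \<open>i\<close>,
  and \<open>ls\<close> and \<open>gs\<close> those at the vertex (written with a star in the literature).\<close>

definition terminal_cost ::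
    "('n \<Rightarrow> real \<Rightarrow> real) \<Rightarrow> real \<Rightarrow> real ^ 'n::finite \<Rightarrow> real" where
  "terminal_cost g gs z =
     (\<Sum>i\<in>UNIV. g i (norm z) * indicator (edge i - {0}) z)
     + min gs (MIN i. g i 0) * indicator {0} z"

definition vertex_cost ::
    "('n::finite \<Rightarrow> real \<Rightarrow> real \<Rightarrow> real \<Rightarrow> real) \<Rightarrow> (real \<Rightarrow> real) \<Rightarrow> real \<Rightarrow> real" where
  "vertex_cost l ls \<tau> = min (ls \<tau>) (MIN i. l i 0 0 \<tau>)"

definition running_cost ::
    "real \<Rightarrow> real \<Rightarrow> ('n \<Rightarrow> real \<Rightarrow> real \<Rightarrow> real \<Rightarrow> real) \<Rightarrow> (real \<Rightarrow> real)
     \<Rightarrow> (real \<Rightarrow> real ^ 'n::finite) \<Rightarrow> real \<Rightarrow> real" where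
  "running_cost T p l ls y \<tau> =
     (\<Sum>i\<in>UNIV. l i (norm (y \<tau>)) (weak_deriv T p (\<lambda>s. norm (y s)) \<tau>) \<tau>
        * indicator (edge i - {0}) (y \<tau>))
     + vertex_cost l ls \<tau> * indicator {0} (y \<tau>)"

text \<open>Under the standing assumptions below the running cost of a trajectory is integrable:
  the bounds on the partial derivatives give \<open>p\<close>-growth in the velocity on bounded
  sets. So the Bochner integral is the intended finite one, and the costs of the trajectories
  from a given point are bounded below.\<close>

definition cost ::
    "real \<Rightarrow> real \<Rightarrow> ('n \<Rightarrow> real \<Rightarrow> real \<Rightarrow> real \<Rightarrow> real) \<Rightarrow> (real \<Rightarrow> real)
     \<Rightarrow> ('n \<Rightarrow> real \<Rightarrow> real) \<Rightarrow> real \<Rightarrow> (real \<Rightarrow> real ^ 'n::finite) \<Rightarrow> real" where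
  "cost T p l ls g gs y =
     (\<integral>\<tau>. running_cost T p l ls y \<tau> \<partial>lebesgue_on {0<..<T}) + terminal_cost g gs (y T)"

definition optimal_trajectories ::
    "real \<Rightarrow> real \<Rightarrow> ('n \<Rightarrow> real \<Rightarrow> real \<Rightarrow> real \<Rightarrow> real) \<Rightarrow> (real \<Rightarrow> real)
     \<Rightarrow> ('n \<Rightarrow> real \<Rightarrow> real) \<Rightarrow> real \<Rightarrow> real ^ 'n \<Rightarrow> (real \<Rightarrow> real ^ 'n::finite) set" where
  "optimal_trajectories T p l ls g gs x =
     {y \<in> trajectories T p x.
        cost T p l ls g gs y = (INF z \<in> trajectories T p x. cost T p l ls g gs z)}"

definition modulus_of_continuity :: "(real \<Rightarrow> real) \<Rightarrow> bool" where
  "modulus_of_continuity \<omega> \<longleftrightarrow> mono_on {0..} \<omega> \<and> \<omega> 0 = 0 \<and> (\<omega> \<longlongrightarrow> 0) (at_right 0)"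

definition strictly_convex :: "(real \<Rightarrow> real) \<Rightarrow> bool" where
  "strictly_convex f \<longleftrightarrow> (\<forall>a b u. a \<noteq> b \<longrightarrow> 0 < u \<longrightarrow> u < 1 \<longrightarrow>
     f ((1 - u) * a + u * b) < (1 - u) * f a + u * f b)"

text \<open>One-sided in \<open>y\<close> at \<open>y = 0\<close>, the end of the domain.\<close>

definition partial_y :: "(real \<Rightarrow> real \<Rightarrow> real \<Rightarrow> real) \<Rightarrow> real \<Rightarrow> real \<Rightarrow> real \<Rightarrow> real" where
  "partial_y f y a s = vector_derivative (\<lambda>z. f z a s) (at y within {0..})"

definition partial_a :: "(real \<Rightarrow> real \<Rightarrow> real \<Rightarrow> real) \<Rightarrow> real \<Rightarrow> real \<Rightarrow> real \<Rightarrow> real" where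
  "partial_a f y a s = deriv (\<lambda>b. f y b s) a"

text \<open>The constants in the bounds may depend on the edge \<open>i\<close>.\<close>

locale standing_assumptions =
  fixes T p :: real
    and l :: "'n::finite \<Rightarrow> real \<Rightarrow> real \<Rightarrow> real \<Rightarrow> real"
    and ls :: "real \<Rightarrow> real"
    and g :: "'n \<Rightarrow> real \<Rightarrow> real"
  assumes g_continuous: "\<And>i. continuous_on {0..} (g i)"
    and g_bounded: "\<And>i. bounded (g i ` {0..})"
    and ls_continuous: "continuous_on {0..T} ls"
    and l_continuous:
      "\<And>i. continuous_on ({0..} \<times> UNIV \<times> {0..T}) (\<lambda>(y, a, s). l i y a s)"
    and l_differentiable:
      "\<And>i y a s. y \<ge> 0 \<Longrightarrow> s \<in> {0..T} \<Longrightarrow>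
         (\<lambda>(z, b). l i z b s) differentiable (at (y, a) within {0..} \<times> UNIV)"
    and partial_y_continuous:
      "\<And>i. continuous_on ({0..} \<times> UNIV \<times> {0..T}) (\<lambda>(y, a, s). partial_y (l i) y a s)"
    and partial_a_continuous:
      "\<And>i. continuous_on ({0..} \<times> UNIV \<times> {0..T}) (\<lambda>(y, a, s). partial_a (l i) y a s)"
    and H1: "\<And>i. \<exists>C0>0.
         (\<forall>y\<ge>0. \<forall>a. \<forall>s\<in>{0..T}. l i y a s \<ge> C0 * (\<bar>a\<bar> powr p - 1)) \<and>
         (\<forall>s\<in>{0..T}. ls s \<ge> - C0)"
    and H2: "\<And>i r. r > 0 \<Longrightarrow> \<exists>\<omega>. modulus_of_continuity \<omega> \<and>
         (\<forall>y\<in>{0..r}. \<forall>a. \<forall>t1\<in>{0..T}. \<forall>t2\<in>{0..T}.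
            \<bar>l i y a t1 - l i y a t2\<bar> \<le> (1 + \<bar>a\<bar> powr p) * \<omega> \<bar>t1 - t2\<bar>)"
    and H3: "\<And>i r. r > 0 \<Longrightarrow> \<exists>c\<ge>0. \<forall>y\<in>{0..r}. \<forall>a. \<forall>s\<in>{0..T}.
         \<bar>partial_y (l i) y a s\<bar> \<le> c * (\<bar>a\<bar> powr p + 1) \<and>
         \<bar>partial_a (l i) y a s\<bar> \<le> c * (\<bar>a\<bar> powr (p - 1) + 1)"
    and H4: "\<And>i y s. y \<ge> 0 \<Longrightarrow> s \<in> {0..T} \<Longrightarrow> strictly_convex (\<lambda>a. l i y a s)"

end

theory Submission imports Defs begin

text \<open>The direct method. Along the junction the norm is the sum of the coordinates, so the running cost is a
  function of the coordinates and of their weak derivatives, which vanish almost everywhere where the coordinates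
  do. Optimality bounds the energies of the \<open>ys n\<close>; hence their limit \<open>y\<close> has a velocity in \<open>L\<^sup>p\<close>, and the
  velocities converge weakly to it. Convexity of the running cost in the velocity then gives lower semicontinuity
  of the cost. At the vertex the tangent line inequality is applied coordinatewise, as the slope depends on the edge
  along which \<open>ys n\<close> leaves. Conversely, every competitor from \<open>x\<close> is modified on a short initial time
  interval into a competitor from \<open>xs n\<close> at a small extra cost.\<close>

section \<open>Velocities and integration by parts\<close>

text \<open>The cost is built on weak derivatives, given by testing against smooth functions and
  picked by \<open>SOME\<close>, whereas the estimates need \<open>y\<close> to be the primitive of
  its derivative. For continuous functions both notions agree: integration by parts gives one
  direction, the du Bois-Reymond argument with explicit smooth bumps the other. The cost also
  contains the derivative of \<open>norm (y t)\<close>; as the norm is linear in the coordinates on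
  the junction, no chain rule for the norm is required. The obstacle to lower semicontinuity is that
  weak convergence can be tested only against bounded slopes, and that a trajectory near
  \<open>y\<close> is known to be on the edge of \<open>y\<close> only where
  \<open>norm (y t)\<close> is bounded away from 0. The tangent line inequality is therefore used on
  the set where \<open>v\<close> is bounded and \<open>y\<close> is either 0 or not close to 0. The
  complement of this set has small measure, and there the lower bound of the cost suffices. Where
  \<open>y = 0\<close>, the velocity of \<open>y\<close> vanishes almost everywhere and the vertex
  cost is at most each \<open>l i 0 0\<close>, so that any edge chosen by the approximating
  trajectory is admissible.\<close>

abbreviation leb :: "real \<Rightarrow> real measure" where
  "leb T \<equiv> lebesgue_on {0<..<T}"

text \<open>Absolute continuity on the closed interval with derivative in \<open>Lp T p\<close>,
  encoded through the primitive. In contrast to \<open>is_weak_deriv\<close>, this fixes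
  \<open>y\<close> at every point of \<open>{0..T}\<close>, end points included; only
  \<open>v\<close> remains determined up to null sets.\<close>

definition velocity :: "real \<Rightarrow> real \<Rightarrow> (real \<Rightarrow> 'a::euclidean_space) \<Rightarrow> (real \<Rightarrow> 'a) \<Rightarrow> bool" where
  "velocity T p y v \<longleftrightarrow> v \<in> Lp T p \<and> (\<forall>t\<in>{0..T}. (v has_integral (y t - y 0)) {0..t})"

lemma space_leb [simp]: "space (leb T) = {0<..<T}"
  by simp

lemma finite_measure_leb: "finite_measure (leb T)"
  by (rule finite_measureI) (cases "0 \<le> T"; simp add: emeasure_restrict_space)

lemma measure_leb: "0 \<le> T \<Longrightarrow> measure (leb T) (space (leb T)) = T"
  by (simp add: measure_restrict_space)

text \<open>The bridge between the two integrals in use: costs are Bochner integrals on the open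
  interval, primitives are gauge integrals on closed ones. The end points form a null set.\<close>

lemma integrable_leb_iff:
  fixes f :: "real \<Rightarrow> 'a::euclidean_space"
  shows "integrable (leb T) f \<longleftrightarrow> f absolutely_integrable_on {0..T}"
  by (subst absolutely_integrable_on_Icc_iff_Ioo) (simp add: set_integrable_def integrable_restrict_space)

lemma integral_leb:
  fixes f :: "real \<Rightarrow> 'a::euclidean_space"
  assumes "integrable (leb T) f"
  shows "(\<integral>t. f t \<partial>leb T) = integral {0..T} f"
proof -
  have "(\<integral>t. f t \<partial>leb T) = integral {0<..<T} f"
    using assms by (rule lebesgue_integral_eq_integral) simp
  also have "\<dots> = integral {0..T} f"
    by (simp add: integral_open_interval_real)
  finally show ?thesis .
qed

lemma borel_measurable_leb_continuous:
  fixes f :: "real \<Rightarrow> 'a::euclidean_space"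
  assumes "continuous_on {0..T} f"
  shows "f \<in> borel_measurable (leb T)"
  using assms by (intro continuous_imp_measurable_on_sets_lebesgue)
    (auto intro: continuous_on_subset)

lemma integrable_leb_continuous:
  fixes f :: "real \<Rightarrow> 'a::euclidean_space"
  assumes "continuous_on {0..T} f"
  shows "integrable (leb T) f"
  using assms by (simp add: integrable_leb_iff absolutely_integrable_continuous_real)

lemma Lp_imp_integrable:
  fixes v :: "real \<Rightarrow> 'a::euclidean_space"
  assumes "v \<in> Lp T p" "1 \<le> p"
  shows "integrable (leb T) v"
proof -
  interpret finite_measure "leb T" by (rule finite_measure_leb)
  have bound: "norm (v t) \<le> 1 + norm (v t) powr p" for t
  proof (cases "norm (v t) \<le> 1")
    case False
    then have "norm (v t) powr 1 \<le> norm (v t) powr p"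
      using assms by (intro powr_mono) auto
    then show ?thesis using False by simp
  qed (simp add: add_increasing2)
  show ?thesis
  proof (rule Bochner_Integration.integrable_bound)
    show "integrable (leb T) (\<lambda>t. 1 + norm (v t) powr p)"
      using assms(1) by (simp add: Lp_def)
    show "v \<in> borel_measurable (leb T)"
      using assms(1) by (simp add: Lp_def)
    show "AE t in leb T. norm (v t) \<le> norm (1 + norm (v t) powr p)"
      using order_trans[OF bound abs_ge_self] by (intro AE_I2) simp
  qed
qed

text \<open>Both factors are merely absolutely continuous, so the product cannot be differentiated
  pointwise. Instead the defect \<open>D\<close> of the identity is additive over adjacent intervals
  and, by uniform smallness of the increments, at most \<open>\<epsilon>\<close> times the integral
  of \<open>\<bar>\<phi>'\<bar> + norm v\<close> on short ones. Bisection carries the bound over to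
  the whole interval.\<close>

lemma has_integral_scaleR_by_parts:
  fixes \<phi> \<phi>' :: "real \<Rightarrow> real" and u v :: "real \<Rightarrow> 'a::euclidean_space"
  assumes "a \<le> b"
    and \<phi>': "\<phi>' absolutely_integrable_on {a..b}" and v: "v absolutely_integrable_on {a..b}"
    and \<phi>: "\<And>t. t \<in> {a..b} \<Longrightarrow> (\<phi>' has_integral (\<phi> t - \<phi> a)) {a..t}"
    and u: "\<And>t. t \<in> {a..b} \<Longrightarrow> (v has_integral (u t - u a)) {a..t}"
  shows "((\<lambda>t. \<phi>' t *\<^sub>R u t + \<phi> t *\<^sub>R v t) has_integral (\<phi> b *\<^sub>R u b - \<phi> a *\<^sub>R u a)) {a..b}"
proof -
  have cont: "continuous_on {a..b} f"
    if "\<And>t. t \<in> {a..b} \<Longrightarrow> (f' has_integral (f t - f a)) {a..t}" for f f' :: "real \<Rightarrow> 'b::euclidean_space"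
  proof -
    have "f' integrable_on {a..b}" using that[of b] \<open>a \<le> b\<close> by auto
    then have "continuous_on {a..b} (\<lambda>x. f a + integral {a..x} f')"
      by (intro continuous_intros indefinite_integral_continuous_1)
    then show ?thesis
      by (rule continuous_on_eq) (use that in \<open>force dest: integral_unique\<close>)
  qed
  note c\<phi> = cont[OF \<phi>] and cu = cont[OF u]
  have hi: "(f' has_integral (f t - f s)) {s..t}"
    if "\<And>t. t \<in> {a..b} \<Longrightarrow> (f' has_integral (f t - f a)) {a..t}" "a \<le> s" "s \<le> t" "t \<le> b"
    for f f' :: "real \<Rightarrow> 'b::euclidean_space" and s t
  proof -
    have "f' integrable_on {s..t}"
      using has_integral_integrable[OF that(1)[of t]] that(2-)
      by (auto intro: integrable_subinterval_real[of f' a t s t])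
    moreover have "integral {a..s} f' + integral {s..t} f' = integral {a..t} f'"
      using that(2-) has_integral_integrable[OF that(1)[of t]]
      by (intro Henstock_Kurzweil_Integration.integral_combine) auto
    ultimately show ?thesis
      using integral_unique[OF that(1)[of s]] integral_unique[OF that(1)[of t]] that(2-)
      by (simp add: has_integral_iff algebra_simps)
  qed
  define w where "w t = \<phi>' t *\<^sub>R u t + \<phi> t *\<^sub>R v t" for t
  have "(\<lambda>t. \<phi>' t *\<^sub>R u t) absolutely_integrable_on {a..b}"
    using absolutely_integrable_bounded_measurable_product[of "\<lambda>x y. y *\<^sub>R x" u "{a..b}" \<phi>']
      cu compact_imp_bounded[OF compact_continuous_image[OF cu compact_Icc]]
      continuous_imp_measurable_on_sets_lebesgue[OF cu] \<phi>'
    by (simp add: bilinear_conv_bounded_bilinear bounded_bilinear.flip[OF bounded_bilinear_scaleR])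
  moreover have "(\<lambda>t. \<phi> t *\<^sub>R v t) absolutely_integrable_on {a..b}"
    using absolutely_integrable_bounded_measurable_product[of "\<lambda>x y. x *\<^sub>R y" \<phi> "{a..b}" v]
      compact_imp_bounded[OF compact_continuous_image[OF c\<phi> compact_Icc]]
      continuous_imp_measurable_on_sets_lebesgue[OF c\<phi>] v
    by (simp add: bilinear_conv_bounded_bilinear bounded_bilinear_scaleR)
  ultimately have "w absolutely_integrable_on {a..b}"
    unfolding w_def by (rule set_integral_add(1))
  then have w: "w integrable_on {s..t}" if "a \<le> s" "t \<le> b" for s t
    using that by (intro integrable_subinterval_real[OF set_lebesgue_integral_eq_integral(1)]) auto
  define m where "m t = \<bar>\<phi>' t\<bar> + norm (v t)" for t
  have "m integrable_on {a..b}"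
    using set_lebesgue_integral_eq_integral(1)[OF set_integrable_norm[OF \<phi>']]
      set_lebesgue_integral_eq_integral(1)[OF set_integrable_norm[OF v]]
    unfolding m_def by (intro integrable_add) auto
  then have m: "m integrable_on {s..t}" if "a \<le> s" "t \<le> b" for s t
    using that by (intro integrable_subinterval_real[of m a b s t]) auto
  define D where "D s t = \<phi> t *\<^sub>R u t - \<phi> s *\<^sub>R u s - integral {s..t} w" for s t
  have bound: "norm (D a b) \<le> \<epsilon> * integral {a..b} m" if "\<epsilon> > 0" for \<epsilon>
  proof -
    \<comment> \<open>The guard makes \<open>P\<close> trivial for intervals that leave
      \<open>{a..b}\<close>: the local step of the bisection ranges over all short intervals around
      a point, also at the end points.\<close>
    define P where "P s t \<longleftrightarrow> (a \<le> s \<and> t \<le> b \<longrightarrow> norm (D s t) \<le> \<epsilon> * integral {s..t} m)" for s t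
    have "P a b"
      using \<open>a \<le> b\<close>
    proof (induction rule: Bolzano)
      case (trans r s t)
      show ?case unfolding P_def
      proof
        assume *: "a \<le> r \<and> t \<le> b"
        have "integral {r..s} w + integral {s..t} w = integral {r..t} w"
          "integral {r..s} m + integral {s..t} m = integral {r..t} m"
          using trans * by (auto intro!: Henstock_Kurzweil_Integration.integral_combine w m)
        note int = this[symmetric]
        have "norm (D r t) = norm (D r s + D s t)"
          by (simp add: D_def int algebra_simps)
        also have "\<dots> \<le> norm (D r s) + norm (D s t)"
          by (rule norm_triangle_ineq)
        also have "\<dots> \<le> \<epsilon> * integral {r..s} m + \<epsilon> * integral {s..t} m"
          using trans * by (intro add_mono) (auto simp: P_def)
        finally show "norm (D r t) \<le> \<epsilon> * integral {r..t} m"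
          by (simp add: int distrib_left)
      qed
    next
      case (local x)
      then have "x \<in> {a..b}" by simp
      have e2: "\<epsilon> / 2 > 0" using \<open>\<epsilon> > 0\<close> by simp
      obtain d1 where d1: "d1 > 0"
        "\<And>t. t \<in> {a..b} \<Longrightarrow> dist t x < d1 \<Longrightarrow> dist (\<phi> t) (\<phi> x) < \<epsilon> / 2"
        using c\<phi> \<open>x \<in> {a..b}\<close> e2 unfolding continuous_on_iff by blast
      obtain d2 where d2: "d2 > 0"
        "\<And>t. t \<in> {a..b} \<Longrightarrow> dist t x < d2 \<Longrightarrow> dist (u t) (u x) < \<epsilon> / 2"
        using cu \<open>x \<in> {a..b}\<close> e2 unfolding continuous_on_iff by blast
      note d = d1 d2
      show ?case unfolding P_def
      proof (intro exI[of _ "min d1 d2"] conjI allI impI)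
        fix s t assume st: "s \<le> x \<and> x \<le> t \<and> t - s < min d1 d2" "a \<le> s \<and> t \<le> b"
        have near: "norm (\<phi> t - \<phi> r) \<le> \<epsilon>" "norm (u s - u r) \<le> \<epsilon>" if "r \<in> {s..t}" for r
        proof -
          have "dist r x < d1" "dist t x < d1" "dist r x < d2" "dist s x < d2"
            using that st by (auto simp: dist_real_def)
          then have "dist (\<phi> t) (\<phi> x) < \<epsilon> / 2" "dist (\<phi> r) (\<phi> x) < \<epsilon> / 2"
            "dist (u r) (u x) < \<epsilon> / 2" "dist (u s) (u x) < \<epsilon> / 2"
            using d that st by auto
          then show "norm (\<phi> t - \<phi> r) \<le> \<epsilon>" "norm (u s - u r) \<le> \<epsilon>"
            unfolding dist_norm[symmetric]
            by (meson dist_triangle_half_l less_imp_le)+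
        qed
        \<comment> \<open>Freezing \<open>\<phi>\<close> at the right end and \<open>u\<close> at
          the left end splits the increment of the product exactly, so no quadratic remainder is
          left.\<close>
        have 1: "((\<lambda>r. \<phi> t *\<^sub>R v r + \<phi>' r *\<^sub>R u s - w r) has_integral
            \<phi> t *\<^sub>R (u t - u s) + (\<phi> t - \<phi> s) *\<^sub>R u s - integral {s..t} w) {s..t}"
          using st hi[OF u, of s t] hi[OF \<phi>, of s t] w[of s t]
          by (intro has_integral_diff has_integral_add has_integral_cmul
              has_integral_scaleR_left integrable_integral) auto
        have "norm (\<phi> t *\<^sub>R (u t - u s) + (\<phi> t - \<phi> s) *\<^sub>R u s - integral {s..t} w)
            \<le> integral {s..t} (\<lambda>r. \<epsilon> * m r)"
        proof (rule order_trans[OF eq_refl integral_norm_bound_integral])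
          show "norm (\<phi> t *\<^sub>R (u t - u s) + (\<phi> t - \<phi> s) *\<^sub>R u s - integral {s..t} w)
            = norm (integral {s..t} (\<lambda>r. \<phi> t *\<^sub>R v r + \<phi>' r *\<^sub>R u s - w r))"
            using 1 by (simp add: integral_unique)
          show "(\<lambda>r. \<phi> t *\<^sub>R v r + \<phi>' r *\<^sub>R u s - w r) integrable_on {s..t}"
            using 1 by blast
          show "(\<lambda>r. \<epsilon> * m r) integrable_on {s..t}"
            using m[of s t] st by (intro integrable_on_mult_right) auto
          fix r assume r: "r \<in> {s..t}"
          have "\<phi> t *\<^sub>R v r + \<phi>' r *\<^sub>R u s - w r = (\<phi> t - \<phi> r) *\<^sub>R v r + \<phi>' r *\<^sub>R (u s - u r)"
            by (simp add: w_def algebra_simps)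
          also have "norm \<dots> \<le> norm (\<phi> t - \<phi> r) * norm (v r) + \<bar>\<phi>' r\<bar> * norm (u s - u r)"
            by (rule norm_triangle_le) simp
          also have "\<dots> \<le> \<epsilon> * norm (v r) + \<bar>\<phi>' r\<bar> * \<epsilon>"
            using near[OF r] by (intro add_mono mult_mono) auto
          finally show "norm (\<phi> t *\<^sub>R v r + \<phi>' r *\<^sub>R u s - w r) \<le> \<epsilon> * m r"
            by (simp add: m_def algebra_simps)
        qed
        then show "norm (D s t) \<le> \<epsilon> * integral {s..t} m"
          by (simp add: D_def algebra_simps)
      qed (use d in auto)
    qed
    then show ?thesis by (simp add: P_def)
  qed
  have "norm (D a b) \<le> 0"
  proof (rule field_le_epsilon)
    fix e :: real assume "e > 0"
    have mb: "0 \<le> integral {a..b} m"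
      by (rule Henstock_Kurzweil_Integration.integral_nonneg) (use m[of a b] in \<open>auto simp: m_def\<close>)
    have "norm (D a b) \<le> e / (1 + integral {a..b} m) * integral {a..b} m"
      using \<open>e > 0\<close> mb by (intro bound) (auto simp: field_simps)
    also have "\<dots> \<le> e"
      using \<open>e > 0\<close> mb by (simp add: field_simps)
    finally show "norm (D a b) \<le> 0 + e" by simp
  qed
  then have "integral {a..b} w = \<phi> b *\<^sub>R u b - \<phi> a *\<^sub>R u a"
    by (simp add: D_def)
  with w[of a b] show ?thesis
    unfolding w_def by (auto simp: has_integral_iff)
qed

section \<open>Testing velocities against bounded functions\<close>

lemma velocity_continuous:
  fixes y v :: "real \<Rightarrow> 'a::euclidean_space"
  assumes v: "velocity T p y v"
  shows "continuous_on {0..T} y"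
proof (cases "0 \<le> T")
  case True
  have y: "(v has_integral (y t - y 0)) {0..t}" if "t \<in> {0..T}" for t
    using v that by (simp add: velocity_def)
  have "v integrable_on {0..T}" using y[of T] True by auto
  then have "continuous_on {0..T} (\<lambda>t. y 0 + integral {0..t} v)"
    by (intro continuous_intros indefinite_integral_continuous_1)
  then show ?thesis
    by (rule continuous_on_eq) (use integral_unique[OF y] in auto)
qed auto

lemma velocity_imp_weak_deriv:
  fixes y v :: "real \<Rightarrow> 'a::euclidean_space"
  assumes v: "velocity T p y v" and "0 < T" "1 \<le> p"
  shows "is_weak_deriv T p y v"
  unfolding is_weak_deriv_def
proof (intro conjI ballI)
  show Lp: "v \<in> Lp T p" using v by (simp add: velocity_def)
  have iv: "v absolutely_integrable_on {0..T}"
    using Lp_imp_integrable[OF Lp] assms by (simp add: integrable_leb_iff)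
  have y: "(v has_integral (y t - y 0)) {0..t}" if "t \<in> {0..T}" for t
    using v that by (simp add: velocity_def)
  fix \<phi> assume "\<phi> \<in> test_functions T"
  then have supp: "closure {t. \<phi> t \<noteq> 0} \<subseteq> {0<..<T}"
    and diff: "\<And>k. (deriv ^^ k) \<phi> differentiable_on UNIV"
    by (auto simp: test_functions_def)
  have zero: "\<phi> 0 = 0" "\<phi> T = 0"
    using supp closure_subset[of "{t. \<phi> t \<noteq> 0}"] by force+
  have d: "(\<phi> has_real_derivative deriv \<phi> t) (at t)" for t
    using diff[of 0] by (auto simp: differentiable_on_def DERIV_deriv_iff_real_differentiable)
  have cd: "continuous_on {0..T} (deriv \<phi>)"
    using differentiable_imp_continuous_on[OF diff[of 1]] by (auto intro: continuous_on_subset)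
  have c: "continuous_on {0..T} \<phi>"
    using differentiable_imp_continuous_on[OF diff[of 0]] by (auto intro: continuous_on_subset)
  have "(deriv \<phi> has_integral (\<phi> t - \<phi> 0)) {0..t}" if "t \<in> {0..T}" for t
    using that d by (intro fundamental_theorem_of_calculus)
      (auto simp: has_real_derivative_iff_has_vector_derivative[symmetric] intro: has_field_derivative_at_within)
  then have parts: "((\<lambda>t. deriv \<phi> t *\<^sub>R y t + \<phi> t *\<^sub>R v t) has_integral 0) {0..T}"
    using has_integral_scaleR_by_parts[of 0 T "deriv \<phi>" v \<phi> y] zero assms iv y cd
    by (simp add: absolutely_integrable_continuous_real)
  have cy: "continuous_on {0..T} y" using v by (rule velocity_continuous)
  have 1: "integrable (leb T) (\<lambda>t. deriv \<phi> t *\<^sub>R y t)"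
    using cd cy by (intro integrable_leb_continuous continuous_intros)
  have 2: "integrable (leb T) (\<lambda>t. \<phi> t *\<^sub>R v t)"
    using absolutely_integrable_bounded_measurable_product[of "\<lambda>x y. x *\<^sub>R y" \<phi> "{0..T}" v]
      compact_imp_bounded[OF compact_continuous_image[OF c compact_Icc]]
      continuous_imp_measurable_on_sets_lebesgue[OF c] iv
    by (simp add: bilinear_conv_bounded_bilinear bounded_bilinear_scaleR integrable_leb_iff)
  have "(\<integral>t. deriv \<phi> t *\<^sub>R y t \<partial>leb T) + (\<integral>t. \<phi> t *\<^sub>R v t \<partial>leb T) = 0"
    using 1 2 integral_unique[OF parts] integral_leb[OF Bochner_Integration.integrable_add[OF 1 2]]
    by simp
  then show "(\<integral>t. deriv \<phi> t *\<^sub>R y t \<partial>leb T) = - (\<integral>t. \<phi> t *\<^sub>R v t \<partial>leb T)"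
    by (simp add: eq_neg_iff_add_eq_0)
qed

text \<open>Quantitative uniform integrability, used in place of Hoelder's inequality: above the
  threshold \<open>c\<close> one writes \<open>a = a powr (1 - p) * a powr p\<close>, where the
  exponent \<open>1 - p\<close> is not positive. For \<open>p > 1\<close> the factor
  \<open>c powr (1 - p)\<close> is small for large \<open>c\<close>.\<close>

lemma le_add_powr:
  fixes a c p :: real
  assumes "0 \<le> a" "0 < c" "1 \<le> p"
  shows "a \<le> c + c powr (1 - p) * a powr p"
proof (cases "a \<le> c")
  case False
  then have "c powr (1 - p) * a powr p \<ge> a powr (1 - p) * a powr p"
    using assms by (intro mult_right_mono powr_mono2') auto
  also have "a powr (1 - p) * a powr p = a"
    using False assms by (simp flip: powr_add)
  finally show ?thesis using assms by simp
qed (use assms in \<open>simp add: add_increasing2\<close>)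

text \<open>Measurability supplies continuous functions converging to \<open>h\<close> off a null
  set. Clamping them to \<open>[-B, B]\<close> does not move the limit, since \<open>h\<close> has
  the same bound, and makes dominated convergence applicable.\<close>

lemma continuous_L1_approximation:
  fixes h :: "real \<Rightarrow> real"
  assumes h: "h \<in> borel_measurable (leb T)" and B: "\<And>t. \<bar>h t\<bar> \<le> B" and "0 < e"
  obtains k where "continuous_on UNIV k" "\<And>t. \<bar>k t\<bar> \<le> B" "(\<integral>t. \<bar>h t - k t\<bar> \<partial>leb T) < e"
proof -
  interpret finite_measure "leb T" by (rule finite_measure_leb)
  have "h measurable_on {0<..<T}"
    using h by (simp add: measurable_on_iff_borel_measurable)
  then obtain N g where N: "negligible N" and g: "\<And>n. continuous_on UNIV (g n)"
    and lim: "\<And>t. t \<notin> N \<Longrightarrow> (\<lambda>n. g n t) \<longlonglongrightarrow> (if t \<in> {0<..<T} then h t else 0)"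
    unfolding measurable_on_def by blast
  define k where "k n t = max (- B) (min B (g n t))" for n :: nat and t
  have k: "continuous_on UNIV (k n)" for n
    unfolding k_def by (intro continuous_intros g)
  have B0: "0 \<le> B" using B[of 0] by linarith
  have kB: "\<bar>k n t\<bar> \<le> B" for n t
    using B0 by (auto simp: k_def)
  have km: "k n \<in> borel_measurable (leb T)" for n
    using k[of n] by (intro borel_measurable_leb_continuous) (auto intro: continuous_on_subset)
  have "AE t in lebesgue. t \<notin> N"
    using N by (auto simp: negligible_iff_null_sets intro: AE_not_in)
  then have "AE t in leb T. t \<notin> N"
    by (subst AE_restrict_space_iff) auto
  moreover have "AE t in leb T. t \<in> {0<..<T}"
    by (rule AE_I2) simp
  ultimately have ae: "AE t in leb T. (\<lambda>n. \<bar>h t - k n t\<bar>) \<longlonglongrightarrow> 0"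
  proof eventually_elim
    case (elim t)
    have "(\<lambda>n. k n t) \<longlonglongrightarrow> max (- B) (min B (h t))"
      unfolding k_def using lim[of t] elim by (intro tendsto_intros) auto
    also have "max (- B) (min B (h t)) = h t" using B[of t] by auto
    finally have "(\<lambda>n. \<bar>h t - k n t\<bar>) \<longlonglongrightarrow> \<bar>h t - h t\<bar>"
      by (intro tendsto_intros)
    then show ?case by simp
  qed
  have "(\<lambda>n. \<integral>t. \<bar>h t - k n t\<bar> \<partial>leb T) \<longlonglongrightarrow> (\<integral>t. 0 \<partial>leb T)"
  proof (rule integral_dominated_convergence[where w = "\<lambda>_. 2 * B"])
    show "AE t in leb T. norm \<bar>h t - k n t\<bar> \<le> 2 * B" for n
      using B kB[of n] by (intro AE_I2) (smt (verit) real_norm_def)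
  qed (use h km ae in auto)
  then have "\<forall>\<^sub>F n in sequentially. (\<integral>t. \<bar>h t - k n t\<bar> \<partial>leb T) < e"
    using \<open>0 < e\<close> by (intro order_tendstoD) auto
  then obtain n where "(\<integral>t. \<bar>h t - k n t\<bar> \<partial>leb T) < e"
    by (auto simp: eventually_sequentially)
  with k kB that show ?thesis by blast
qed

text \<open>A polynomial approximation of \<open>h\<close> costs a multiple of the \<open>L1\<close>
  bound \<open>K\<close>. Polynomials have derivatives, so integration by parts shifts the integral
  onto the primitives of \<open>w n\<close>, which are uniformly small.\<close>

lemma continuous_test_small:
  fixes w :: "nat \<Rightarrow> real \<Rightarrow> real"
  assumes T: "0 < T" and int: "\<And>n. integrable (leb T) (w n)"
    and K: "\<And>n. (\<integral>t. \<bar>w n t\<bar> \<partial>leb T) \<le> K"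
    and W: "uniform_limit {0..T} (\<lambda>n t. integral {0..t} (w n)) (\<lambda>_. 0) sequentially"
    and h: "continuous_on {0..T} h"
  shows "(\<lambda>n. \<integral>t. h t * w n t \<partial>leb T) \<longlonglongrightarrow> 0"
proof (rule LIMSEQ_I)
  fix e :: real assume "0 < e"
  have K0: "0 \<le> K" using K[of 0] by (rule order_trans[rotated]) simp
  \<comment> \<open>The polynomial error gets \<open>e / 2\<close> through \<open>\<eta>\<close>;
    the boundary term and the term with \<open>P'\<close> together get \<open>e / 4\<close> through
    \<open>\<mu>\<close> below. The added 1 keeps the denominators positive.\<close>
  define \<eta> where "\<eta> = e / (2 * (K + 1))"
  have \<eta>: "0 < \<eta>" using \<open>0 < e\<close> K0 by (simp add: \<eta>_def)
  obtain P where P: "real_polynomial_function P" and hP: "\<And>t. t \<in> {0..T} \<Longrightarrow> \<bar>h t - P t\<bar> < \<eta>"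
    using Stone_Weierstrass_real_polynomial_function[OF compact_Icc h \<eta>] by blast
  obtain P' where P': "real_polynomial_function P'" and dP: "\<And>t. (P has_real_derivative P' t) (at t)"
    using has_real_derivative_polynomial_function[OF P] by blast
  have cP: "continuous_on S P" "continuous_on S P'" for S
    using P P' continuous_on_polymonial_function real_polynomial_function_eq by blast+
  obtain C where C: "\<And>t. t \<in> {0..T} \<Longrightarrow> \<bar>P' t\<bar> \<le> C"
    using compact_imp_bounded[OF compact_continuous_image[OF cP(2) compact_Icc]]
    unfolding bounded_iff by (metis imageI real_norm_def)
  have C0: "0 \<le> C" using C[of 0] T by simp
  define \<mu> where "\<mu> = e / (4 * (\<bar>P T\<bar> + T * C + 1))"
  have \<mu>: "0 < \<mu>" using \<open>0 < e\<close> C0 T by (auto simp: \<mu>_def intro!: divide_pos_pos add_nonneg_pos)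
  from uniform_limitD[OF W \<mu>] have "\<exists>n0. \<forall>n\<ge>n0. \<forall>t\<in>{0..T}. \<bar>integral {0..t} (w n)\<bar> < \<mu>"
    by (simp add: eventually_sequentially)
  then obtain n0 where n0: "\<And>n t. n \<ge> n0 \<Longrightarrow> t \<in> {0..T} \<Longrightarrow> \<bar>integral {0..t} (w n)\<bar> < \<mu>"
    by blast
  have wi: "w n absolutely_integrable_on {0..T}" for n
    using int by (simp add: integrable_leb_iff)
  have prod: "integrable (leb T) (\<lambda>t. k t * w n t)" if k: "continuous_on {0..T} k" for k n
    using absolutely_integrable_bounded_measurable_product_real[OF continuous_imp_measurable_on_sets_lebesgue[OF k] _
        compact_imp_bounded[OF compact_continuous_image[OF k compact_Icc]] wi]
    by (simp add: integrable_leb_iff)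
  have "norm ((\<integral>t. h t * w n t \<partial>leb T) - 0) < e" if n: "n \<ge> n0" for n
  proof -
    define u where "u t = integral {0..t} (w n)" for t
    have u: "(w n has_integral (u t - u 0)) {0..t}" if "t \<in> {0..T}" for t
    proof -
      have "w n integrable_on {0..t}"
        using that by (intro integrable_subinterval_real[OF set_lebesgue_integral_eq_integral(1)[OF wi[of n]]]) auto
      then show ?thesis by (auto simp: u_def)
    qed
    have P'i: "(P' has_integral (P t - P 0)) {0..t}" if "t \<in> {0..T}" for t
      using that dP by (intro fundamental_theorem_of_calculus)
        (auto simp: has_real_derivative_iff_has_vector_derivative[symmetric] intro: has_field_derivative_at_within)
    have "((\<lambda>t. P' t *\<^sub>R u t + P t *\<^sub>R w n t) has_integral (P T *\<^sub>R u T - P 0 *\<^sub>R u 0)) {0..T}"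
      using T by (intro has_integral_scaleR_by_parts[OF _ absolutely_integrable_continuous_real[OF cP(2)] wi] u P'i) auto
    then have parts: "integral {0..T} (\<lambda>t. P' t * u t + P t * w n t) = P T * u T"
      by (auto dest: integral_unique simp: u_def)
    have cu: "continuous_on {0..T} u"
      unfolding u_def by (intro indefinite_integral_continuous_1 set_lebesgue_integral_eq_integral(1)[OF wi])
    have i1: "integrable (leb T) (\<lambda>t. P' t * u t)"
      using cP cu by (intro integrable_leb_continuous continuous_intros)
    note i2 = prod[OF cP(1), of n]
    have "(\<integral>t. P' t * u t \<partial>leb T) + (\<integral>t. P t * w n t \<partial>leb T) = P T * u T"
      using i1 i2 parts integral_leb[OF Bochner_Integration.integrable_add[OF i1 i2]] by simp
    then have "\<bar>\<integral>t. P t * w n t \<partial>leb T\<bar> \<le> \<bar>P T\<bar> * \<bar>u T\<bar> + \<bar>\<integral>t. P' t * u t \<partial>leb T\<bar>"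
      by (simp flip: abs_mult)
    also have "\<bar>\<integral>t. P' t * u t \<partial>leb T\<bar> \<le> (\<integral>t. C * \<mu> \<partial>leb T)"
    proof (rule integral_abs_bound_integral[OF i1])
      show "integrable (leb T) (\<lambda>t. C * \<mu>)" by (intro integrable_leb_continuous continuous_intros)
      show "\<bar>P' t * u t\<bar> \<le> C * \<mu>" if "t \<in> space (leb T)" for t
        using that C[of t] n0[OF n, of t] C0 unfolding abs_mult u_def by (intro mult_mono) auto
    qed
    also have "(\<integral>t. C * \<mu> \<partial>leb T) = T * C * \<mu>"
      using T measure_leb[of T] by simp
    also have "\<bar>P T\<bar> * \<bar>u T\<bar> \<le> \<bar>P T\<bar> * \<mu>"
      using n0[OF n, of T] T by (intro mult_left_mono) (auto simp: u_def)
    also have "\<bar>P T\<bar> * \<mu> + T * C * \<mu> = (\<bar>P T\<bar> + T * C) * \<mu>"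
      by (simp add: algebra_simps)
    also have "\<dots> \<le> (\<bar>P T\<bar> + T * C + 1) * \<mu>"
      using \<mu> by (intro mult_right_mono) auto
    also have "\<dots> = e / 4"
    proof -
      have *: "x * (e / (4 * x)) = e / 4" if "0 < x" for x using that by simp
      have "0 < \<bar>P T\<bar> + T * C + 1" using C0 T by (intro add_nonneg_pos) auto
      from *[OF this] show ?thesis unfolding \<mu>_def .
    qed
    finally have 1: "\<bar>\<integral>t. P t * w n t \<partial>leb T\<bar> \<le> e / 4" by simp
    have "\<bar>\<integral>t. (h t - P t) * w n t \<partial>leb T\<bar> \<le> (\<integral>t. \<eta> * \<bar>w n t\<bar> \<partial>leb T)"
    proof (rule integral_abs_bound_integral)
      show "integrable (leb T) (\<lambda>t. (h t - P t) * w n t)"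
        using h cP by (intro prod continuous_intros)
      show "\<bar>(h t - P t) * w n t\<bar> \<le> \<eta> * \<bar>w n t\<bar>" if "t \<in> space (leb T)" for t
        using that hP[of t] unfolding abs_mult by (intro mult_right_mono) auto
    qed (use int[of n] in auto)
    also have "\<dots> \<le> \<eta> * K" using K[of n] \<eta> by simp
    also have "\<dots> \<le> e / 2" using K0 \<open>0 < e\<close> by (simp add: \<eta>_def field_simps)
    finally have 2: "\<bar>\<integral>t. (h t - P t) * w n t \<partial>leb T\<bar> \<le> e / 2" .
    have "(\<integral>t. h t * w n t \<partial>leb T) = (\<integral>t. (h t - P t) * w n t \<partial>leb T) + (\<integral>t. P t * w n t \<partial>leb T)"
      using prod[OF h, of n] i2 by (simp add: left_diff_distrib)
    with 1 2 \<open>0 < e\<close> show ?thesis by simp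
  qed
  then show "\<exists>n0. \<forall>n\<ge>n0. norm ((\<integral>t. h t * w n t \<partial>leb T) - 0) < e" by blast
qed

lemma Lp_bounded_imp_L1_bounded:
  fixes w :: "real \<Rightarrow> 'a::euclidean_space"
  assumes "0 < T" "1 \<le> p" "w \<in> Lp T p" "(\<integral>t. norm (w t) powr p \<partial>leb T) \<le> K"
  shows "(\<integral>t. norm (w t) \<partial>leb T) \<le> T + K"
proof -
  interpret finite_measure "leb T" by (rule finite_measure_leb)
  have i: "integrable (leb T) (\<lambda>t. norm (w t) powr p)"
    using assms by (simp add: Lp_def)
  have "(\<integral>t. norm (w t) \<partial>leb T) \<le> (\<integral>t. 1 + norm (w t) powr p \<partial>leb T)"
    using Lp_imp_integrable[OF assms(3)] assms i le_add_powr[of "norm (w t)" 1 p for t]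
    by (intro integral_mono) auto
  also have "\<dots> = T + (\<integral>t. norm (w t) powr p \<partial>leb T)"
    using i measure_leb[of T] \<open>0 < T\<close> by simp
  finally show ?thesis using assms by simp
qed

text \<open>Boundedness in \<open>L\<^sup>p\<close> with \<open>p > 1\<close> makes the sequence uniformly integrable, so it suffices to
  test against continuous functions, for which one integrates by parts.\<close>

lemma bounded_test_small:
  fixes w :: "nat \<Rightarrow> real \<Rightarrow> real"
  assumes T: "0 < T" and p: "1 < p" and Lp: "\<And>n. w n \<in> Lp T p"
    and K: "\<And>n. (\<integral>t. \<bar>w n t\<bar> powr p \<partial>leb T) \<le> K"
    and W: "uniform_limit {0..T} (\<lambda>n t. integral {0..t} (w n)) (\<lambda>_. 0) sequentially"
    and h: "h \<in> borel_measurable (leb T)" and B: "\<And>t. \<bar>h t\<bar> \<le> B"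
  shows "(\<lambda>n. \<integral>t. h t * w n t \<partial>leb T) \<longlonglongrightarrow> 0"
proof (rule LIMSEQ_I)
  interpret finite_measure "leb T" by (rule finite_measure_leb)
  fix e :: real assume "0 < e"
  have int: "integrable (leb T) (w n)" for n
    using Lp_imp_integrable[OF Lp] p by simp
  have intp: "integrable (leb T) (\<lambda>t. \<bar>w n t\<bar> powr p)" for n
    using Lp[of n] by (simp add: Lp_def)
  have K0: "0 \<le> K" using K[of 0] by (rule order_trans[rotated]) simp
  have B0: "0 \<le> B" using B[of 0] by linarith
  define \<eta> where "\<eta> = e / (4 * (2 * B * K + 1))"
  have BK: "0 < 2 * B * K + 1" using B0 K0 by (intro add_nonneg_pos) auto
  then have \<eta>: "0 < \<eta>" using \<open>0 < e\<close> by (simp add: \<eta>_def)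
  \<comment> \<open>The threshold at which the tail coefficient \<open>c powr (1 - p)\<close> of
    \<open>le_add_powr\<close> is exactly \<open>\<eta>\<close>. Since \<open>c\<close> may be
    large, the \<open>L1\<close> approximation \<open>k\<close> is chosen afterwards, with an error
    relative to \<open>c\<close>.\<close>
  define c where "c = \<eta> powr (1 / (1 - p))"
  have c: "0 < c" "c powr (1 - p) = \<eta>" using \<eta> p by (auto simp: c_def powr_powr)
  obtain k where k: "continuous_on UNIV k" "\<And>t. \<bar>k t\<bar> \<le> B" "(\<integral>t. \<bar>h t - k t\<bar> \<partial>leb T) < e / (4 * c)"
    using continuous_L1_approximation[OF h B, of "e / (4 * c)"] \<open>0 < e\<close> c(1) by auto
  have km: "k \<in> borel_measurable (leb T)"
    using k(1) by (intro borel_measurable_leb_continuous) (auto intro: continuous_on_subset)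
  have hk: "\<bar>h t - k t\<bar> \<le> 2 * B" for t using B[of t] k(2)[of t] by linarith
  have ihk: "integrable (leb T) (\<lambda>t. \<bar>h t - k t\<bar>)"
    using hk h km by (intro integrable_const_bound[where B = "2 * B"]) auto
  have ih: "integrable (leb T) (\<lambda>t. f t * w n t)"
    if "f \<in> borel_measurable (leb T)" "\<And>t. \<bar>f t\<bar> \<le> C" for f C n
  proof (rule Bochner_Integration.integrable_bound)
    show "integrable (leb T) (\<lambda>t. C * w n t)" using int by simp
    show "AE t in leb T. norm (f t * w n t) \<le> norm (C * w n t)"
      using order_trans[OF that(2) abs_ge_self] by (intro AE_I2) (auto simp: abs_mult intro!: mult_right_mono)
  qed (use that int[of n] in measurable)
  have "(\<lambda>n. \<integral>t. k t * w n t \<partial>leb T) \<longlonglongrightarrow> 0"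
    using k(1) Lp_bounded_imp_L1_bounded[OF T _ Lp] K p
    by (intro continuous_test_small[OF T int _ W, of "T + K"]) (auto intro: continuous_on_subset)
  then obtain n0 where n0: "\<And>n. n \<ge> n0 \<Longrightarrow> \<bar>\<integral>t. k t * w n t \<partial>leb T\<bar> < e / 2"
    using \<open>0 < e\<close> by (force dest: LIMSEQ_D[where r = "e / 2"])
  have "norm ((\<integral>t. h t * w n t \<partial>leb T) - 0) < e" if "n \<ge> n0" for n
  proof -
    have "\<bar>\<integral>t. (h t - k t) * w n t \<partial>leb T\<bar> \<le> (\<integral>t. c * \<bar>h t - k t\<bar> + 2 * B * \<eta> * (\<bar>w n t\<bar> powr p) \<partial>leb T)"
    proof (rule integral_abs_bound_integral)
      show "integrable (leb T) (\<lambda>t. (h t - k t) * w n t)"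
        using h km hk by (intro ih) auto
      show "integrable (leb T) (\<lambda>t. c * \<bar>h t - k t\<bar> + 2 * B * \<eta> * (\<bar>w n t\<bar> powr p))"
        using ihk intp[of n] by auto
      fix t
      have "\<bar>(h t - k t) * w n t\<bar> \<le> \<bar>h t - k t\<bar> * (c + \<eta> * \<bar>w n t\<bar> powr p)"
        using le_add_powr[of "\<bar>w n t\<bar>" c p] c p unfolding abs_mult by (intro mult_left_mono) auto
      also have "\<dots> \<le> c * \<bar>h t - k t\<bar> + 2 * B * (\<eta> * (\<bar>w n t\<bar> powr p))"
        using mult_right_mono[OF hk[of t], of "\<eta> * (\<bar>w n t\<bar> powr p)"] \<eta> by (simp add: algebra_simps)
      finally show "\<bar>(h t - k t) * w n t\<bar> \<le> c * \<bar>h t - k t\<bar> + 2 * B * \<eta> * (\<bar>w n t\<bar> powr p)"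
        by (simp add: mult.assoc)
    qed
    also have "\<dots> = c * (\<integral>t. \<bar>h t - k t\<bar> \<partial>leb T) + 2 * B * \<eta> * (\<integral>t. \<bar>w n t\<bar> powr p \<partial>leb T)"
      using ihk intp[of n] by simp
    also have "\<dots> \<le> c * (e / (4 * c)) + 2 * B * \<eta> * K"
      using k(3) c K[of n] B0 \<eta> by (intro add_mono mult_left_mono) auto
    also have "\<dots> \<le> e / 4 + e / 4"
    proof -
      have "2 * B * \<eta> * K \<le> (2 * B * K + 1) * \<eta>" using \<eta> by (simp add: algebra_simps)
      also have "\<dots> = e / 4"
      proof -
        have "x * (e / (4 * x)) = e / 4" if "0 < x" for x using that by simp
        from this[OF BK] show ?thesis unfolding \<eta>_def .
      qed
      finally show ?thesis using c by simp
    qed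
    finally have 1: "\<bar>\<integral>t. (h t - k t) * w n t \<partial>leb T\<bar> \<le> e / 2" by simp
    have "(\<integral>t. h t * w n t \<partial>leb T) = (\<integral>t. (h t - k t) * w n t \<partial>leb T) + (\<integral>t. k t * w n t \<partial>leb T)"
      using ih[OF h B, of n] ih[OF km k(2), of n] by (simp add: left_diff_distrib)
    with 1 n0[OF that] show ?thesis by simp
  qed
  then show "\<exists>n0. \<forall>n\<ge>n0. norm ((\<integral>t. h t * w n t \<partial>leb T) - 0) < e" by blast
qed

section \<open>Stability of \<open>Lp\<close> and of velocities under linear operations\<close>

lemma powr_add_le:
  fixes a b p :: real
  assumes "0 \<le> a" "0 \<le> b" "0 \<le> p"
  shows "(a + b) powr p \<le> 2 powr p * (a powr p + b powr p)"
proof -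
  have "(a + b) powr p \<le> (2 * max a b) powr p"
    using assms by (intro powr_mono2) auto
  also have "\<dots> = 2 powr p * max a b powr p"
    using assms by (simp add: powr_mult)
  also have "\<dots> \<le> 2 powr p * (a powr p + b powr p)"
    by (intro mult_left_mono) (auto simp: max_def)
  finally show ?thesis .
qed

lemma Lp_dominated:
  fixes w :: "real \<Rightarrow> 'a::euclidean_space"
  assumes "w \<in> borel_measurable (leb T)" "integrable (leb T) G" "AE t in leb T. norm (w t) powr p \<le> G t"
  shows "w \<in> Lp T p"
  unfolding Lp_def
proof (intro CollectI conjI assms Bochner_Integration.integrable_bound[OF assms(2)])
  show "AE t in leb T. norm (norm (w t) powr p) \<le> norm (G t)"
    using assms(3) by eventually_elim auto
qed (use assms(1) in measurable)

lemma Lp_diff: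
  fixes v w :: "real \<Rightarrow> 'a::euclidean_space"
  assumes "v \<in> Lp T p" "w \<in> Lp T p" "0 \<le> p"
  shows "(\<lambda>t. v t - w t) \<in> Lp T p"
proof (rule Lp_dominated)
  show "(\<lambda>t. v t - w t) \<in> borel_measurable (leb T)"
    using assms by (auto simp: Lp_def)
  show "integrable (leb T) (\<lambda>t. 2 powr p * (norm (v t) powr p + norm (w t) powr p))"
    using assms by (auto simp: Lp_def)
  have "norm (v t - w t) powr p \<le> (norm (v t) + norm (w t)) powr p" for t
    using assms by (intro powr_mono2 norm_triangle_ineq4) auto
  then show "AE t in leb T. norm (v t - w t) powr p \<le> 2 powr p * (norm (v t) powr p + norm (w t) powr p)"
    using powr_add_le[of "norm (v t)" "norm (w t)" p for t] assms by (intro AE_I2) (meson norm_ge_zero order_trans)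
qed

lemma Lp_bounded_linear:
  fixes v :: "real \<Rightarrow> 'a::euclidean_space" and f :: "'a \<Rightarrow> 'b::euclidean_space"
  assumes f: "bounded_linear f" and v: "v \<in> Lp T p" and "0 \<le> p"
  shows "(\<lambda>t. f (v t)) \<in> Lp T p"
proof -
  obtain C where C: "0 < C" "\<And>x. norm (f x) \<le> norm x * C"
    using bounded_linear.pos_bounded[OF f] by blast
  have "f \<in> borel_measurable borel"
    by (intro borel_measurable_continuous_onI linear_continuous_on f)
  then have "(\<lambda>t. f (v t)) \<in> borel_measurable (leb T)"
    using v by (auto simp: Lp_def intro: measurable_compose)
  moreover have "norm (f (v t)) powr p \<le> norm (v t) powr p * C powr p" for t
    using C \<open>0 \<le> p\<close> by (simp flip: powr_mult add: powr_mono2)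
  moreover have "integrable (leb T) (\<lambda>t. norm (v t) powr p * C powr p)"
    using v by (simp add: Lp_def)
  ultimately show ?thesis
    by (intro Lp_dominated[where G = "\<lambda>t. norm (v t) powr p * C powr p"] AE_I2)
qed

lemma velocity_bounded_linear:
  fixes y :: "real \<Rightarrow> 'a::euclidean_space" and f :: "'a \<Rightarrow> 'b::euclidean_space"
  assumes f: "bounded_linear f" and v: "velocity T p y v" and "0 \<le> p"
  shows "velocity T p (\<lambda>t. f (y t)) (\<lambda>t. f (v t))"
  unfolding velocity_def
proof (intro conjI ballI)
  show "(\<lambda>t. f (v t)) \<in> Lp T p"
    using v by (intro Lp_bounded_linear[OF f _ \<open>0 \<le> p\<close>]) (simp add: velocity_def)
  fix t assume "t \<in> {0..T}"
  then have "(v has_integral (y t - y 0)) {0..t}" using v by (simp add: velocity_def)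
  from has_integral_linear[OF this f]
  show "((\<lambda>t. f (v t)) has_integral (f (y t) - f (y 0))) {0..t}"
    by (simp add: comp_def linear_diff[OF bounded_linear.linear[OF f]])
qed

lemma velocity_integrable:
  assumes "velocity T p y v" "1 \<le> p"
  shows "integrable (leb T) v"
  using assms Lp_imp_integrable by (auto simp: velocity_def)

lemma velocity_abs_integrable:
  assumes "velocity T p y v" "1 \<le> p"
  shows "v absolutely_integrable_on {0..T}"
  using velocity_integrable[OF assms] by (simp add: integrable_leb_iff)

text \<open>The constant sequence \<open>w\<close> satisfies the hypotheses of
  \<open>bounded_test_small\<close>. Testing it against the bounded function \<open>sgn w\<close>
  yields the integral of \<open>\<bar>w\<bar>\<close>, which therefore is 0.\<close>

lemma Lp_AE_eq_0_real:
  fixes w :: "real \<Rightarrow> real"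
  assumes T: "0 < T" and p: "1 < p" and w: "w \<in> Lp T p"
    and 0: "\<And>t. t \<in> {0..T} \<Longrightarrow> integral {0..t} w = 0"
  shows "AE t in leb T. w t = 0"
proof -
  have m: "w \<in> borel_measurable (leb T)" using w by (simp add: Lp_def)
  have i: "integrable (leb T) w" using Lp_imp_integrable[OF w] p by simp
  have s: "(\<lambda>t. sgn (w t)) \<in> borel_measurable (leb T)" using m by measurable
  have "(\<lambda>n::nat. \<integral>t. sgn (w t) * w t \<partial>leb T) \<longlonglongrightarrow> 0"
    by (rule bounded_test_small[OF T p, of "\<lambda>_. w" "\<integral>t. \<bar>w t\<bar> powr p \<partial>leb T" "\<lambda>t. sgn (w t)" 1])
      (use w 0 s in \<open>auto simp: uniform_limit_iff abs_sgn_eq\<close>)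
  then have "(\<integral>t. \<bar>w t\<bar> \<partial>leb T) = 0"
    by (simp add: LIMSEQ_const_iff sgn_mult_self_eq mult.commute abs_mult_sgn flip: abs_sgn)
  then show ?thesis
    using i by (subst (asm) integral_nonneg_eq_0_iff_AE) auto
qed

lemma velocity_unique:
  fixes y v w :: "real \<Rightarrow> 'a::euclidean_space"
  assumes T: "0 < T" and p: "1 < p" and v: "velocity T p y v" and w: "velocity T p y w"
  shows "AE t in leb T. v t = w t"
proof -
  have "AE t in leb T. (v t - w t) \<bullet> b = 0" for b
  proof (rule Lp_AE_eq_0_real[OF T p])
    show "(\<lambda>t. (v t - w t) \<bullet> b) \<in> Lp T p"
      using v w p by (intro Lp_bounded_linear[OF bounded_linear_inner_left] Lp_diff) (auto simp: velocity_def)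
    fix t assume t: "t \<in> {0..T}"
    have "((\<lambda>t. (v t - w t) \<bullet> b) has_integral ((y t - y 0 - (y t - y 0)) \<bullet> b)) {0..t}"
      using v w t by (intro has_integral_linear[OF _ bounded_linear_inner_left, unfolded comp_def] has_integral_diff)
        (auto simp: velocity_def)
    then show "integral {0..t} (\<lambda>t. (v t - w t) \<bullet> b) = 0" by (auto dest: integral_unique)
  qed
  then have "AE t in leb T. \<forall>b\<in>Basis. (v t - w t) \<bullet> b = 0"
    by (subst AE_ball_countable) (auto simp: countable_finite)
  then show ?thesis
    by eventually_elim (auto simp: inner_diff_left intro: euclidean_eqI)
qed

text \<open>The chain rule for powers of an absolutely continuous function, by induction: the
  product of \<open>f\<close> and \<open>f ^ Suc k\<close> is integrated by parts.\<close>

lemma has_integral_power: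
  fixes f f' :: "real \<Rightarrow> real"
  assumes "a \<le> b" and f': "f' absolutely_integrable_on {a..b}"
    and f: "\<And>t. t \<in> {a..b} \<Longrightarrow> (f' has_integral (f t - f a)) {a..t}"
  shows "((\<lambda>t. real (Suc k) * f t ^ k * f' t) has_integral (f b ^ Suc k - f a ^ Suc k)) {a..b}"
  using assms
proof (induction k arbitrary: b)
  case (Suc k)
  have "f' integrable_on {a..b}" using set_lebesgue_integral_eq_integral(1)[OF Suc.prems(2)] .
  then have "continuous_on {a..b} (\<lambda>t. f a + integral {a..t} f')"
    by (intro continuous_intros indefinite_integral_continuous_1)
  then have c: "continuous_on {a..b} f"
    by (rule continuous_on_eq) (use integral_unique[OF Suc.prems(3)] in auto)
  have ck: "continuous_on {a..b} (\<lambda>t. real (Suc k) * f t ^ k)"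
    by (intro continuous_intros c)
  have ai: "(\<lambda>t. real (Suc k) * f t ^ k * f' t) absolutely_integrable_on {a..b}"
    by (intro absolutely_integrable_bounded_measurable_product_real[OF _ _ _ Suc.prems(2)]
        continuous_imp_measurable_on_sets_lebesgue[OF ck]
        compact_imp_bounded[OF compact_continuous_image[OF ck compact_Icc]]) auto
  have "((\<lambda>t. f' t *\<^sub>R f t ^ Suc k + f t *\<^sub>R (real (Suc k) * f t ^ k * f' t)) has_integral
      (f b *\<^sub>R f b ^ Suc k - f a *\<^sub>R f a ^ Suc k)) {a..b}"
  proof (rule has_integral_scaleR_by_parts[OF Suc.prems(1,2) ai Suc.prems(3)])
    show "((\<lambda>t. real (Suc k) * f t ^ k * f' t) has_integral (f t ^ Suc k - f a ^ Suc k)) {a..t}"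
      if "t \<in> {a..b}" for t
      using that Suc.prems by (intro Suc.IH) (auto elim: absolutely_integrable_on_subinterval)
  qed
  then show ?case by (simp add: algebra_simps)
qed simp

text \<open>With \<open>w = 1 - u / M\<close> valued in the unit interval, \<open>w ^ k * w'\<close> has small integrals, being the
  derivative of \<open>w ^ (k + 1) / (k + 1)\<close>, and converges to \<open>w'\<close> times the indicator of \<open>u = 0\<close>.\<close>

lemma velocity_eq_0_on_zeros:
  fixes u v :: "real \<Rightarrow> real"
  assumes T: "0 < T" and p: "1 < p" and v: "velocity T p u v" and u: "\<And>t. t \<in> {0..T} \<Longrightarrow> 0 \<le> u t"
  shows "AE t in leb T. u t = 0 \<longrightarrow> v t = 0"
proof -
  have cu: "continuous_on {0..T} u" using v by (rule velocity_continuous)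
  have ai: "v absolutely_integrable_on {0..T}" using v p by (intro velocity_abs_integrable) auto
  obtain M where M: "0 < M" "\<And>t. t \<in> {0..T} \<Longrightarrow> u t \<le> M"
    using compact_imp_bounded[OF compact_continuous_image[OF cu compact_Icc]]
    unfolding bounded_pos by (metis abs_le_D1 imageI real_norm_def)
  define w where "w t = 1 - u t / M" for t
  have w01: "0 \<le> w t" "w t \<le> 1" if "t \<in> {0..T}" for t
    using M u[OF that] M(2)[OF that] by (auto simp: w_def field_simps)
  have w': "((\<lambda>t. - v t / M) has_integral (w t - w 0)) {0..t}" if "t \<in> {0..T}" for t
  proof -
    have "((\<lambda>t. v t * (- 1 / M)) has_integral ((u t - u 0) * (- 1 / M))) {0..t}"
      using v that by (intro has_integral_mult_left) (auto simp: velocity_def)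
    then show ?thesis by (simp add: w_def algebra_simps diff_divide_distrib)
  qed
  let ?Z = "\<lambda>t. if u t = 0 then v t else 0"
  have "integral {0..t} ?Z = 0" if t: "t \<in> {0..T}" for t
  proof -
    have ait: "v absolutely_integrable_on {0..t}"
      using ai t by (auto elim: absolutely_integrable_on_subinterval)
    have hi: "((\<lambda>s. w s ^ k * v s) has_integral (- M / Suc k) * (w t ^ Suc k - w 0 ^ Suc k)) {0..t}" for k
    proof -
      have "((\<lambda>t. real (Suc k) * w t ^ k * (- v t / M)) has_integral (w t ^ Suc k - w 0 ^ Suc k)) {0..t}"
        using t w' set_integrable_mult_left[of "- 1 / M" _ "{0..t}" v] ait
        by (intro has_integral_power) auto
      then have "((\<lambda>s. (- M / Suc k) * (real (Suc k) * w s ^ k * (- v s / M))) has_integral (- M / Suc k) * (w t ^ Suc k - w 0 ^ Suc k)) {0..t}"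
        by (rule has_integral_mult_right)
      moreover have "(- M / Suc k) * (real (Suc k) * w s ^ k * (- v s / M)) = w s ^ k * v s" for s
        using M by (simp add: divide_simps del: of_nat_Suc)
      ultimately show ?thesis by (simp del: of_nat_Suc)
    qed
    have "(\<lambda>k. integral {0..t} (\<lambda>s. w s ^ k * v s)) \<longlonglongrightarrow> integral {0..t} ?Z"
    proof (rule dominated_convergence(2))
      show "(\<lambda>s. w s ^ k * v s) integrable_on {0..t}" for k using hi by blast
      show "(\<lambda>s. \<bar>v s\<bar>) integrable_on {0..t}"
        using set_lebesgue_integral_eq_integral(1)[OF set_integrable_norm[OF ait]] by simp
      show "norm (w s ^ k * v s) \<le> \<bar>v s\<bar>" if "s \<in> {0..t}" for k s
        using w01[of s] that t by (auto simp: abs_mult power_abs intro!: mult_left_le_one_le power_le_one)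
      show "(\<lambda>k. w s ^ k * v s) \<longlonglongrightarrow> ?Z s" if "s \<in> {0..t}" for s
      proof (cases "u s = 0")
        case False
        then have "w s < 1" using u[of s] that t M by (auto simp: w_def order_less_le)
        then have "(\<lambda>k. w s ^ k * v s) \<longlonglongrightarrow> 0 * v s"
          using w01[of s] that t by (intro tendsto_mult LIMSEQ_power_zero) auto
        then show ?thesis using False by simp
      qed (auto simp: w_def)
    qed
    moreover have "(\<lambda>k. integral {0..t} (\<lambda>s. w s ^ k * v s)) \<longlonglongrightarrow> 0"
    proof (rule Lim_null_comparison)
      show "\<forall>\<^sub>F k in sequentially. norm (integral {0..t} (\<lambda>s. w s ^ k * v s)) \<le> M / Suc k"
      proof (intro always_eventually allI)
        fix k
        have "0 \<le> w s ^ Suc k \<and> w s ^ Suc k \<le> 1" if "s \<in> {0..T}" for s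
          using w01[OF that] power_le_one[of "w s" "Suc k"] by simp
        from this[of t] this[of 0] have "\<bar>w t ^ Suc k - w 0 ^ Suc k\<bar> \<le> 1" using t by force
        then have "M / Suc k * \<bar>w t ^ Suc k - w 0 ^ Suc k\<bar> \<le> M / Suc k"
          using M by (intro mult_left_le) auto
        then show "norm (integral {0..t} (\<lambda>s. w s ^ k * v s)) \<le> M / Suc k"
          using integral_unique[OF hi[of k]] M by (simp add: abs_mult)
      qed
      show "(\<lambda>k. M / Suc k) \<longlonglongrightarrow> 0"
        using tendsto_mult[OF tendsto_const[of M] LIMSEQ_inverse_real_of_nat] by (simp add: divide_inverse)
    qed
    ultimately show ?thesis by (rule LIMSEQ_unique)
  qed
  moreover have "?Z \<in> Lp T p"
  proof (rule Lp_dominated)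
    have "Measurable.pred (leb T) (\<lambda>t. u t = 0)"
      using borel_measurable_leb_continuous[OF cu] by measurable
    moreover have "v \<in> borel_measurable (leb T)" using v by (simp add: velocity_def Lp_def)
    ultimately show "?Z \<in> borel_measurable (leb T)" by measurable
    show "integrable (leb T) (\<lambda>t. norm (v t) powr p)" using v by (simp add: velocity_def Lp_def)
  qed auto
  ultimately have "AE t in leb T. ?Z t = 0"
    by (intro Lp_AE_eq_0_real[OF T p])
  then show ?thesis by eventually_elim (auto split: if_splits)
qed

section \<open>Weak derivatives of continuous functions\<close>

text \<open>With \<open>Q\<close> constant and \<open>m = 0\<close> this is the usual bump. The
  polynomial and the exponent are there because the family then is closed under differentiation,
  which reduces smoothness to an induction.\<close>

definition bump :: "real \<Rightarrow> real \<Rightarrow> real poly \<Rightarrow> nat \<Rightarrow> real \<Rightarrow> real" where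
  "bump a b Q m t = (if a < t \<and> t < b
     then poly Q t / ((t - a) * (b - t)) ^ m * exp (- 1 / ((t - a) * (b - t))) else 0)"

text \<open>Comes from \<open>(1 + x / n) ^ n \<le> exp x\<close> with
  \<open>x = 1 / w\<close>.\<close>

lemma exp_neg_inverse_le:
  fixes w :: real
  assumes "0 < w"
  shows "exp (- 1 / w) \<le> real n ^ n * w ^ n"
proof (cases "n = 0")
  case False
  have "(1 / (n * w)) ^ n \<le> (1 + (1 / w) / n) ^ n"
    using assms by (intro power_mono) (auto simp: field_simps)
  also have "\<dots> \<le> exp (1 / w)"
    using False order_less_le_trans[of "- real n" 0 "1 / w"] assms
    by (intro exp_ge_one_plus_x_over_n_power_n) auto
  finally have "(1 / (n * w)) ^ n \<le> exp (1 / w)" .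
  then have "1 / exp (1 / w) \<le> 1 / (1 / (n * w)) ^ n"
    using assms False by (intro divide_left_mono) auto
  then show ?thesis
    by (simp add: exp_minus divide_inverse power_mult_distrib power_inverse)
qed (use assms in simp)

text \<open>Vanishing to second order at both end points makes the derivative there 0. Of the
  \<open>m + 2\<close> powers gained from the exponential, \<open>m\<close> cancel the denominator
  and two remain.\<close>

lemma bump_le_square:
  assumes "a < b"
  obtains C where "\<And>t. \<bar>bump a b Q m t\<bar> \<le> C * ((t - a) * (b - t))\<^sup>2" "0 \<le> C"
proof -
  obtain B where B: "\<And>t. t \<in> {a..b} \<Longrightarrow> \<bar>poly Q t\<bar> \<le> B"
    using compact_imp_bounded[OF compact_continuous_image[OF continuous_on_poly[OF continuous_on_id] compact_Icc]]
    unfolding bounded_iff by (metis imageI real_norm_def id_apply)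
  have B0: "0 \<le> B" using B[of a] assms by simp
  let ?n = "m + 2"
  have "\<bar>bump a b Q m t\<bar> \<le> B * real ?n ^ ?n * ((t - a) * (b - t))\<^sup>2" for t
  proof (cases "a < t \<and> t < b")
    case True
    define w where "w = (t - a) * (b - t)"
    have w: "0 < w" using True by (simp add: w_def)
    have "\<bar>bump a b Q m t\<bar> = \<bar>poly Q t\<bar> * (exp (- 1 / w) / w ^ m)"
      using True w by (simp add: bump_def w_def[symmetric] abs_mult)
    also have "\<dots> \<le> B * (real ?n ^ ?n * w ^ ?n / w ^ m)"
      using True w B[of t] B0 exp_neg_inverse_le[OF w, of ?n]
      by (intro mult_mono divide_right_mono) auto
    also have "\<dots> = B * real ?n ^ ?n * w\<^sup>2"
      using w by (simp add: power_add power2_eq_square)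
    finally show ?thesis by (simp add: w_def)
  qed (use B0 in \<open>auto simp: bump_def\<close>)
  then show ?thesis
    by (rule that) (use B0 in simp)
qed

lemma DERIV_0_if_le_square:
  fixes f :: "real \<Rightarrow> real"
  assumes "\<And>t. \<bar>f t\<bar> \<le> C * (t - c)\<^sup>2"
  shows "(f has_real_derivative 0) (at c)"
proof -
  have f0: "f c = 0" using assms[of c] by simp
  have "((\<lambda>h. (f (c + h) - f c) / h) \<longlongrightarrow> 0) (at 0)"
  proof (rule Lim_null_comparison)
    have "norm ((f (c + h) - f c) / h) \<le> C * \<bar>h\<bar>" if "h \<noteq> 0" for h
    proof -
      have "\<bar>f (c + h)\<bar> \<le> C * \<bar>h\<bar> * \<bar>h\<bar>"
        using assms[of "c + h"] by (simp add: power2_eq_square mult.assoc)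
      then show ?thesis using that f0 by (simp add: divide_simps)
    qed
    then show "\<forall>\<^sub>F h in at 0. norm ((f (c + h) - f c) / h) \<le> C * \<bar>h\<bar>"
      by (auto simp: eventually_at intro!: exI[of _ 1])
    show "((\<lambda>h. C * \<bar>h\<bar>) \<longlongrightarrow> 0) (at 0)" by (auto intro!: tendsto_eq_intros)
  qed
  then show ?thesis by (simp add: DERIV_def)
qed

lemma bump_has_derivative:
  assumes ab: "a < b"
  obtains Q' m' where "\<And>t. (bump a b Q m has_real_derivative bump a b Q' m' t) (at t)"
proof -
  define W where "W = [:- a, 1:] * [:b, - 1:]"
  \<comment> \<open>Numerator of the derivative of \<open>Q / W ^ m * exp (- 1 / W)\<close> over the
    common denominator \<open>W ^ (m + 2)\<close>; the last summand comes from the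
    exponential.\<close>
  define Q' where "Q' = pderiv Q * W\<^sup>2 - smult (real m) (Q * pderiv W * W) + Q * pderiv W"
  have W: "poly W t = (t - a) * (b - t)" for t by (simp add: W_def algebra_simps)
  have "(bump a b Q m has_real_derivative bump a b Q' (m + 2) t) (at t)" for t
  proof -
    obtain C where C: "\<And>t. \<bar>bump a b Q m t\<bar> \<le> C * ((t - a) * (b - t))\<^sup>2" "0 \<le> C"
      using bump_le_square[OF ab] by blast
    consider "a < t" "t < b" | "t = a" | "t = b" | "t < a" | "b < t" by linarith
    then show ?thesis
    proof cases
      case 1
      then have w: "poly W t > 0" by (simp add: W)
      have "((\<lambda>t. poly Q t / poly W t ^ m) has_real_derivative
          (poly (pderiv Q) t * poly W t ^ m - poly Q t * (real m * poly W t ^ (m - 1) * poly (pderiv W) t))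
            / (poly W t ^ m * poly W t ^ m)) (at t)"
        using w by (auto intro!: derivative_eq_intros)
      moreover have "((\<lambda>t. exp (- 1 / poly W t)) has_real_derivative
          exp (- 1 / poly W t) * (poly (pderiv W) t / (poly W t)\<^sup>2)) (at t)"
        using w by (auto intro!: derivative_eq_intros simp: power2_eq_square)
      ultimately have "((\<lambda>t. poly Q t / poly W t ^ m * exp (- 1 / poly W t)) has_real_derivative
          ((poly (pderiv Q) t * poly W t ^ m - poly Q t * (real m * poly W t ^ (m - 1) * poly (pderiv W) t))
            / (poly W t ^ m * poly W t ^ m)) * exp (- 1 / poly W t)
          + exp (- 1 / poly W t) * (poly (pderiv W) t / (poly W t)\<^sup>2) * (poly Q t / poly W t ^ m)) (at t)"
        by (rule DERIV_mult)
      moreover have "((poly (pderiv Q) t * poly W t ^ m - poly Q t * (real m * poly W t ^ (m - 1) * poly (pderiv W) t))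
            / (poly W t ^ m * poly W t ^ m)) * exp (- 1 / poly W t)
          + exp (- 1 / poly W t) * (poly (pderiv W) t / (poly W t)\<^sup>2) * (poly Q t / poly W t ^ m)
          = poly Q' t / poly W t ^ (m + 2) * exp (- 1 / poly W t)"
      proof (cases m)
        case 0
        then show ?thesis using w by (simp add: Q'_def field_simps power2_eq_square)
      next
        case (Suc k)
        then show ?thesis using w by (simp add: Q'_def field_simps power2_eq_square del: of_nat_Suc)
      qed
      ultimately have d: "((\<lambda>t. poly Q t / poly W t ^ m * exp (- 1 / poly W t)) has_real_derivative
          poly Q' t / poly W t ^ (m + 2) * exp (- 1 / poly W t)) (at t)" by simp
      have "(bump a b Q m has_real_derivative poly Q' t / poly W t ^ (m + 2) * exp (- 1 / poly W t)) (at t)"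
        by (rule has_field_derivative_transform_within_open[OF d, of "{a<..<b}"])
          (use 1 in \<open>auto simp: bump_def W\<close>)
      then show ?thesis using 1 by (simp add: bump_def W)
    next
      case 2
      have "\<bar>bump a b Q m s\<bar> \<le> C * (b - a)\<^sup>2 * (s - a)\<^sup>2" for s
      proof (cases "a < s \<and> s < b")
        case True
        then have "C * ((s - a) * (b - s))\<^sup>2 \<le> C * ((s - a) * (b - a))\<^sup>2"
          using C(2) by (intro mult_left_mono power_mono mult_mono) auto
        then show ?thesis using C(1)[of s] by (simp add: power_mult_distrib mult_ac)
      qed (use C(2) in \<open>auto simp: bump_def\<close>)
      then have "(bump a b Q m has_real_derivative 0) (at a)" by (rule DERIV_0_if_le_square)
      then show ?thesis using 2 by (simp add: bump_def)
    next
      case 3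
      have "\<bar>bump a b Q m s\<bar> \<le> C * (b - a)\<^sup>2 * (s - b)\<^sup>2" for s
      proof (cases "a < s \<and> s < b")
        case True
        then have "C * ((s - a) * (b - s))\<^sup>2 \<le> C * ((b - a) * (b - s))\<^sup>2"
          using C(2) by (intro mult_left_mono power_mono mult_mono) auto
        then show ?thesis using C(1)[of s] by (simp add: power_mult_distrib mult_ac power2_commute)
      qed (use C(2) in \<open>auto simp: bump_def\<close>)
      then have "(bump a b Q m has_real_derivative 0) (at b)" by (rule DERIV_0_if_le_square)
      then show ?thesis using 3 by (simp add: bump_def)
    next
      case 4
      have "(bump a b Q m has_real_derivative 0) (at t)"
        by (rule has_field_derivative_transform_within_open[OF DERIV_const[of 0], of "{..<a}"])
          (use 4 in \<open>auto simp: bump_def\<close>)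
      then show ?thesis using 4 by (simp add: bump_def)
    next
      case 5
      have "(bump a b Q m has_real_derivative 0) (at t)"
        by (rule has_field_derivative_transform_within_open[OF DERIV_const[of 0], of "{b<..}"])
          (use 5 in \<open>auto simp: bump_def\<close>)
      then show ?thesis using 5 by (simp add: bump_def)
    qed
  qed
  then show ?thesis by (rule that)
qed

lemma continuous_bump:
  assumes "a < b"
  shows "continuous_on S (bump a b Q m)"
proof -
  obtain Q' m' where "\<And>t. (bump a b Q m has_real_derivative bump a b Q' m' t) (at t)"
    using bump_has_derivative[OF assms] by blast
  then show ?thesis by (intro continuous_at_imp_continuous_on ballI DERIV_isCont)
qed

text \<open>Each derivative is again a difference of two bumps on the same intervals but with other
  polynomials and exponents, so the induction is over all of these at once.\<close>

lemma iterated_deriv_bump_diff: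
  assumes "a < b" "c < d"
  shows "(deriv ^^ k) (\<lambda>t. bump a b P m t - bump c d Q n t) differentiable_on UNIV"
proof (induction k arbitrary: P m Q n)
  case 0
  obtain P' m' where P': "\<And>t. (bump a b P m has_real_derivative bump a b P' m' t) (at t)"
    using bump_has_derivative[OF assms(1)] by blast
  obtain Q' n' where Q': "\<And>t. (bump c d Q n has_real_derivative bump c d Q' n' t) (at t)"
    using bump_has_derivative[OF assms(2)] by blast
  have "((\<lambda>t. bump a b P m t - bump c d Q n t) has_real_derivative bump a b P' m' t - bump c d Q' n' t) (at t)" for t
    by (intro DERIV_diff P' Q')
  then show ?case
    by (auto simp: differentiable_on_def real_differentiable_def)
next
  case (Suc k)
  obtain P' m' where P': "\<And>t. (bump a b P m has_real_derivative bump a b P' m' t) (at t)"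
    using bump_has_derivative[OF assms(1)] by blast
  obtain Q' n' where Q': "\<And>t. (bump c d Q n has_real_derivative bump c d Q' n' t) (at t)"
    using bump_has_derivative[OF assms(2)] by blast
  have "deriv (\<lambda>t. bump a b P m t - bump c d Q n t) = (\<lambda>t. bump a b P' m' t - bump c d Q' n' t)"
    by (intro ext DERIV_imp_deriv DERIV_diff P' Q')
  then show ?case using Suc.IH by (simp only: funpow_Suc_right comp_def)
qed

lemma bump_nonneg: "0 \<le> bump a b 1 0 t"
  by (simp add: bump_def)

lemma integral_bump_pos:
  assumes "0 \<le> a" "a < b" "b \<le> T"
  shows "0 < integral {0..T} (bump a b 1 0)"
proof -
  have "0 \<le> integral {0..T} (bump a b 1 0)"
    by (intro Henstock_Kurzweil_Integration.integral_nonneg integrable_continuous_real continuous_bump assms)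
      (auto simp: bump_def)
  moreover have "integral {0..T} (bump a b 1 0) \<noteq> 0"
  proof
    assume "integral {0..T} (bump a b 1 0) = 0"
    then have "\<forall>t\<in>{0..T}. bump a b 1 0 t = 0"
      using assms integral_eq_0_iff[OF continuous_bump[OF assms(2)], of 0 T 1 0] by (auto simp: bump_nonneg)
    then have "bump a b 1 0 ((a + b) / 2) = 0" using assms by auto
    then show False using assms by (auto simp: bump_def field_simps split: if_splits)
  qed
  ultimately show ?thesis by simp
qed

text \<open>The normalizing factor is put into the polynomial, so that the result stays in the
  family.\<close>

lemma normalized_bump:
  assumes "0 \<le> a" "a < b" "b \<le> T"
  obtains c where "0 < c" "integral {0..T} (bump a b [:c:] 0) = 1"
proof
  let ?c = "1 / integral {0..T} (bump a b 1 0)"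
  show "0 < ?c" using integral_bump_pos[OF assms] by simp
  have "bump a b [:?c:] 0 = (\<lambda>t. ?c * bump a b 1 0 t)" by (auto simp: bump_def)
  then show "integral {0..T} (bump a b [:?c:] 0) = 1"
    using integral_bump_pos[OF assms] by simp
qed

text \<open>The test function is a primitive of the difference. It is constant to the left of
  \<open>a\<close> and to the right of \<open>b'\<close>, where the difference vanishes; equality of
  the two integrals makes both constants 0, whence the compact support.\<close>

lemma bump_test_function:
  assumes "0 < a" "a < a'" "a' \<le> b'" "a < b" "b < b'" "b' < T"
    and "integral {0..T} (bump a a' P 0) = integral {0..T} (bump b b' Q 0)"
  obtains \<phi> where "\<phi> \<in> test_functions T" "deriv \<phi> = (\<lambda>t. bump a a' P 0 t - bump b b' Q 0 t)"
proof -
  let ?\<psi> = "\<lambda>t. bump a a' P 0 t - bump b b' Q 0 t"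
  have c\<psi>: "continuous_on S ?\<psi>" for S
    using assms by (intro continuous_intros continuous_bump)
  \<comment> \<open>The antiderivative has to live on the whole line, as test functions are
    differentiable on \<open>UNIV\<close>.\<close>
  have "\<exists>F. \<forall>x::real. (-\<infinity>::ereal) < x \<longrightarrow> x < (\<infinity>::ereal) \<longrightarrow> (F has_vector_derivative ?\<psi> x) (at x)"
    using c\<psi>[of UNIV] by (intro einterval_antiderivative) (auto simp: continuous_on_eq_continuous_at)
  then obtain F where F: "\<And>x. (F has_vector_derivative ?\<psi> x) (at x)" by auto
  define \<phi> where "\<phi> t = F t - F 0" for t
  have d: "(\<phi> has_real_derivative ?\<psi> t) (at t)" for t
    unfolding \<phi>_def using F[of t]
    by (auto simp: has_real_derivative_iff_has_vector_derivative intro!: derivative_eq_intros)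
  have deriv: "deriv \<phi> = ?\<psi>" by (intro ext DERIV_imp_deriv d)
  have l: "\<phi> t = 0" if "t \<le> a" for t
  proof -
    have "\<exists>c. \<forall>t\<in>{..a}. \<phi> t = c"
    proof (rule has_field_derivative_zero_constant)
      show "(\<phi> has_real_derivative 0) (at t within {..a})" if "t \<in> {..a}" for t
        using d[of t] that assms by (auto simp: bump_def intro: has_field_derivative_at_within)
    qed simp
    then have "\<phi> t = \<phi> 0" using that assms by auto
    then show ?thesis by (simp add: \<phi>_def)
  qed
  have "(?\<psi> has_integral (\<phi> T - \<phi> 0)) {0..T}"
    using assms d by (intro fundamental_theorem_of_calculus)
      (auto simp: has_real_derivative_iff_has_vector_derivative[symmetric] intro: has_field_derivative_at_within)
  moreover have "integral {0..T} ?\<psi> = 0"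
    using assms by (subst Henstock_Kurzweil_Integration.integral_diff)
      (auto intro!: integrable_continuous_real continuous_bump)
  ultimately have T: "\<phi> T = 0" using l[of 0] assms by (auto dest: integral_unique)
  have r: "\<phi> t = 0" if "b' \<le> t" for t
  proof -
    have "\<exists>c. \<forall>t\<in>{b'..}. \<phi> t = c"
    proof (rule has_field_derivative_zero_constant)
      show "(\<phi> has_real_derivative 0) (at t within {b'..})" if "t \<in> {b'..}" for t
        using d[of t] that assms by (auto simp: bump_def intro: has_field_derivative_at_within)
    qed simp
    then have "\<phi> t = \<phi> T" using that assms by auto
    then show ?thesis using T by simp
  qed
  have "{t. \<phi> t \<noteq> 0} \<subseteq> {a..b'}"
  proof
    fix t assume "t \<in> {t. \<phi> t \<noteq> 0}"
    then have "\<not> t \<le> a" "\<not> b' \<le> t" using l[of t] r[of t] by auto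
    then show "t \<in> {a..b'}" by simp
  qed
  then have supp: "closure {t. \<phi> t \<noteq> 0} \<subseteq> {a..b'}"
    by (rule closure_minimal) simp
  have "(deriv ^^ k) \<phi> differentiable_on UNIV" for k
  proof (cases k)
    case 0
    then show ?thesis using d by (auto simp: differentiable_on_def real_differentiable_def)
  next
    case (Suc j)
    then show ?thesis
      using iterated_deriv_bump_diff[of a a' b b' j] assms by (simp add: funpow_Suc_right deriv del: funpow.simps)
  qed
  moreover have "compact (closure {t. \<phi> t \<noteq> 0})"
    using bounded_subset[OF bounded_closed_interval, OF supp] by (simp add: compact_eq_bounded_closed)
  ultimately have "\<phi> \<in> test_functions T"
    using supp assms by (auto simp: test_functions_def)
  then show ?thesis using deriv by (rule that)
qed

lemma bump_average:
  fixes f :: "real \<Rightarrow> 'a::euclidean_space"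
  assumes ab: "0 \<le> a" "a < b" "b \<le> T" and c: "0 < c" "integral {0..T} (bump a b [:c:] 0) = 1"
    and f: "continuous_on {0..T} f" and e: "\<And>t. t \<in> {a..b} \<Longrightarrow> norm (f t - z) \<le> e"
  shows "norm ((\<integral>t. bump a b [:c:] 0 t *\<^sub>R f t \<partial>leb T) - z) \<le> e"
proof -
  let ?\<beta> = "bump a b [:c:] 0"
  have \<beta>: "integrable (leb T) ?\<beta>" using ab by (intro integrable_leb_continuous continuous_bump)
  have \<beta>f: "integrable (leb T) (\<lambda>t. ?\<beta> t *\<^sub>R f t)"
    using ab by (intro integrable_leb_continuous continuous_intros continuous_bump f)
  have \<beta>1: "(\<integral>t. ?\<beta> t \<partial>leb T) = 1" using c by (simp add: integral_leb[OF \<beta>])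
  have "(\<integral>t. ?\<beta> t *\<^sub>R f t \<partial>leb T) - z = (\<integral>t. ?\<beta> t *\<^sub>R (f t - z) \<partial>leb T)"
    using \<beta> \<beta>f \<beta>1 by (simp add: scaleR_diff_right)
  also have "norm \<dots> \<le> (\<integral>t. norm (?\<beta> t *\<^sub>R (f t - z)) \<partial>leb T)"
    by (rule integral_norm_bound)
  also have "\<dots> \<le> (\<integral>t. e * ?\<beta> t \<partial>leb T)"
  proof (rule integral_mono)
    show "integrable (leb T) (\<lambda>t. norm (?\<beta> t *\<^sub>R (f t - z)))"
      using ab by (intro integrable_norm integrable_leb_continuous continuous_intros continuous_bump f)
    show "norm (?\<beta> t *\<^sub>R (f t - z)) \<le> e * ?\<beta> t" for t
      using e[of t] c(1) by (auto simp: bump_def mult_ac intro!: mult_mono)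
  qed (use \<beta> in auto)
  also have "\<dots> = e" using \<beta>1 by simp
  finally show ?thesis .
qed

text \<open>The du Bois-Reymond argument. With \<open>V\<close> the primitive of \<open>v\<close>,
  the continuous function \<open>f = y - V\<close> is annihilated by the derivative of every test
  function. Differences of normalized bumps next to \<open>a\<close> and \<open>b\<close> are such
  derivatives, so the averages of \<open>f\<close> near both points coincide; shrinking the bumps
  gives \<open>f a = f b\<close>. Continuity extends this to the end points.\<close>

lemma weak_deriv_imp_velocity:
  fixes y v :: "real \<Rightarrow> 'a::euclidean_space"
  assumes wd: "is_weak_deriv T p y v" and T: "0 < T" and p: "1 \<le> p" and y: "continuous_on {0..T} y"
  shows "velocity T p y v"
proof -
  have v: "v \<in> Lp T p" using wd by (simp add: is_weak_deriv_def)
  have ai: "v absolutely_integrable_on {0..T}"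
    using Lp_imp_integrable[OF v p] by (simp add: integrable_leb_iff)
  define V where "V t = integral {0..t} v" for t
  have V: "(v has_integral (V t - V 0)) {0..t}" if "t \<in> {0..T}" for t
  proof -
    have "v integrable_on {0..t}"
      using that by (intro integrable_subinterval_real[OF set_lebesgue_integral_eq_integral(1)[OF ai]]) auto
    then show ?thesis by (auto simp: V_def)
  qed
  then have vV: "velocity T p V v" using v by (simp add: velocity_def)
  note cV = velocity_continuous[OF vV]
  define f where "f t = y t - V t" for t
  have f: "continuous_on {0..T} f" unfolding f_def by (intro continuous_intros y cV)
  have zero: "(\<integral>t. deriv \<phi> t *\<^sub>R f t \<partial>leb T) = 0" if "\<phi> \<in> test_functions T" for \<phi>
  proof -
    have "(deriv ^^ 1) \<phi> differentiable_on UNIV"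
      using that unfolding test_functions_def by blast
    then have "continuous_on {0..T} (deriv \<phi>)"
      using differentiable_imp_continuous_on by (auto intro: continuous_on_subset)
    then have "integrable (leb T) (\<lambda>t. deriv \<phi> t *\<^sub>R y t)" "integrable (leb T) (\<lambda>t. deriv \<phi> t *\<^sub>R V t)"
      by (intro integrable_leb_continuous continuous_intros y cV; assumption)+
    then have "(\<integral>t. deriv \<phi> t *\<^sub>R f t \<partial>leb T) = (\<integral>t. deriv \<phi> t *\<^sub>R y t \<partial>leb T) - (\<integral>t. deriv \<phi> t *\<^sub>R V t \<partial>leb T)"
      by (simp add: f_def scaleR_diff_right)
    also have "\<dots> = 0"
      using wd velocity_imp_weak_deriv[OF vV T p] that by (simp add: is_weak_deriv_def)
    finally show ?thesis .
  qed
  have eq: "f a = f b" if ab: "0 < a" "a < b" "b < T" for a b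
  proof -
    have "norm (f a - f b) \<le> 0 + e" if "0 < e" for e
    proof -
      have e2: "0 < e / 2" using \<open>0 < e\<close> by simp
      have abT: "a \<in> {0..T}" "b \<in> {0..T}" using ab by auto
      obtain d1 where d1: "0 < d1" "\<And>t. t \<in> {0..T} \<Longrightarrow> dist t a < d1 \<Longrightarrow> dist (f t) (f a) < e / 2"
        using f e2 abT unfolding continuous_on_iff by blast
      obtain d2 where d2: "0 < d2" "\<And>t. t \<in> {0..T} \<Longrightarrow> dist t b < d2 \<Longrightarrow> dist (f t) (f b) < e / 2"
        using f e2 abT unfolding continuous_on_iff by blast
      \<comment> \<open>Short enough for each bump to stay within the continuity neighbourhood of
        its point, and for the second one to end before \<open>T\<close>.\<close>
      define h where "h = min (min d1 d2) (T - b) / 2"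
      have h: "0 < h" "h < d1" "h < d2" "b + h < T" using d1 d2 ab by (auto simp: h_def min_def field_simps)
      obtain c1 where c1: "0 < c1" "integral {0..T} (bump a (a + h) [:c1:] 0) = 1"
        using normalized_bump[of a "a + h" T] ab h by auto
      obtain c2 where c2: "0 < c2" "integral {0..T} (bump b (b + h) [:c2:] 0) = 1"
        using normalized_bump[of b "b + h" T] ab h by auto
      let ?b1 = "bump a (a + h) [:c1:] 0" and ?b2 = "bump b (b + h) [:c2:] 0"
      obtain \<phi> where \<phi>: "\<phi> \<in> test_functions T" "deriv \<phi> = (\<lambda>t. ?b1 t - ?b2 t)"
        using bump_test_function[of a "a + h" "b + h" b T "[:c1:]" "[:c2:]"] ab h c1 c2 by auto
      have 1: "norm ((\<integral>t. ?b1 t *\<^sub>R f t \<partial>leb T) - f a) \<le> e / 2"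
        using d1(2) h ab c1 by (intro bump_average f) (auto simp: dist_norm less_imp_le)
      have 2: "norm ((\<integral>t. ?b2 t *\<^sub>R f t \<partial>leb T) - f b) \<le> e / 2"
        using d2(2) h ab c2 by (intro bump_average f) (auto simp: dist_norm less_imp_le)
      have "integrable (leb T) (\<lambda>t. ?b1 t *\<^sub>R f t)" "integrable (leb T) (\<lambda>t. ?b2 t *\<^sub>R f t)"
        using h by (intro integrable_leb_continuous continuous_intros continuous_bump f; simp)+
      then have "(\<integral>t. ?b1 t *\<^sub>R f t \<partial>leb T) = (\<integral>t. ?b2 t *\<^sub>R f t \<partial>leb T)"
        using zero[OF \<phi>(1)] by (simp add: \<phi>(2) scaleR_diff_left)
      then have "norm (f a - f b) \<le> norm ((\<integral>t. ?b1 t *\<^sub>R f t \<partial>leb T) - f a) + norm ((\<integral>t. ?b2 t *\<^sub>R f t \<partial>leb T) - f b)"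
        using norm_triangle_ineq4[of "(\<integral>t. ?b2 t *\<^sub>R f t \<partial>leb T) - f b" "(\<integral>t. ?b1 t *\<^sub>R f t \<partial>leb T) - f a"]
        by (simp add: algebra_simps)
      then show ?thesis using 1 2 by simp
    qed
    then have "norm (f a - f b) \<le> 0" by (rule field_le_epsilon)
    then show ?thesis by simp
  qed
  have half: "f t = f (T / 2)" if "t \<in> {0<..<T}" for t
  proof -
    consider "t < T / 2" | "t = T / 2" | "T / 2 < t" by linarith
    then show ?thesis
    proof cases
      case 1
      then show ?thesis using that T by (intro eq) auto
    next
      case 2
      then show ?thesis by (rule arg_cong)
    next
      case 3
      then show ?thesis using that T by (intro eq[symmetric]) auto
    qed
  qed
  have const: "f t = f (T / 2)" if "t \<in> {0..T}" for t
  proof (rule continuous_constant_on_closure[OF _ half])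
    show "continuous_on (closure {0<..<T}) f" "t \<in> closure {0<..<T}"
      using f that T by (simp_all add: closure_greaterThanLessThan)
  qed
  have "y t - y 0 = V t - V 0" if "t \<in> {0..T}" for t
  proof -
    have "f 0 = f (T / 2)" by (rule const) (use T in simp)
    with const[OF that] have "f t = f 0" by (rule trans[OF _ sym])
    then show ?thesis by (simp add: f_def algebra_simps)
  qed
  then show ?thesis using V v by (simp add: velocity_def)
qed

section \<open>Limits of trajectories with bounded energy\<close>

text \<open>Strong convexity of \<open>\<Phi>\<close>, with a constant degenerating as the arguments
  grow. Here \<open>\<Phi> a\<close> is the length of the vector \<open>(1, a)\<close>, and
  \<open>X = 1 + a \<bullet> b\<close> is the inner product of \<open>(1, a)\<close> and
  \<open>(1, b)\<close>. With \<open>x\<close>, \<open>y\<close>, \<open>m\<close> the values of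
  \<open>\<Phi>\<close> at \<open>a\<close>, \<open>b\<close> and the midpoint,
  \<open>(x + y)\<^sup>2 - 4 * m\<^sup>2 = 2 * (x * y - X)\<close>, while Cauchy-Schwarz gives
  \<open>(x * y)\<^sup>2 - X\<^sup>2 \<ge> (norm (a - b))\<^sup>2\<close>. Factoring both
  differences of squares leaves sums that \<open>Z\<close> bounds.\<close>

lemma sqrt_one_plus_square_midpoint:
  fixes a b :: "'a::real_inner"
  defines "\<Phi> \<equiv> \<lambda>x::'a. sqrt (1 + (norm x)\<^sup>2)"
  shows "(norm (a - b))\<^sup>2 \<le> 4 * (1 + ((norm a)\<^sup>2 + (norm b)\<^sup>2) / 2)\<^sup>2 * (\<Phi> a + \<Phi> b - 2 * \<Phi> ((1/2) *\<^sub>R (a + b)))"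
proof -
  define A B c where "A = a \<bullet> a" and "B = b \<bullet> b" and "c = a \<bullet> b"
  define Z where "Z = 1 + (A + B) / 2"
  define x y m where "x = \<Phi> a" and "y = \<Phi> b" and "m = \<Phi> ((1/2) *\<^sub>R (a + b))"
  have AB: "0 \<le> A" "0 \<le> B" "c\<^sup>2 \<le> A * B"
    using Cauchy_Schwarz_ineq[of a b] by (auto simp: A_def B_def c_def)
  have d: "(norm (a - b))\<^sup>2 = A + B - 2 * c" "0 \<le> A + B - 2 * c"
  proof -
    show *: "(norm (a - b))\<^sup>2 = A + B - 2 * c"
      by (simp add: power2_norm_eq_inner A_def B_def c_def inner_diff_left inner_diff_right inner_commute)
    show "0 \<le> A + B - 2 * c" unfolding *[symmetric] by simp
  qed
  have mm: "(norm ((1/2) *\<^sub>R (a + b)))\<^sup>2 = (A + B + 2 * c) / 4"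
    unfolding power2_norm_eq_inner
    by (simp add: A_def B_def c_def inner_add_left inner_add_right inner_commute)
  have "0 \<le> (A + B + 2 * c) / 4" unfolding mm[symmetric] by simp
  then have s: "0 \<le> A + B + 2 * c" by simp
  have "m\<^sup>2 = 1 + (norm ((1/2) *\<^sub>R (a + b)))\<^sup>2"
    unfolding m_def \<Phi>_def by (rule real_sqrt_pow2) simp
  then have sq: "x\<^sup>2 = 1 + A" "y\<^sup>2 = 1 + B" "m\<^sup>2 = 1 + (A + B + 2 * c) / 4" and nn: "1 \<le> x" "1 \<le> y"
    using AB mm by (simp_all add: x_def y_def \<Phi>_def power2_norm_eq_inner A_def B_def)
  have Z1: "1 \<le> Z" using AB by (simp add: Z_def)
  have xy: "x * y \<le> Z"
  proof -
    have "2 * (x * y) \<le> x\<^sup>2 + y\<^sup>2" using sum_squares_bound[of x y] by (simp add: mult.assoc)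
    also have "\<dots> = 2 * Z" unfolding sq Z_def by simp
    finally show ?thesis by simp
  qed
  define X where "X = 1 + c"
  have XZ: "X \<le> Z" "- X \<le> Z" using d s by (simp_all add: X_def Z_def field_simps)
  have "(x * y)\<^sup>2 = (1 + A) * (1 + B)" by (simp add: power_mult_distrib sq)
  then have "(x * y - X) * (x * y + X) \<ge> A + B - 2 * c"
    using AB by (simp add: X_def power2_eq_square algebra_simps)
  moreover have Xxy: "X \<le> x * y"
  proof (rule power2_le_imp_le)
    show "X\<^sup>2 \<le> (x * y)\<^sup>2"
      using \<open>(x * y)\<^sup>2 = (1 + A) * (1 + B)\<close> AB d by (simp add: X_def power2_eq_square algebra_simps)
  qed (use nn in simp)
  then have "(x * y - X) * (x * y + X) \<le> (x * y - X) * (2 * Z)"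
    using xy XZ by (intro mult_left_mono) auto
  ultimately have 1: "A + B - 2 * c \<le> (x * y - X) * (2 * Z)" by linarith
  have 2: "(x + y)\<^sup>2 - 4 * m\<^sup>2 = 2 * (x * y - X)"
    using sq by (simp add: X_def power2_eq_square algebra_simps)
  then have "(2 * m)\<^sup>2 \<le> (x + y)\<^sup>2" using Xxy by (simp add: power_mult_distrib)
  then have m2: "2 * m \<le> x + y" by (rule power2_le_imp_le) (use nn in simp)
  have "x * 1 \<le> x * x" "y * 1 \<le> y * y" using nn by (intro mult_left_mono; simp)+
  then have "x + y \<le> x\<^sup>2 + y\<^sup>2" by (simp add: power2_eq_square)
  also have "\<dots> = 2 * Z" unfolding sq Z_def by simp
  finally have xyZ: "x + y \<le> 2 * Z" .
  have "A + B - 2 * c \<le> ((x + y)\<^sup>2 - 4 * m\<^sup>2) * Z" unfolding 2 using 1 by (simp only: mult_ac)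
  also have "\<dots> = (x + y - 2 * m) * ((x + y + 2 * m) * Z)" by (simp add: power2_eq_square algebra_simps)
  also have "\<dots> \<le> (x + y - 2 * m) * (4 * Z * Z)"
    using m2 xyZ Z1 by (intro mult_left_mono mult_right_mono) auto
  finally have "A + B - 2 * c \<le> 4 * Z\<^sup>2 * (x + y - 2 * m)" by (simp add: power2_eq_square mult_ac)
  then have "(norm (a - b))\<^sup>2 \<le> 4 * Z\<^sup>2 * (x + y - 2 * m)" unfolding d .
  then show ?thesis unfolding x_def y_def m_def Z_def A_def B_def power2_norm_eq_inner .
qed

text \<open>Controls the \<open>L\<^sup>1\<close> distance by the defect of convexity of \<open>sqrt (1 + x\<^sup>2)\<close>, up to errors made small
  by the choice of \<open>d\<close> and \<open>R\<close>.\<close>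

lemma norm_diff_le_convexity_defect:
  fixes a b :: "'a::real_inner"
  defines "\<Phi> \<equiv> \<lambda>x::'a. sqrt (1 + (norm x)\<^sup>2)"
  assumes d: "0 < d" and R: "0 < R" and p: "1 \<le> p"
  shows "norm (a - b) \<le> d + (1 + R\<^sup>2)\<^sup>2 / d * (\<Phi> a + \<Phi> b - 2 * \<Phi> ((1/2) *\<^sub>R (a + b)))
    + 2 * R powr (1 - p) * (norm a powr p + norm b powr p)"
proof -
  define D where "D = \<Phi> a + \<Phi> b - 2 * \<Phi> ((1/2) *\<^sub>R (a + b))"
  define Z where "Z = 1 + ((norm a)\<^sup>2 + (norm b)\<^sup>2) / 2"
  have Z: "1 \<le> Z" by (simp add: Z_def)
  have main: "(norm (a - b))\<^sup>2 \<le> 4 * Z\<^sup>2 * D"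
    using sqrt_one_plus_square_midpoint[of a b] by (simp add: D_def Z_def \<Phi>_def)
  have D: "0 \<le> D"
  proof -
    have "0 \<le> 4 * Z\<^sup>2 * D" using main by (rule order_trans[rotated]) simp
    then show ?thesis using Z by (simp add: zero_le_mult_iff)
  qed
  show ?thesis
  proof (cases "norm a \<le> R \<and> norm b \<le> R")
    case True
    then have "(norm a)\<^sup>2 \<le> R\<^sup>2" "(norm b)\<^sup>2 \<le> R\<^sup>2" by (auto intro: power_mono)
    then have "Z\<^sup>2 \<le> (1 + R\<^sup>2)\<^sup>2" by (intro power_mono) (auto simp: Z_def)
    then have "(norm (a - b))\<^sup>2 \<le> 4 * (1 + R\<^sup>2)\<^sup>2 * D"
      using main D by (smt (verit) mult_right_mono)
    then have "(norm (a - b))\<^sup>2 / (4 * d) \<le> (1 + R\<^sup>2)\<^sup>2 / d * D"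
      using d by (simp add: field_simps)
    moreover have "norm (a - b) \<le> d + (norm (a - b))\<^sup>2 / (4 * d)"
    proof -
      have "0 \<le> (norm (a - b) - 2 * d)\<^sup>2" by simp
      then show ?thesis using d by (simp add: field_simps power2_eq_square)
    qed
    moreover have "0 \<le> 2 * R powr (1 - p) * (norm a powr p + norm b powr p)" by simp
    ultimately show ?thesis unfolding D_def by linarith
  next
    case False
    \<comment> \<open>If the larger norm exceeds \<open>R\<close>, the distance is at most twice
      that norm, and the tail factor \<open>R powr (1 - p)\<close> trades it for the
      \<open>p\<close>-th power.\<close>
    have key: "norm (x - z) \<le> 2 * (R powr (1 - p) * norm x powr p)"
      if "norm z \<le> norm x" "R < norm x" for x z :: 'a
    proof -
      have "norm x powr (1 - p) * norm x powr p \<le> R powr (1 - p) * norm x powr p"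
        using that p R by (intro mult_right_mono powr_mono2') auto
      moreover have "norm x powr (1 - p) * norm x powr p = norm x"
        using that R by (simp flip: powr_add)
      ultimately show ?thesis using norm_triangle_ineq4[of x z] that by linarith
    qed
    have "norm (a - b) \<le> 2 * R powr (1 - p) * (norm a powr p + norm b powr p)"
    proof (cases "norm b \<le> norm a")
      case True
      then have "norm (a - b) \<le> 2 * (R powr (1 - p) * norm a powr p)" using False by (intro key) auto
      moreover have "0 \<le> 2 * (R powr (1 - p) * norm b powr p)" by simp
      ultimately show ?thesis unfolding distrib_left mult.assoc by linarith
    next
      case F: False
      then have "norm (b - a) \<le> 2 * (R powr (1 - p) * norm b powr p)" using False by (intro key) auto
      moreover have "0 \<le> 2 * (R powr (1 - p) * norm a powr p)" by simp
      ultimately show ?thesis unfolding distrib_left mult.assoc norm_minus_commute[of a] by linarith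
    qed
    moreover have "0 \<le> (1 + R\<^sup>2)\<^sup>2 / d * D" using D d by simp
    ultimately show ?thesis using d unfolding D_def by linarith
  qed
qed

lemma powr_midpoint_le:
  fixes a b :: "'a::real_normed_vector"
  assumes "1 \<le> p"
  shows "norm ((1/2) *\<^sub>R (a + b)) powr p \<le> (norm a powr p + norm b powr p) / 2"
proof -
  have "norm ((1/2) *\<^sub>R (a + b)) powr p \<le> ((norm a + norm b) / 2) powr p"
    using assms norm_triangle_ineq[of a b] by (intro powr_mono2) auto
  also have "\<dots> \<le> (norm a powr p + norm b powr p) / 2"
  proof (cases "a = 0 \<or> b = 0")
    case True
    have "(x / 2) powr p \<le> x powr p / 2" if "0 \<le> x" for x :: real
    proof -
      have "2 powr 1 \<le> 2 powr p" using assms by (intro powr_mono) auto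
      then have "x powr p / 2 powr p \<le> x powr p / 2" by (intro divide_left_mono) auto
      then show ?thesis using that by (simp add: powr_divide)
    qed
    with True show ?thesis by auto
  next
    case False
    then show ?thesis
      using convex_onD[OF powr_convex[OF assms], of "1/2" "norm a" "norm b"] by (simp add: field_simps)
  qed
  finally show ?thesis .
qed

text \<open>No weak compactness is needed: the functions whose primitive is close to \<open>u\<close> form a decreasing
  sequence of convex sets, and near-minimizers of the strictly convex functional
  \<open>\<integral> sqrt (1 + |g|\<^sup>2)\<close> on these sets form a Cauchy sequence in \<open>L\<^sup>1\<close>.\<close>

lemma velocity_limit:
  fixes u :: "real \<Rightarrow> 'a::euclidean_space" and vs :: "nat \<Rightarrow> real \<Rightarrow> 'a"
  assumes T: "0 < T" and p: "1 < p" and vs: "\<And>n. vs n \<in> Lp T p"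
    and K: "\<And>n. (\<integral>t. norm (vs n t) powr p \<partial>leb T) \<le> K"
    and lim: "uniform_limit {0..T} (\<lambda>n t. integral {0..t} (vs n)) (\<lambda>t. u t - u 0) sequentially"
  obtains v where "velocity T p u v"
proof -
  interpret finite_measure "leb T" by (rule finite_measure_leb)
  define \<Phi> where "\<Phi> x = sqrt (1 + (norm x)\<^sup>2)" for x :: 'a
  \<comment> \<open>The energy bound belongs to the set: it is preserved by midpoints, controls the
    large values of near-minimizers, and passes to their limit by Fatou's lemma.\<close>
  define C where "C n = {g \<in> Lp T p. (\<integral>t. norm (g t) powr p \<partial>leb T) \<le> K \<and>
     (\<forall>t\<in>{0..T}. norm (integral {0..t} g - (u t - u 0)) \<le> 1 / Suc n)}" for n
  have C_Lp: "g \<in> Lp T p" if "g \<in> C n" for g n using that by (simp add: C_def)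
  have C_meas: "g \<in> borel_measurable (leb T)" if "g \<in> C n" for g n
    using C_Lp[OF that] by (simp add: Lp_def)
  have C_int: "integrable (leb T) g" if "g \<in> C n" for g n
    using Lp_imp_integrable[OF C_Lp[OF that]] p by simp
  have C_intp: "integrable (leb T) (\<lambda>t. norm (g t) powr p)" if "g \<in> C n" for g n
    using C_Lp[OF that] by (simp add: Lp_def)
  have C_ai: "g absolutely_integrable_on {0..T}" if "g \<in> C n" for g n
    using C_int[OF that] by (simp add: integrable_leb_iff)
  have C_io: "g integrable_on {0..t}" if "g \<in> C n" "t \<in> {0..T}" for g n t
    using that(2) by (intro integrable_subinterval_real[OF set_lebesgue_integral_eq_integral(1)[OF C_ai[OF that(1)]]]) auto
  have C_mono: "g \<in> C m" if "g \<in> C n" "m \<le> n" for g m n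
  proof -
    have "1 / real (Suc n) \<le> 1 / real (Suc m)" using that by (intro divide_left_mono) auto
    with that show ?thesis by (force simp: C_def)
  qed
  have C_ne: "\<exists>g. g \<in> C n" for n
  proof -
    from uniform_limitD[OF lim, of "1 / Suc n"] obtain k where
      "\<forall>t\<in>{0..T}. dist (integral {0..t} (vs k)) (u t - u 0) < 1 / Suc n"
      by (auto simp: eventually_sequentially)
    then have "vs k \<in> C n" using vs K by (auto simp: C_def dist_norm intro: less_imp_le)
    then show ?thesis by blast
  qed
  have C_mid: "(\<lambda>t. (1/2) *\<^sub>R (g t + h t)) \<in> C n" if g: "g \<in> C n" and h: "h \<in> C n" for g h n
  proof -
    let ?m = "\<lambda>t. (1/2) *\<^sub>R (g t + h t)"
    have i2: "integrable (leb T) (\<lambda>t. (norm (g t) powr p + norm (h t) powr p) / 2)"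
      using C_intp[OF g] C_intp[OF h] by simp
    have mLp: "?m \<in> Lp T p"
      using p C_meas[OF g] C_meas[OF h]
      by (intro Lp_dominated[OF _ i2] AE_I2 powr_midpoint_le) auto
    have "(\<integral>t. norm (?m t) powr p \<partial>leb T) \<le> (\<integral>t. (norm (g t) powr p + norm (h t) powr p) / 2 \<partial>leb T)"
    proof (rule integral_mono[OF _ i2])
      show "integrable (leb T) (\<lambda>t. norm (?m t) powr p)" using mLp by (simp add: Lp_def)
    qed (use p in \<open>intro powr_midpoint_le, simp\<close>)
    also have "\<dots> = ((\<integral>t. norm (g t) powr p \<partial>leb T) + (\<integral>t. norm (h t) powr p \<partial>leb T)) / 2"
      using C_intp[OF g] C_intp[OF h] by simp
    also have "\<dots> \<le> K" using g h by (simp add: C_def)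
    finally have "(\<integral>t. norm (?m t) powr p \<partial>leb T) \<le> K" .
    moreover have "norm (integral {0..t} ?m - (u t - u 0)) \<le> 1 / Suc n" if t: "t \<in> {0..T}" for t
    proof -
      have "integral {0..t} ?m = (1/2) *\<^sub>R (integral {0..t} g + integral {0..t} h)"
        using C_io[OF g t] C_io[OF h t] by (simp add: Henstock_Kurzweil_Integration.integral_add)
      then have "integral {0..t} ?m - (u t - u 0)
          = (1/2) *\<^sub>R ((integral {0..t} g - (u t - u 0)) + (integral {0..t} h - (u t - u 0)))"
        by (simp add: algebra_simps flip: scaleR_add_left)
      also have "norm \<dots> \<le> (1/2) * (norm (integral {0..t} g - (u t - u 0)) + norm (integral {0..t} h - (u t - u 0)))"
        unfolding norm_scaleR by (intro mult_mono norm_triangle_ineq) auto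
      also have "\<dots> \<le> (1/2) * (1 / Suc n + 1 / Suc n)"
        using g h t by (intro mult_left_mono add_mono) (auto simp: C_def)
      finally show ?thesis by simp
    qed
    ultimately show ?thesis using mLp by (simp add: C_def)
  qed
  define F where "F g = (\<integral>t. \<Phi> (g t) \<partial>leb T)" for g
  have \<Phi>_le: "\<Phi> x \<le> 1 + norm x" "0 \<le> \<Phi> x" for x
    by (auto simp: \<Phi>_def intro!: real_le_lsqrt simp: power2_eq_square algebra_simps)
  have "continuous_on UNIV \<Phi>" unfolding \<Phi>_def by (intro continuous_intros)
  then have \<Phi>m: "\<Phi> \<in> borel_measurable borel" by (rule borel_measurable_continuous_onI)
  have \<Phi>i: "integrable (leb T) (\<lambda>t. \<Phi> (g t))" if "g \<in> C n" for g n
  proof (rule Bochner_Integration.integrable_bound)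
    show "integrable (leb T) (\<lambda>t. 1 + norm (g t))" using C_int[OF that] by simp
    show "(\<lambda>t. \<Phi> (g t)) \<in> borel_measurable (leb T)"
      using C_meas[OF that] \<Phi>m by (rule measurable_compose)
    show "AE t in leb T. norm (\<Phi> (g t)) \<le> norm (1 + norm (g t))"
      using \<Phi>_le by (intro AE_I2) simp
  qed
  have F0: "0 \<le> F g" for g unfolding F_def by (intro integral_nonneg_AE AE_I2 \<Phi>_le)
  have F_le: "F g \<le> T + (T + K)" if "g \<in> C n" for g n
  proof -
    have "F g \<le> (\<integral>t. 1 + norm (g t) \<partial>leb T)"
      unfolding F_def using \<Phi>i[OF that] C_int[OF that] \<Phi>_le by (intro integral_mono) auto
    also have "\<dots> = T + (\<integral>t. norm (g t) \<partial>leb T)"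
      using C_int[OF that] measure_leb[of T] T by simp
    also have "(\<integral>t. norm (g t) \<partial>leb T) \<le> T + K"
      using Lp_bounded_imp_L1_bounded[OF T _ C_Lp[OF that]] that p by (simp add: C_def)
    finally show ?thesis by simp
  qed
  \<comment> \<open>The sets decrease, so the infima increase; the energy bound keeps them below a
    constant, hence they converge.\<close>
  define I where "I n = (INF g\<in>C n. F g)" for n
  have bdd: "bdd_below (F ` C n)" for n by (rule bdd_belowI[of _ 0]) (auto simp: F0)
  have I_le: "I n \<le> F g" if "g \<in> C n" for g n unfolding I_def using bdd that by (rule cINF_lower)
  have I_bound: "I n \<le> T + (T + K)" for n using C_ne[of n] I_le F_le order_trans by blast
  have "incseq I"
  proof (rule monoI)
    fix m n :: nat assume "m \<le> n"
    then show "I m \<le> I n"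
      unfolding I_def[of n] using C_ne[of n] by (intro cINF_greatest I_le[OF C_mono[OF _ \<open>m \<le> n\<close>]]) auto
  qed
  then obtain S where S: "I \<longlonglongrightarrow> S" and IS: "\<And>n. I n \<le> S"
    using incseq_convergent[of I "T + (T + K)"] I_bound by blast
  have "\<exists>g. g \<in> C n \<and> F g \<le> I n + 1 / Suc n" for n
  proof (rule ccontr)
    assume "\<not> ?thesis"
    then have "I n + 1 / Suc n \<le> I n"
      unfolding I_def[of n] using C_ne[of n] by (intro cINF_greatest) (auto simp: I_def[symmetric] not_le intro: less_imp_le)
    then show False by (simp add: field_simps)
  qed
  then obtain g where g: "\<And>n. g n \<in> C n" "\<And>n. F (g n) \<le> I n + 1 / Suc n" by metis
  note gint = C_int[OF g(1)] and gintp = C_intp[OF g(1)]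
  define D where "D i j t = \<Phi> (g i t) + \<Phi> (g j t) - 2 * \<Phi> ((1/2) *\<^sub>R (g i t + g j t))" for i j t
  \<comment> \<open>For \<open>i, j \<ge> N\<close> the midpoint of \<open>g i\<close> and
    \<open>g j\<close> lies in \<open>C N\<close>, so its value under \<open>F\<close> is at least
    \<open>I N\<close>. Thus the convexity defect is at most \<open>2 * (S - I N)\<close> plus the
    slack of the near-minimizers.\<close>
  have D_small: "\<exists>N. \<forall>i\<ge>N. \<forall>j\<ge>N. integrable (leb T) (D i j) \<and> (\<integral>t. D i j t \<partial>leb T) < e" if "0 < e" for e
  proof -
    have "(\<lambda>N. 2 * (S - I N) + 2 * inverse (real (Suc N))) \<longlonglongrightarrow> 2 * (S - S) + 2 * 0"
      by (intro tendsto_intros S LIMSEQ_inverse_real_of_nat)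
    then have "\<forall>\<^sub>F N in sequentially. 2 * (S - I N) + 2 * inverse (real (Suc N)) < e"
      using that by (intro order_tendstoD(2)) auto
    then obtain N where N: "2 * (S - I N) + 2 * inverse (real (Suc N)) < e"
      by (auto simp: eventually_sequentially)
    have "integrable (leb T) (D i j) \<and> (\<integral>t. D i j t \<partial>leb T) < e" if "i \<ge> N" "j \<ge> N" for i j
    proof
      let ?m = "\<lambda>t. (1/2) *\<^sub>R (g i t + g j t)"
      have m: "?m \<in> C N" by (rule C_mid[OF C_mono[OF g(1) that(1)] C_mono[OF g(1) that(2)]])
      show "integrable (leb T) (D i j)"
        unfolding D_def using \<Phi>i[OF g(1)] \<Phi>i[OF m] by simp
      have "(\<integral>t. D i j t \<partial>leb T) = F (g i) + F (g j) - 2 * F ?m"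
        unfolding D_def F_def using \<Phi>i[OF g(1)] \<Phi>i[OF m] by simp
      also have "\<dots> \<le> (I i + 1 / Suc i) + (I j + 1 / Suc j) - 2 * I N"
        using g(2)[of i] g(2)[of j] I_le[OF m] by linarith
      also have "\<dots> \<le> (S + inverse (real (Suc N))) + (S + inverse (real (Suc N))) - 2 * I N"
      proof -
        have "1 / real (Suc k) \<le> inverse (real (Suc N))" if "k \<ge> N" for k
          using that by (simp add: field_simps)
        then show ?thesis using IS[of i] IS[of j] that by (intro diff_right_mono add_mono) auto
      qed
      finally show "(\<integral>t. D i j t \<partial>leb T) < e" using N by (simp add: algebra_simps)
    qed
    then show ?thesis by blast
  qed
  have K0: "0 \<le> K" using K[of 0] by (rule order_trans[rotated]) simp
  have cauchy: "\<exists>N. \<forall>i\<ge>N. \<forall>j\<ge>N. (\<integral>t. norm (g i t - g j t) \<partial>leb T) < e" if e: "0 < e" for e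
  proof -
    \<comment> \<open>The three terms of \<open>norm_diff_le_convexity_defect\<close> cost
      \<open>e / 4\<close> each: the first through \<open>d\<close>, the tail through
      \<open>R\<close>, and the defect, whose factor \<open>A\<close> depends on both, through
      \<open>N\<close> at last.\<close>
    define d where "d = e / (4 * T)"
    have d: "0 < d" using e T by (simp add: d_def)
    define R where "R = (e / (16 * (K + 1))) powr (1 / (1 - p))"
    have eK: "0 < e / (16 * (K + 1))" using e K0 by simp
    have R: "0 < R" "R powr (1 - p) = e / (16 * (K + 1))"
      using eK p e K0 by (auto simp: R_def powr_powr)
    define A where "A = (1 + R\<^sup>2)\<^sup>2 / d"
    have "0 < 1 + R\<^sup>2" by (intro add_pos_nonneg) auto
    then have A: "0 < A" using d by (simp add: A_def)
    obtain N where N: "\<And>i j. i \<ge> N \<Longrightarrow> j \<ge> N \<Longrightarrow> integrable (leb T) (D i j)"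
      "\<And>i j. i \<ge> N \<Longrightarrow> j \<ge> N \<Longrightarrow> (\<integral>t. D i j t \<partial>leb T) < e / (4 * A)"
      using D_small[of "e / (4 * A)"] e A by auto
    have "(\<integral>t. norm (g i t - g j t) \<partial>leb T) < e" if ij: "i \<ge> N" "j \<ge> N" for i j
    proof -
      let ?G = "\<lambda>t. d + A * D i j t + 2 * R powr (1 - p) * (norm (g i t) powr p + norm (g j t) powr p)"
      have "(\<integral>t. norm (g i t - g j t) \<partial>leb T) \<le> (\<integral>t. ?G t \<partial>leb T)"
      proof (rule integral_mono)
        show "integrable (leb T) (\<lambda>t. norm (g i t - g j t))" using gint by simp
        show "integrable (leb T) ?G" using N(1)[OF ij] gintp by simp
        show "norm (g i t - g j t) \<le> ?G t" for t
          using norm_diff_le_convexity_defect[OF d R(1), of p "g i t" "g j t"] p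
          by (simp add: D_def A_def \<Phi>_def)
      qed
      also have "\<dots> = d * T + A * (\<integral>t. D i j t \<partial>leb T) + 2 * R powr (1 - p) *
          ((\<integral>t. norm (g i t) powr p \<partial>leb T) + (\<integral>t. norm (g j t) powr p \<partial>leb T))"
        using N(1)[OF ij] gintp measure_leb[of T] T by simp
      also have "\<dots> < d * T + A * (e / (4 * A)) + 2 * (e / (16 * (K + 1))) * (K + 1 + (K + 1))"
        using N(2)[OF ij] A g(1)[of i] g(1)[of j] eK unfolding R(2)
        by (intro add_less_le_mono add_strict_left_mono mult_strict_left_mono mult_left_mono)
          (auto simp: C_def)
      also have "\<dots> \<le> e"
      proof -
        have "2 * (e / (16 * x)) * (x + x) = e / 4" if "0 < x" for x using that by simp
        from this[of "K + 1"] have "2 * (e / (16 * (K + 1))) * (K + 1 + (K + 1)) = e / 4" using K0 by simp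
        moreover have "d * T = e / 4" "A * (e / (4 * A)) = e / 4" using A T by (simp_all add: d_def)
        ultimately show ?thesis using e by linarith
      qed
      finally show ?thesis .
    qed
    then show ?thesis by blast
  qed
  obtain r where r: "strict_mono r" and ae: "AE t in leb T. Cauchy (\<lambda>i. g (r i) t)"
    using cauchy_L1_AE_cauchy_subseq[OF gint cauchy] by blast
  define v where "v t = lim (\<lambda>i. g (r i) t)" for t
  have vm: "v \<in> borel_measurable (leb T)"
    unfolding v_def using C_meas[OF g(1)] by measurable
  have aelim: "AE t in leb T. (\<lambda>i. g (r i) t) \<longlonglongrightarrow> v t"
    using ae by eventually_elim (simp add: v_def Cauchy_convergent_iff convergent_LIMSEQ_iff)
  have "(\<integral>\<^sup>+t. ennreal (norm (v t) powr p) \<partial>leb T) \<le> ennreal K"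
  proof -
    have "(\<integral>\<^sup>+t. ennreal (norm (v t) powr p) \<partial>leb T)
        = (\<integral>\<^sup>+t. liminf (\<lambda>i. ennreal (norm (g (r i) t) powr p)) \<partial>leb T)"
    proof (rule nn_integral_cong_AE)
      show "AE t in leb T. ennreal (norm (v t) powr p) = liminf (\<lambda>i. ennreal (norm (g (r i) t) powr p))"
        using aelim
      proof eventually_elim
        case (elim t)
        have "(\<lambda>i. norm (g (r i) t) powr p) \<longlonglongrightarrow> norm (v t) powr p"
          using p by (intro tendsto_powr' tendsto_norm elim tendsto_const) auto
        then have "(\<lambda>i. ennreal (norm (g (r i) t) powr p)) \<longlonglongrightarrow> ennreal (norm (v t) powr p)"
          by (rule tendsto_ennrealI)
        then show ?case by (intro lim_imp_Liminf[symmetric]) auto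
      qed
    qed
    also have "\<dots> \<le> liminf (\<lambda>i. \<integral>\<^sup>+t. ennreal (norm (g (r i) t) powr p) \<partial>leb T)"
      using C_meas[OF g(1)] by (intro nn_integral_liminf) measurable
    also have "\<dots> \<le> liminf (\<lambda>i. ennreal K)"
    proof (intro Liminf_mono always_eventually allI)
      fix i
      have "(\<integral>\<^sup>+t. ennreal (norm (g (r i) t) powr p) \<partial>leb T) = ennreal (\<integral>t. norm (g (r i) t) powr p \<partial>leb T)"
        using gintp by (intro nn_integral_eq_integral) auto
      then show "(\<integral>\<^sup>+t. ennreal (norm (g (r i) t) powr p) \<partial>leb T) \<le> ennreal K"
        using g(1)[of "r i"] by (simp add: C_def ennreal_leI)
    qed
    also have "\<dots> = ennreal K" by (intro Liminf_const) simp
    finally show ?thesis .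
  qed
  then have "integrable (leb T) (\<lambda>t. norm (v t) powr p)"
    using vm by (intro integrableI_bounded) (auto simp: top_unique le_less_trans[OF _ ennreal_less_top])
  with vm have vLp: "v \<in> Lp T p" by (simp add: Lp_def)
  have vi: "integrable (leb T) v" using Lp_imp_integrable[OF vLp] p by simp
  have vai: "v absolutely_integrable_on {0..T}" using vi by (simp add: integrable_leb_iff)
  \<comment> \<open>Fatou's lemma in the second index turns the Cauchy property into
    \<open>L1\<close> convergence to \<open>v\<close>, for the whole sequence and not only along
    \<open>r\<close>.\<close>
  have L1: "\<exists>N. \<forall>i\<ge>N. (\<integral>t. norm (g i t - v t) \<partial>leb T) \<le> e" if e: "0 < e" for e
  proof -
    obtain N where N: "\<And>i j. i \<ge> N \<Longrightarrow> j \<ge> N \<Longrightarrow> (\<integral>t. norm (g i t - g j t) \<partial>leb T) < e"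
      using cauchy[OF e] by blast
    have "(\<integral>t. norm (g i t - v t) \<partial>leb T) \<le> e" if i: "i \<ge> N" for i
    proof -
      have "ennreal (\<integral>t. norm (g i t - v t) \<partial>leb T) = (\<integral>\<^sup>+t. ennreal (norm (g i t - v t)) \<partial>leb T)"
        using gint vi by (intro nn_integral_eq_integral[symmetric]) auto
      also have "\<dots> = (\<integral>\<^sup>+t. liminf (\<lambda>j. ennreal (norm (g i t - g (r j) t))) \<partial>leb T)"
      proof (rule nn_integral_cong_AE)
        show "AE t in leb T. ennreal (norm (g i t - v t)) = liminf (\<lambda>j. ennreal (norm (g i t - g (r j) t)))"
          using aelim
        proof eventually_elim
          case (elim t)
          then have "(\<lambda>j. ennreal (norm (g i t - g (r j) t))) \<longlonglongrightarrow> ennreal (norm (g i t - v t))"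
            by (intro tendsto_ennrealI tendsto_intros)
          then show ?case by (intro lim_imp_Liminf[symmetric]) auto
        qed
      qed
      also have "\<dots> \<le> liminf (\<lambda>j. \<integral>\<^sup>+t. ennreal (norm (g i t - g (r j) t)) \<partial>leb T)"
        using C_meas[OF g(1)] by (intro nn_integral_liminf) measurable
      also have "\<dots> \<le> liminf (\<lambda>j. ennreal e)"
      proof (intro Liminf_mono eventually_sequentiallyI)
        fix j assume "N \<le> j"
        then have "N \<le> r j" using seq_suble[OF r, of j] by simp
        have "(\<integral>\<^sup>+t. ennreal (norm (g i t - g (r j) t)) \<partial>leb T) = ennreal (\<integral>t. norm (g i t - g (r j) t) \<partial>leb T)"
          using gint by (intro nn_integral_eq_integral) auto
        then show "(\<integral>\<^sup>+t. ennreal (norm (g i t - g (r j) t)) \<partial>leb T) \<le> ennreal e"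
          using N[OF i \<open>N \<le> r j\<close>] by (simp add: ennreal_leI)
      qed
      also have "\<dots> = ennreal e" by (intro Liminf_const) simp
      finally show ?thesis using e by (simp add: ennreal_le_iff)
    qed
    then show ?thesis by blast
  qed
  have "velocity T p u v"
    unfolding velocity_def
  proof (intro conjI ballI vLp)
    fix t assume t: "t \<in> {0..T}"
    have vt: "v integrable_on {0..t}"
      using t by (intro integrable_subinterval_real[OF set_lebesgue_integral_eq_integral(1)[OF vai]]) auto
    have "norm (integral {0..t} v - (u t - u 0)) \<le> 0 + e" if e: "0 < e" for e
    proof -
      obtain N where N: "\<And>i. i \<ge> N \<Longrightarrow> (\<integral>t. norm (g i t - v t) \<partial>leb T) \<le> e / 2"
        using L1[of "e / 2"] e by auto
      obtain n where n: "1 / real (Suc n) < e / 2"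
        using reals_Archimedean[of "e / 2"] e by (auto simp: inverse_eq_divide)
      define i where "i = max N n"
      have gi: "g i \<in> C n" using C_mono[OF g(1)[of i], of n] by (simp add: i_def)
      have ai: "(\<lambda>t. g i t - v t) absolutely_integrable_on {0..T}"
        using gint[of i] vi by (simp flip: integrable_leb_iff)
      have nai: "(\<lambda>t. norm (g i t - v t)) integrable_on {0..T}"
        using set_lebesgue_integral_eq_integral(1)[OF set_integrable_norm[OF ai]] .
      have "norm (integral {0..t} (g i) - integral {0..t} v) = norm (integral {0..t} (\<lambda>t. g i t - v t))"
        using C_io[OF gi t] vt by (simp add: Henstock_Kurzweil_Integration.integral_diff)
      also have "\<dots> \<le> integral {0..t} (\<lambda>t. norm (g i t - v t))"
        using C_io[OF gi t] vt t nai
        by (intro integral_norm_bound_integral integrable_diff integrable_subinterval_real[OF nai]) auto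
      also have "\<dots> \<le> integral {0..T} (\<lambda>t. norm (g i t - v t))"
        using t nai by (intro integral_subset_le integrable_subinterval_real[OF nai]) auto
      also have "\<dots> = (\<integral>t. norm (g i t - v t) \<partial>leb T)"
        using gint vi by (intro integral_leb[symmetric]) auto
      also have "\<dots> \<le> e / 2" using N by (simp add: i_def)
      finally have "norm (integral {0..t} v - integral {0..t} (g i)) \<le> e / 2" by (simp add: norm_minus_commute)
      moreover have "norm (integral {0..t} (g i) - (u t - u 0)) \<le> e / 2"
        using gi t n by (force simp: C_def)
      moreover have split: "integral {0..t} v - (u t - u 0)
          = (integral {0..t} v - integral {0..t} (g i)) + (integral {0..t} (g i) - (u t - u 0))"
        by simp
      ultimately show ?thesis
        using norm_triangle_ineq[of "integral {0..t} v - integral {0..t} (g i)" "integral {0..t} (g i) - (u t - u 0)"]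
        unfolding split by linarith
    qed
    then have "norm (integral {0..t} v - (u t - u 0)) \<le> 0" by (rule field_le_epsilon)
    then show "(v has_integral (u t - u 0)) {0..t}" using vt by (simp add: has_integral_iff)
  qed
  then show ?thesis by (rule that)
qed

section \<open>The junction\<close>

lemma edge_iff: "z \<in> edge i \<longleftrightarrow> 0 \<le> z $ i \<and> (\<forall>j. j \<noteq> i \<longrightarrow> z $ j = 0)"
proof
  assume "0 \<le> z $ i \<and> (\<forall>j. j \<noteq> i \<longrightarrow> z $ j = 0)"
  then have "z = (z $ i) *\<^sub>R axis i 1" "0 \<le> z $ i"
    by (auto simp: vec_eq_iff axis_def)
  then show "z \<in> edge i" unfolding edge_def by blast
qed (auto simp: edge_def axis_def)

lemma junction_iff: "z \<in> junction \<longleftrightarrow> (\<exists>i. z \<in> edge i)"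
  by (simp add: junction_def)

lemma zero_in_edge [simp]: "0 \<in> edge i"
  by (simp add: edge_iff)

lemma norm_edge:
  assumes "z \<in> edge i"
  shows "norm z = z $ i"
proof -
  obtain t where "0 \<le> t" "z = t *\<^sub>R axis i 1" using assms by (auto simp: edge_def)
  then have "z $ i = t" "norm z = t" by (simp_all add: norm_axis_1)
  then show ?thesis by simp
qed

lemma convex_edge: "convex (edge i)"
  by (intro convexI) (auto simp: edge_iff)

lemma closed_edge: "closed (edge i)"
proof -
  have "edge i = {z. 0 \<le> z $ i} \<inter> (\<Inter>j\<in>- {i}. {z. z $ j = 0})"
    by (auto simp: edge_iff)
  also have "closed \<dots>"
    by (intro closed_Int closed_INT ballI closed_Collect_le closed_Collect_eq continuous_intros)
  finally show ?thesis .
qed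

lemma closed_junction: "closed (junction :: (real ^ 'n::finite) set)"
  unfolding junction_def by (rule closed_UN) (auto simp: closed_edge)

lemma norm_junction:
  assumes "z \<in> junction"
  shows "norm z = (\<Sum>j\<in>UNIV. z $ j)"
proof -
  obtain i where i: "z \<in> edge i" using assms by (auto simp: junction_iff)
  then have "(\<Sum>j\<in>UNIV. z $ j) = (\<Sum>j\<in>UNIV. if j = i then z $ i else 0)"
    by (intro sum.cong) (auto simp: edge_iff)
  then show ?thesis using norm_edge[OF i] by simp
qed

lemma junction_nonneg:
  assumes "z \<in> junction"
  shows "0 \<le> z $ j"
proof -
  obtain i where "z \<in> edge i" using assms by (auto simp: junction_iff)
  then show ?thesis by (cases "j = i") (auto simp: edge_iff)
qed

lemma junction_cases [consumes 1, case_names vertex edge]: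
  assumes "z \<in> junction"
  obtains "z = 0" | i where "z \<in> edge i" "0 < z $ i" "\<And>j. j \<noteq> i \<Longrightarrow> z $ j = 0" "norm z = z $ i" "z \<noteq> 0"
proof (cases "z = 0")
  case False
  obtain i where i: "z \<in> edge i" using assms by (auto simp: junction_iff)
  have "0 < z $ i" using zero_less_norm_iff[of z] False unfolding norm_edge[OF i] by blast
  with i False norm_edge[OF i] that(2)[of i] show ?thesis by (auto simp: edge_iff)
qed (use that in blast)

section \<open>Trajectories and the running cost in coordinates\<close>

lemma trajectories_iff:
  fixes y :: "real \<Rightarrow> real ^ 'n::finite"
  assumes T: "0 < T" and p: "1 < p"
  shows "y \<in> trajectories T p x \<longleftrightarrow>
    (\<exists>v. velocity T p y v) \<and> y ` {0..T} \<subseteq> junction \<and> y 0 = x"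
proof
  assume y: "y \<in> trajectories T p x"
  then obtain v where "is_weak_deriv T p y v" by (auto simp: trajectories_def W1p_def)
  then have "velocity T p y v"
    using y T p by (intro weak_deriv_imp_velocity) (auto simp: trajectories_def)
  then show "(\<exists>v. velocity T p y v) \<and> y ` {0..T} \<subseteq> junction \<and> y 0 = x"
    using y by (auto simp: trajectories_def)
next
  assume y: "(\<exists>v. velocity T p y v) \<and> y ` {0..T} \<subseteq> junction \<and> y 0 = x"
  then obtain v where v: "velocity T p y v" by blast
  have c: "continuous_on {0..T} y" using v by (rule velocity_continuous)
  have "continuous_on {0..T} (\<lambda>t. norm (y t) powr p)"
    using p by (intro continuous_on_powr' continuous_intros c) auto
  then have "y \<in> Lp T p"
    by (auto simp: Lp_def intro: integrable_leb_continuous borel_measurable_leb_continuous c)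
  then show "y \<in> trajectories T p x"
    using y c velocity_imp_weak_deriv[OF v T] p by (auto simp: trajectories_def W1p_def)
qed

text \<open>The running cost as a function of position and full velocity vector. Every edge reads
  its own coordinate of the velocity, which takes the place of the derivative of the norm and makes
  the tangent term linear in the vector.\<close>

definition lagrangian ::
    "('n \<Rightarrow> real \<Rightarrow> real \<Rightarrow> real \<Rightarrow> real) \<Rightarrow> (real \<Rightarrow> real) \<Rightarrow> real ^ 'n::finite \<Rightarrow> real ^ 'n \<Rightarrow> real \<Rightarrow> real" where
  "lagrangian l ls q w s =
     (\<Sum>i\<in>UNIV. if 0 < q $ i then l i (q $ i) (w $ i) s else 0) + (if q = 0 then vertex_cost l ls s else 0)"

lemma lagrangian_vertex: "lagrangian l ls 0 w s = vertex_cost l ls s"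
  by (simp add: lagrangian_def)

lemma lagrangian_edge:
  assumes "q \<in> edge i" "0 < q $ i"
  shows "lagrangian l ls q w s = l i (q $ i) (w $ i) s"
proof -
  have "(\<Sum>j\<in>UNIV. if 0 < q $ j then l j (q $ j) (w $ j) s else 0)
      = (\<Sum>j\<in>UNIV. if j = i then l i (q $ i) (w $ i) s else 0)"
    using assms by (intro sum.cong) (auto simp: edge_iff)
  then show ?thesis using assms by (auto simp: lagrangian_def)
qed

lemma indicator_edge_sum:
  fixes f :: "'n::finite \<Rightarrow> real"
  assumes "z \<in> edge i" "z \<noteq> 0"
  shows "(\<Sum>j\<in>UNIV. f j * indicator (edge j - {0}) z) = f i"
proof -
  have "0 < z $ i" using zero_less_norm_iff[of z] assms(2) unfolding norm_edge[OF assms(1)] by blast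
  then have "z \<in> edge j \<longleftrightarrow> j = i" for j
    using assms(1) by (cases "j = i") (auto simp: edge_iff)
  then have "(\<Sum>j\<in>UNIV. f j * indicator (edge j - {0}) z) = (\<Sum>j\<in>UNIV. if j = i then f i else 0)"
    using assms by (intro sum.cong) (auto simp: indicator_def)
  then show ?thesis by simp
qed

text \<open>Coordinates are nonnegative on the junction, so every zero of a coordinate is a minimum
  of it. This covers the edges that \<open>y\<close> is not on as well as the vertex.\<close>

lemma AE_velocity_eq_0:
  fixes y v :: "real \<Rightarrow> real ^ 'n::finite"
  assumes T: "0 < T" and p: "1 < p" and v: "velocity T p y v" and y: "y ` {0..T} \<subseteq> junction"
  shows "AE t in leb T. \<forall>j. y t $ j = 0 \<longrightarrow> v t $ j = 0"
proof (subst AE_all_countable, rule allI)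
  fix j
  have "velocity T p (\<lambda>t. y t $ j) (\<lambda>t. v t $ j)"
    by (rule velocity_bounded_linear[OF bounded_linear_vec_nth v]) (use p in simp)
  then show "AE t in leb T. y t $ j = 0 \<longrightarrow> v t $ j = 0"
    by (rule velocity_eq_0_on_zeros[OF T p]) (use y in \<open>auto intro!: junction_nonneg\<close>)
qed

lemma velocity_cong:
  assumes "velocity T p y v" "\<And>t. t \<in> {0..T} \<Longrightarrow> z t = y t" "0 \<le> T"
  shows "velocity T p z v"
  using assms by (auto simp: velocity_def)

lemma velocity_norm:
  fixes y v :: "real \<Rightarrow> real ^ 'n::finite"
  assumes T: "0 < T" and p: "1 < p" and v: "velocity T p y v" and y: "y ` {0..T} \<subseteq> junction"
  shows "velocity T p (\<lambda>t. norm (y t)) (\<lambda>t. \<Sum>j\<in>UNIV. v t $ j)"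
proof -
  have "velocity T p (\<lambda>t. \<Sum>j\<in>UNIV. y t $ j) (\<lambda>t. \<Sum>j\<in>UNIV. v t $ j)"
    using p by (intro velocity_bounded_linear[OF _ v] bounded_linear_sum bounded_linear_vec_nth) auto
  then show ?thesis
    by (rule velocity_cong) (use y T in \<open>auto intro!: norm_junction\<close>)
qed

text \<open>The choice made by \<open>SOME\<close> is legitimate because
  \<open>velocity_norm\<close> exhibits a weak derivative; continuity of the norm along
  \<open>y\<close> then upgrades the chosen one to a velocity.\<close>

lemma velocity_weak_deriv_norm:
  fixes y v :: "real \<Rightarrow> real ^ 'n::finite"
  assumes T: "0 < T" and p: "1 < p" and v: "velocity T p y v" and y: "y ` {0..T} \<subseteq> junction"
  shows "velocity T p (\<lambda>t. norm (y t)) (weak_deriv T p (\<lambda>s. norm (y s)))"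
proof -
  note vn = velocity_norm[OF assms]
  have "is_weak_deriv T p (\<lambda>s. norm (y s)) (weak_deriv T p (\<lambda>s. norm (y s)))"
    unfolding weak_deriv_def
    by (rule someI[of "is_weak_deriv T p (\<lambda>s. norm (y s))", OF velocity_imp_weak_deriv[OF vn T]]) (use p in simp)
  then show ?thesis
    using T p velocity_continuous[OF vn] by (intro weak_deriv_imp_velocity) auto
qed

text \<open>Velocities are unique almost everywhere, so the chosen derivative of the norm is the sum
  of the coordinates of \<open>v\<close>; on edge \<open>i\<close> all of these but the one of index
  \<open>i\<close> vanish.\<close>

lemma AE_running_cost:
  fixes y v :: "real \<Rightarrow> real ^ 'n::finite"
  assumes T: "0 < T" and p: "1 < p" and v: "velocity T p y v" and y: "y ` {0..T} \<subseteq> junction"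
  shows "AE t in leb T. running_cost T p l ls y t = lagrangian l ls (y t) (v t) t"
proof -
  have "AE t in leb T. t \<in> {0<..<T}" by (rule AE_I2) simp
  with velocity_unique[OF T p velocity_weak_deriv_norm[OF assms] velocity_norm[OF assms]] AE_velocity_eq_0[OF assms] show ?thesis
  proof eventually_elim
    case (elim t)
    then have "y t \<in> junction" using y by auto
    then show ?case
    proof (cases rule: junction_cases)
      case vertex
      then show ?thesis by (simp add: running_cost_def lagrangian_vertex)
    next
      case (edge i)
      have "(\<Sum>j\<in>UNIV. v t $ j) = (\<Sum>j\<in>UNIV. if j = i then v t $ i else 0)"
        using elim edge by (intro sum.cong) auto
      then show ?thesis
        using elim edge indicator_edge_sum[OF edge(1) edge(5)]
        by (simp add: running_cost_def lagrangian_edge[OF edge(1,2)])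
    qed
  qed
qed

section \<open>The running cost\<close>

lemma norm_component_edge:
  assumes "q \<in> junction" "0 < q $ i" "\<And>j. q $ j = 0 \<Longrightarrow> w $ j = 0"
  shows "norm w = \<bar>w $ i\<bar>"
proof -
  have "q $ j = 0" if "j \<noteq> i" for j
    using assms(1)
  proof (cases rule: junction_cases)
    case (edge k)
    then have "i = k" using assms(2) by fastforce
    then show ?thesis using edge(3) that by simp
  qed (use assms(2) in simp)
  then have "w = (w $ i) *\<^sub>R axis i 1"
    using assms(3) by (auto simp: vec_eq_iff axis_def)
  then have "norm w = norm ((w $ i) *\<^sub>R (axis i 1 :: real ^ 'a))" by (rule arg_cong)
  then show ?thesis by (simp add: norm_axis_1)
qed

lemma partial_a_has_derivative:
  assumes "(\<lambda>(z, b). f z b s) differentiable (at (y, a) within {0..} \<times> UNIV)" "0 \<le> y"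
  shows "((\<lambda>b. f y b s) has_real_derivative partial_a f y a s) (at a)"
proof -
  obtain f' where f': "((\<lambda>(z, b). f z b s) has_derivative f') (at (y, a) within {0..} \<times> UNIV)"
    using assms(1) by (auto simp: differentiable_def)
  have "((\<lambda>b. (y, b)) has_derivative (\<lambda>h. (0, h))) (at a within UNIV)"
    by (auto intro!: derivative_eq_intros)
  then have "((\<lambda>b. (\<lambda>(z, b). f z b s) (y, b)) has_derivative (\<lambda>h. f' (0, h))) (at a within UNIV)"
    by (rule has_derivative_in_compose) (rule has_derivative_subset[OF f'], use assms(2) in auto)
  then have "(\<lambda>b. f y b s) differentiable (at a)"
    by (auto simp: differentiable_def)
  then show ?thesis
    by (simp add: partial_a_def DERIV_deriv_iff_real_differentiable)
qed

lemma partial_y_has_derivative: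
  assumes "(\<lambda>(z, b). f z b s) differentiable (at (y, a) within {0..} \<times> UNIV)"
  shows "((\<lambda>z. f z a s) has_real_derivative partial_y f y a s) (at y within {0..})"
proof -
  obtain f' where f': "((\<lambda>(z, b). f z b s) has_derivative f') (at (y, a) within {0..} \<times> UNIV)"
    using assms(1) by (auto simp: differentiable_def)
  have "((\<lambda>z. (z, a)) has_derivative (\<lambda>h. (h, 0))) (at y within {0..})"
    by (auto intro!: derivative_eq_intros)
  then have "((\<lambda>z. (\<lambda>(z, b). f z b s) (z, a)) has_derivative (\<lambda>h. f' (h, 0))) (at y within {0..})"
    by (rule has_derivative_in_compose) (rule has_derivative_subset[OF f'], auto)
  then have "(\<lambda>z. f z a s) differentiable (at y within {0..})"
    by (auto simp: differentiable_def)
  then show ?thesis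
    by (simp add: partial_y_def has_real_derivative_iff_has_vector_derivative vector_derivative_works)
qed

lemma strictly_convex_imp_convex_on:
  assumes "strictly_convex f"
  shows "convex_on UNIV f"
proof (rule convex_onI)
  fix t x y :: real assume t: "0 < t" "t < 1"
  show "f ((1 - t) *\<^sub>R x + t *\<^sub>R y) \<le> (1 - t) * f x + t * f y"
  proof (cases "x = y")
    case True
    then show ?thesis by (simp add: algebra_simps)
  next
    case False
    then have "f ((1 - t) * x + t * y) < (1 - t) * f x + t * f y"
      using assms t unfolding strictly_convex_def by blast
    then show ?thesis by simp
  qed
qed simp

lemma Min_range_le: "(MIN i. f i) \<le> f i" for f :: "'n::finite \<Rightarrow> real"
  by (rule Min_le) auto

lemma le_Min_range: "(\<And>i. c \<le> f i) \<Longrightarrow> c \<le> (MIN i. f i)" for f :: "'n::finite \<Rightarrow> real"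
  by (rule Min.boundedI) auto

text \<open>The data are continuous only on the closed domain of nonnegative positions and times in
  \<open>{0..T}\<close>, so the composition is factored through the Borel space restricted to
  it.\<close>

lemma borel_measurable_leb_compose:
  fixes f :: "real \<Rightarrow> real \<Rightarrow> real \<Rightarrow> real"
  assumes f: "continuous_on ({0..} \<times> UNIV \<times> {0..T}) (\<lambda>(y, a, s). f y a s)"
    and a: "a \<in> borel_measurable (leb T)" and b: "b \<in> borel_measurable (leb T)"
    and nn: "\<And>t. t \<in> {0<..<T} \<Longrightarrow> 0 \<le> a t"
  shows "(\<lambda>t. f (a t) (b t) t) \<in> borel_measurable (leb T)"
proof -
  have "(\<lambda>t. t) \<in> borel_measurable (leb T)" by (intro borel_measurable_leb_continuous continuous_intros)
  then have "(\<lambda>t. (a t, b t, t)) \<in> leb T \<rightarrow>\<^sub>M restrict_space borel ({0..} \<times> UNIV \<times> {0..T})"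
    using a b nn by (intro measurable_restrict_space2) auto
  from measurable_compose[OF this borel_measurable_continuous_on_restrict[OF f]] show ?thesis by simp
qed

context standing_assumptions
begin

text \<open>The constant of \<open>H1\<close> depends on the edge. The smallest one serves as
  coefficient of the power, the sum of all as offset.\<close>

lemma lower_bounds:
  obtains c C where "0 < c" "0 \<le> C"
    "\<And>i y a s. 0 \<le> y \<Longrightarrow> s \<in> {0..T} \<Longrightarrow> c * \<bar>a\<bar> powr p - C \<le> l i y a s"
    "\<And>s. s \<in> {0..T} \<Longrightarrow> - C \<le> ls s"
proof -
  obtain C0 where C0: "\<And>i. 0 < C0 i"
    "\<And>i y a s. 0 \<le> y \<Longrightarrow> s \<in> {0..T} \<Longrightarrow> C0 i * (\<bar>a\<bar> powr p - 1) \<le> l i y a s"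
    "\<And>i s. s \<in> {0..T} \<Longrightarrow> - C0 i \<le> ls s"
    using H1 by metis
  define c where "c = (MIN i. C0 i)"
  define C where "C = (\<Sum>i\<in>UNIV. C0 i)"
  have c: "0 < c" unfolding c_def using C0(1) by (subst Min_gr_iff) auto
  have C: "C0 i \<le> C" for i
    unfolding C_def using C0(1) by (intro member_le_sum) (auto intro: less_imp_le)
  show ?thesis
  proof (rule that[OF c])
    show "0 \<le> C" unfolding C_def using C0(1) by (intro sum_nonneg) (auto intro: less_imp_le)
    \<comment> \<open>The bound on \<open>ls\<close> comes once per edge; any edge will do, hence
      \<open>undefined\<close>.\<close>
    show "- C \<le> ls s" if "s \<in> {0..T}" for s using C0(3)[OF that, of undefined] C[of undefined] by linarith
    show "c * \<bar>a\<bar> powr p - C \<le> l i y a s" if "0 \<le> y" "s \<in> {0..T}" for i y a s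
    proof -
      have "c * \<bar>a\<bar> powr p \<le> C0 i * \<bar>a\<bar> powr p"
        unfolding c_def by (intro mult_right_mono Min_range_le) auto
      then show ?thesis using C0(2)[OF that, of i a] C[of i] by (simp add: algebra_simps)
    qed
  qed
qed

lemma partial_bounds:
  assumes "0 < r"
  obtains c where "0 \<le> c"
    "\<And>i y a s. y \<in> {0..r} \<Longrightarrow> s \<in> {0..T} \<Longrightarrow> \<bar>partial_y (l i) y a s\<bar> \<le> c * (\<bar>a\<bar> powr p + 1)"
    "\<And>i y a s. y \<in> {0..r} \<Longrightarrow> s \<in> {0..T} \<Longrightarrow> \<bar>partial_a (l i) y a s\<bar> \<le> c * (\<bar>a\<bar> powr (p - 1) + 1)"
proof -
  obtain k where k: "\<And>i. 0 \<le> k i"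
    "\<And>i y a s. y \<in> {0..r} \<Longrightarrow> s \<in> {0..T} \<Longrightarrow> \<bar>partial_y (l i) y a s\<bar> \<le> k i * (\<bar>a\<bar> powr p + 1)"
    "\<And>i y a s. y \<in> {0..r} \<Longrightarrow> s \<in> {0..T} \<Longrightarrow> \<bar>partial_a (l i) y a s\<bar> \<le> k i * (\<bar>a\<bar> powr (p - 1) + 1)"
    using H3[OF assms] by metis
  define c where "c = (\<Sum>i\<in>UNIV. k i)"
  have c: "k i \<le> c" for i unfolding c_def using k(1) by (intro member_le_sum) auto
  have *: "k i * (u + 1) \<le> c * (u + 1)" if "0 \<le> u" for i and u :: real
    using c[of i] that by (intro mult_right_mono) auto
  show ?thesis
  proof (rule that)
    show "0 \<le> c" unfolding c_def using k(1) by (intro sum_nonneg) auto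
    fix i y a s assume "y \<in> {0..r}" "s \<in> {0..T}"
    then show "\<bar>partial_y (l i) y a s\<bar> \<le> c * (\<bar>a\<bar> powr p + 1)"
      "\<bar>partial_a (l i) y a s\<bar> \<le> c * (\<bar>a\<bar> powr (p - 1) + 1)"
      using order_trans[OF k(2) *] order_trans[OF k(3) *] by auto
  qed
qed

lemma lipschitz_y:
  assumes "0 < r"
  obtains c where "0 \<le> c"
    "\<And>i y z a s. y \<in> {0..r} \<Longrightarrow> z \<in> {0..r} \<Longrightarrow> s \<in> {0..T} \<Longrightarrow>
       \<bar>l i y a s - l i z a s\<bar> \<le> c * (\<bar>a\<bar> powr p + 1) * \<bar>y - z\<bar>"
proof -
  obtain c where c: "0 \<le> c"
    "\<And>i y a s. y \<in> {0..r} \<Longrightarrow> s \<in> {0..T} \<Longrightarrow> \<bar>partial_y (l i) y a s\<bar> \<le> c * (\<bar>a\<bar> powr p + 1)"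
    using partial_bounds[OF assms] by metis
  have "\<bar>l i y a s - l i z a s\<bar> \<le> c * (\<bar>a\<bar> powr p + 1) * \<bar>y - z\<bar>"
    if yz: "y \<in> {0..r}" "z \<in> {0..r}" and s: "s \<in> {0..T}" for i y z a s
  proof -
    have "norm (l i y a s - l i z a s) \<le> c * (\<bar>a\<bar> powr p + 1) * norm (y - z)"
    proof (rule field_differentiable_bound[of "{0..r}"])
      fix x assume x: "x \<in> {0..r}"
      have "((\<lambda>z. l i z a s) has_real_derivative partial_y (l i) x a s) (at x within {0..})"
        using x s by (intro partial_y_has_derivative l_differentiable) auto
      then show "((\<lambda>z. l i z a s) has_real_derivative partial_y (l i) x a s) (at x within {0..r})"
        by (rule DERIV_subset) auto
      show "norm (partial_y (l i) x a s) \<le> c * (\<bar>a\<bar> powr p + 1)"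
        using c(2)[OF x s] by simp
    qed (use yz in auto)
    then show ?thesis by simp
  qed
  with c(1) that show ?thesis by blast
qed

text \<open>The upper bound is obtained by integrating the bound on \<open>partial_a\<close> from
  velocity 0, where compactness bounds the cost. The increment is at most
  \<open>c * (m powr p + m)\<close>, hence at most \<open>c * (2 * m powr p + 1)\<close>, which
  explains the summand \<open>2 * c\<close> of \<open>C\<close>.\<close>

lemma growth:
  assumes r: "0 < r" and p: "1 < p"
  obtains C where "0 \<le> C"
    "\<And>i y a s. y \<in> {0..r} \<Longrightarrow> s \<in> {0..T} \<Longrightarrow> \<bar>l i y a s\<bar> \<le> C * (1 + \<bar>a\<bar> powr p)"
    "\<And>s. s \<in> {0..T} \<Longrightarrow> \<bar>ls s\<bar> \<le> C"
proof -
  obtain c where c: "0 \<le> c"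
    "\<And>i y a s. y \<in> {0..r} \<Longrightarrow> s \<in> {0..T} \<Longrightarrow> \<bar>partial_a (l i) y a s\<bar> \<le> c * (\<bar>a\<bar> powr (p - 1) + 1)"
    using partial_bounds[OF r] by metis
  have "\<exists>B. \<forall>y\<in>{0..r}. \<forall>s\<in>{0..T}. \<bar>l i y 0 s\<bar> \<le> B" for i
  proof -
    have "continuous_on ({0..r} \<times> {0..T}) (\<lambda>(y, s). (y, 0::real, s))"
      by (auto simp: case_prod_unfold intro!: continuous_intros)
    moreover have "(\<lambda>(y, s). (y, 0::real, s)) ` ({0..r} \<times> {0..T}) \<subseteq> {0..} \<times> UNIV \<times> {0..T}" by auto
    ultimately have "continuous_on ({0..r} \<times> {0..T}) ((\<lambda>(y, a, s). l i y a s) \<circ> (\<lambda>(y, s). (y, 0::real, s)))"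
      by (intro continuous_on_compose continuous_on_subset[OF l_continuous])
    then have "bounded (((\<lambda>(y, a, s). l i y a s) \<circ> (\<lambda>(y, s). (y, 0::real, s))) ` ({0..r} \<times> {0..T}))"
      by (intro compact_imp_bounded compact_continuous_image compact_Times) auto
    then show ?thesis unfolding bounded_iff by auto
  qed
  then obtain B where B: "\<And>i y s. y \<in> {0..r} \<Longrightarrow> s \<in> {0..T} \<Longrightarrow> \<bar>l i y 0 s\<bar> \<le> B i" by metis
  obtain B' where B': "\<And>s. s \<in> {0..T} \<Longrightarrow> \<bar>ls s\<bar> \<le> B'"
    using compact_imp_bounded[OF compact_continuous_image[OF ls_continuous compact_Icc]]
    unfolding bounded_iff by (metis imageI real_norm_def)
  define C where "C = (\<Sum>i\<in>UNIV. \<bar>B i\<bar>) + \<bar>B'\<bar> + 2 * c"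
  have S: "\<bar>B i\<bar> \<le> (\<Sum>i\<in>UNIV. \<bar>B i\<bar>)" for i by (rule member_le_sum) auto
  have S0: "0 \<le> (\<Sum>i\<in>UNIV. \<bar>B i\<bar>)" by (intro sum_nonneg) auto
  have C0: "0 \<le> C" using S0 c by (simp add: C_def)
  have "\<bar>l i y a s\<bar> \<le> C * (1 + \<bar>a\<bar> powr p)" if y: "y \<in> {0..r}" and s: "s \<in> {0..T}" for i y a s
  proof -
    define m where "m = \<bar>a\<bar>"
    have "norm (l i y a s - l i y 0 s) \<le> c * (m powr (p - 1) + 1) * norm (a - 0)"
    proof (rule field_differentiable_bound[of "{- m..m}"])
      fix x assume x: "x \<in> {- m..m}"
      have "((\<lambda>b. l i y b s) has_real_derivative partial_a (l i) y x s) (at x)"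
        using y s by (intro partial_a_has_derivative l_differentiable) auto
      then show "((\<lambda>b. l i y b s) has_real_derivative partial_a (l i) y x s) (at x within {- m..m})"
        by (rule has_field_derivative_at_within)
      have "\<bar>x\<bar> powr (p - 1) \<le> m powr (p - 1)" using x p by (intro powr_mono2) auto
      then show "norm (partial_a (l i) y x s) \<le> c * (m powr (p - 1) + 1)"
        using c(2)[OF y s, of i x] mult_left_mono[of "\<bar>x\<bar> powr (p - 1) + 1" "m powr (p - 1) + 1" c] c(1) by simp
    qed (auto simp: m_def)
    also have "\<dots> = c * (m powr p + m)"
      by (cases "m = 0") (auto simp: m_def powr_diff field_simps)
    also have "\<dots> \<le> c * (2 * m powr p + 1)"
      using le_add_powr[of m 1 p] p c(1) by (intro mult_left_mono) (auto simp: m_def)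
    finally have "\<bar>l i y a s - l i y 0 s\<bar> \<le> c * (2 * m powr p + 1)" by simp
    then have "\<bar>l i y a s\<bar> \<le> \<bar>B i\<bar> + c * (2 * m powr p + 1)" using B[OF y s, of i] by linarith
    also have "\<dots> \<le> C * (1 + m powr p)"
    proof -
      have "\<bar>B i\<bar> \<le> C - 2 * c" using S[of i] by (simp add: C_def)
      moreover have "0 \<le> (C - 2 * c) * m powr p" using S0 by (simp add: C_def)
      ultimately show ?thesis using c(1) by (simp add: algebra_simps)
    qed
    finally show ?thesis by (simp add: m_def)
  qed
  moreover have "\<bar>ls s\<bar> \<le> C" if "s \<in> {0..T}" for s
    using B'[OF that] S0 c(1) unfolding C_def by linarith
  ultimately show ?thesis using C0 that by blast
qed

lemma tangent_line:
  assumes "0 \<le> y" "s \<in> {0..T}"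
  shows "l i y a s + partial_a (l i) y a s * (b - a) \<le> l i y b s"
proof -
  have "((\<lambda>b. l i y b s) has_real_derivative partial_a (l i) y a s) (at a)"
    using assms by (intro partial_a_has_derivative l_differentiable)
  then have "partial_a (l i) y a s * (b - a) \<le> l i y b s - l i y a s"
    using strictly_convex_imp_convex_on[OF H4[OF assms, of i]]
    by (intro convex_on_imp_above_tangent[of UNIV "\<lambda>b. l i y b s"]) auto
  then show ?thesis by simp
qed

text \<open>The vertex cost does not see the velocity, so it can dominate a power of
  \<open>norm w\<close> only for \<open>w = 0\<close>. The condition that \<open>w\<close> vanish
  with \<open>q\<close> provides this; along trajectories it holds almost everywhere by
  \<open>AE_velocity_eq_0\<close>.\<close>

lemma lagrangian_ge:
  assumes p: "0 < p"
  obtains c C where "0 < c" "0 \<le> C"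
    "\<And>q w s. q \<in> junction \<Longrightarrow> (\<And>j. q $ j = 0 \<Longrightarrow> w $ j = 0) \<Longrightarrow> s \<in> {0..T} \<Longrightarrow>
      c * norm w powr p - C \<le> lagrangian l ls q w s"
proof -
  obtain c C where c: "0 < c" "0 \<le> C"
    "\<And>i y a s. 0 \<le> y \<Longrightarrow> s \<in> {0..T} \<Longrightarrow> c * \<bar>a\<bar> powr p - C \<le> l i y a s"
    "\<And>s. s \<in> {0..T} \<Longrightarrow> - C \<le> ls s"
    using lower_bounds by metis
  have "c * norm w powr p - C \<le> lagrangian l ls q w s"
    if q: "q \<in> junction" and w: "\<And>j. q $ j = 0 \<Longrightarrow> w $ j = 0" and s: "s \<in> {0..T}" for q w s
    using q
  proof (cases rule: junction_cases)
    case vertex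
    then have "w = 0" using w by (simp add: vec_eq_iff)
    have "- C \<le> l i 0 0 s" for i using c(3)[of 0 s 0 i] s by simp
    then have "- C \<le> vertex_cost l ls s"
      unfolding vertex_cost_def using c(4)[OF s] by (intro min.boundedI le_Min_range) auto
    then show ?thesis using vertex \<open>w = 0\<close> by (simp add: lagrangian_vertex)
  next
    case (edge i)
    then show ?thesis
      using c(3)[of "q $ i" s "w $ i" i] s norm_component_edge[OF q edge(2) w]
      by (simp add: lagrangian_edge)
  qed
  with c(1,2) that show ?thesis by blast
qed

lemma lagrangian_le:
  assumes r: "0 < r" and p: "1 < p"
  obtains C where "0 \<le> C"
    "\<And>q w s. q \<in> junction \<Longrightarrow> norm q \<le> r \<Longrightarrow> s \<in> {0..T} \<Longrightarrow>
      \<bar>lagrangian l ls q w s\<bar> \<le> C * (1 + norm w powr p)"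
proof -
  obtain C where C: "0 \<le> C"
    "\<And>i y a s. y \<in> {0..r} \<Longrightarrow> s \<in> {0..T} \<Longrightarrow> \<bar>l i y a s\<bar> \<le> C * (1 + \<bar>a\<bar> powr p)"
    "\<And>s. s \<in> {0..T} \<Longrightarrow> \<bar>ls s\<bar> \<le> C"
    using growth[OF r p] by metis
  have "\<bar>lagrangian l ls q w s\<bar> \<le> C * (1 + norm w powr p)"
    if q: "q \<in> junction" and qr: "norm q \<le> r" and s: "s \<in> {0..T}" for q w s
    using q
  proof (cases rule: junction_cases)
    case vertex
    have b: "\<bar>l i 0 0 s\<bar> \<le> C" for i using C(2)[of 0 s i 0] r s p by simp
    then have "- C \<le> (MIN i. l i 0 0 s)" by (intro le_Min_range) (smt (verit))
    moreover have "(MIN i. l i 0 0 s) \<le> C"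
      using Min_range_le[of "\<lambda>i. l i 0 0 s" undefined] b[of undefined] by linarith
    ultimately have "\<bar>vertex_cost l ls s\<bar> \<le> C"
      unfolding vertex_cost_def using abs_le_D1[OF C(3)[OF s]] abs_le_D2[OF C(3)[OF s]]
      by (intro abs_leI) linarith+
    also have "C \<le> C * (1 + norm w powr p)" using C(1) by (simp add: algebra_simps)
    finally show ?thesis using vertex by (simp add: lagrangian_vertex)
  next
    case (edge i)
    have "\<bar>w $ i\<bar> powr p \<le> norm w powr p"
      using p component_le_norm_cart[of w i] by (intro powr_mono2) auto
    then have "C * (1 + \<bar>w $ i\<bar> powr p) \<le> C * (1 + norm w powr p)"
      using C(1) by (intro mult_left_mono) auto
    then show ?thesis
      using C(2)[of "q $ i" s i "w $ i"] s qr edge by (simp add: lagrangian_edge)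
  qed
  with C(1) that show ?thesis by blast
qed

lemma vertex_cost_measurable: "(\<lambda>t. vertex_cost l ls t) \<in> borel_measurable (leb T)"
proof -
  have l0m: "(\<lambda>t. l i 0 0 t) \<in> borel_measurable (leb T)" for i
    by (rule borel_measurable_leb_compose[where a = "\<lambda>_. 0" and b = "\<lambda>_. 0", OF l_continuous]) auto
  have lsm: "ls \<in> borel_measurable (leb T)" by (rule borel_measurable_leb_continuous[OF ls_continuous])
  have "(\<lambda>t. Min (range (\<lambda>i. l i 0 0 t))) \<in> borel_measurable (leb T)"
    by (intro borel_measurable_Min l0m finite)
  then show ?thesis
    unfolding vertex_cost_def by (intro borel_measurable_min lsm)
qed

lemma lagrangian_measurable:
  fixes y v :: "real \<Rightarrow> real ^ 'n"
  assumes y: "continuous_on {0..T} y" "y ` {0..T} \<subseteq> junction" and v: "v \<in> borel_measurable (leb T)"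
  shows "(\<lambda>t. lagrangian l ls (y t) (v t) t) \<in> borel_measurable (leb T)"
proof -
  have ym: "y \<in> borel_measurable (leb T)" using y(1) by (rule borel_measurable_leb_continuous)
  have yc: "(\<lambda>t. y t $ i) \<in> borel_measurable (leb T)" for i
    using y(1) by (intro borel_measurable_leb_continuous continuous_intros)
  have vc: "(\<lambda>t. v t $ i) \<in> borel_measurable (leb T)" for i
    by (intro measurable_compose[OF v] borel_measurable_continuous_onI linear_continuous_on bounded_linear_vec_nth)
  have nn: "0 \<le> y t $ i" if "t \<in> {0<..<T}" for t i using y(2) that by (intro junction_nonneg) auto
  have lm: "(\<lambda>t. l i (y t $ i) (v t $ i) t) \<in> borel_measurable (leb T)" for i
    by (rule borel_measurable_leb_compose[OF l_continuous yc vc nn])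
  have "{t \<in> space (leb T). 0 < y t $ i} \<in> sets (leb T)" for i using yc[of i] by measurable
  moreover have "{t \<in> space (leb T). y t = 0} \<in> sets (leb T)" using ym by measurable
  ultimately show ?thesis
    unfolding lagrangian_def
    by (intro borel_measurable_add borel_measurable_sum measurable_If lm vertex_cost_measurable borel_measurable_const)
qed

lemma lagrangian_integrable:
  fixes y v :: "real \<Rightarrow> real ^ 'n"
  assumes p: "1 < p" and v: "velocity T p y v" and y: "y ` {0..T} \<subseteq> junction"
  shows "integrable (leb T) (\<lambda>t. lagrangian l ls (y t) (v t) t)"
proof -
  interpret finite_measure "leb T" by (rule finite_measure_leb)
  have vLp: "v \<in> Lp T p" using v by (simp add: velocity_def)
  have c: "continuous_on {0..T} y" using v by (rule velocity_continuous)
  obtain r where r: "0 < r" "\<And>t. t \<in> {0..T} \<Longrightarrow> norm (y t) \<le> r"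
    using compact_imp_bounded[OF compact_continuous_image[OF c compact_Icc]]
    unfolding bounded_pos by blast
  obtain C where C: "0 \<le> C" "\<And>q w s. q \<in> junction \<Longrightarrow> norm q \<le> r \<Longrightarrow> s \<in> {0..T} \<Longrightarrow>
      \<bar>lagrangian l ls q w s\<bar> \<le> C * (1 + norm w powr p)"
    using lagrangian_le[OF r(1) p] by metis
  show ?thesis
  proof (rule Bochner_Integration.integrable_bound)
    show "integrable (leb T) (\<lambda>t. C * (1 + norm (v t) powr p))"
      using vLp by (simp add: Lp_def)
    show "(\<lambda>t. lagrangian l ls (y t) (v t) t) \<in> borel_measurable (leb T)"
      using vLp by (intro lagrangian_measurable c y) (simp add: Lp_def)
    show "AE t in leb T. norm (lagrangian l ls (y t) (v t) t) \<le> norm (C * (1 + norm (v t) powr p))"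
    proof (intro AE_I2)
      fix t assume "t \<in> space (leb T)"
      then have "\<bar>lagrangian l ls (y t) (v t) t\<bar> \<le> C * (1 + norm (v t) powr p)"
        using r(2) y by (intro C(2)) auto
      then show "norm (lagrangian l ls (y t) (v t) t) \<le> norm (C * (1 + norm (v t) powr p))"
        unfolding real_norm_def by (rule order_trans[OF _ abs_ge_self])
    qed
  qed
qed

text \<open>Removes the derivative chosen by \<open>SOME\<close> from all later estimates. Replacing
  an integrand almost everywhere requires both integrands to be measurable, also the one with the
  chosen derivative.\<close>

lemma cost_eq:
  fixes y v :: "real \<Rightarrow> real ^ 'n"
  assumes T: "0 < T" and p: "1 < p" and v: "velocity T p y v" and y: "y ` {0..T} \<subseteq> junction"
  shows "cost T p l ls g gs y = (\<integral>t. lagrangian l ls (y t) (v t) t \<partial>leb T) + terminal_cost g gs (y T)"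
proof -
  have yc: "continuous_on {0..T} y" using v by (rule velocity_continuous)
  have ym: "y \<in> borel_measurable (leb T)" using yc by (rule borel_measurable_leb_continuous)
  have nm: "(\<lambda>t. norm (y t)) \<in> borel_measurable (leb T)" using ym by measurable
  have wm: "weak_deriv T p (\<lambda>s. norm (y s)) \<in> borel_measurable (leb T)"
    using velocity_weak_deriv_norm[OF assms] by (simp add: velocity_def Lp_def)
  have lm: "(\<lambda>t. l i (norm (y t)) (weak_deriv T p (\<lambda>s. norm (y s)) t) t) \<in> borel_measurable (leb T)" for i
    by (rule borel_measurable_leb_compose[OF l_continuous nm wm]) simp
  have em: "(\<lambda>t. indicator (edge i - {0}) (y t) :: real) \<in> borel_measurable (leb T)" for i
    using closed_edge[of i] by (intro measurable_compose[OF ym] borel_measurable_indicator) auto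
  have zm: "(\<lambda>t. indicator {0} (y t) :: real) \<in> borel_measurable (leb T)"
    by (intro measurable_compose[OF ym] borel_measurable_indicator) auto
  have "running_cost T p l ls y \<in> borel_measurable (leb T)"
    unfolding running_cost_def[abs_def]
    by (intro borel_measurable_add borel_measurable_sum borel_measurable_times lm em zm vertex_cost_measurable)
  moreover have "v \<in> borel_measurable (leb T)" using v by (simp add: velocity_def Lp_def)
  ultimately have "(\<integral>t. running_cost T p l ls y t \<partial>leb T) = (\<integral>t. lagrangian l ls (y t) (v t) t \<partial>leb T)"
    by (intro integral_cong_AE AE_running_cost[OF assms] lagrangian_measurable yc y)
  then show ?thesis by (simp add: cost_def)
qed

text \<open>Here \<open>q\<close> is the limit position and \<open>q'\<close> the approximating one.
  The sign condition excludes that they sit on different edges: either \<open>q' = 0\<close>, which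
  forces \<open>q = 0\<close>, or \<open>q'\<close> is on some edge \<open>i\<close> and
  \<open>q\<close> is on it too or at the vertex. In the latter case the position is moved from
  \<open>q'\<close> to \<open>q\<close> by the Lipschitz bound, then the tangent at
  \<open>w $ i\<close> is used. Summing the slopes over all edges makes the bound independent of the
  unknown \<open>i\<close>; all summands but one vanish.\<close>

lemma lagrangian_lower_semicontinuous:
  assumes r: "0 < r"
  obtains c where "0 \<le> c"
    "\<And>q w q' w' s. q \<in> junction \<Longrightarrow> q' \<in> junction \<Longrightarrow> norm q \<le> r \<Longrightarrow> norm q' \<le> r \<Longrightarrow> s \<in> {0..T} \<Longrightarrow>
      (\<And>j. q $ j = 0 \<Longrightarrow> w $ j = 0) \<Longrightarrow> (\<And>j. q' $ j = 0 \<Longrightarrow> w' $ j = 0) \<Longrightarrow> (\<And>j. 0 < q $ j \<Longrightarrow> 0 < q' $ j) \<Longrightarrow>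
      lagrangian l ls q w s + (\<Sum>i\<in>UNIV. partial_a (l i) (q $ i) (w $ i) s * (w' $ i - w $ i))
        - c * (norm w' powr p + 1) * norm (q' - q) \<le> lagrangian l ls q' w' s"
proof -
  obtain c where c: "0 \<le> c"
    "\<And>i y z a s. y \<in> {0..r} \<Longrightarrow> z \<in> {0..r} \<Longrightarrow> s \<in> {0..T} \<Longrightarrow>
       \<bar>l i y a s - l i z a s\<bar> \<le> c * (\<bar>a\<bar> powr p + 1) * \<bar>y - z\<bar>"
    using lipschitz_y[OF r] by metis
  have "lagrangian l ls q w s + (\<Sum>i\<in>UNIV. partial_a (l i) (q $ i) (w $ i) s * (w' $ i - w $ i))
        - c * (norm w' powr p + 1) * norm (q' - q) \<le> lagrangian l ls q' w' s"
    if q: "q \<in> junction" and q': "q' \<in> junction" and qr: "norm q \<le> r" "norm q' \<le> r" and s: "s \<in> {0..T}"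
      and w: "\<And>j. q $ j = 0 \<Longrightarrow> w $ j = 0" and w': "\<And>j. q' $ j = 0 \<Longrightarrow> w' $ j = 0"
      and pos: "\<And>j. 0 < q $ j \<Longrightarrow> 0 < q' $ j" for q w q' w' s
    using q'
  proof (cases rule: junction_cases)
    case vertex
    then have "q $ j = 0" for j using pos[of j] junction_nonneg[OF q, of j] by fastforce
    then have "q = 0" "w = 0" using w by (simp_all add: vec_eq_iff)
    moreover have "w' = 0" using vertex w' by (simp add: vec_eq_iff)
    ultimately show ?thesis using vertex by simp
  next
    case (edge i)
    have qj: "q $ j = 0" if "j \<noteq> i" for j
      using pos[of j] junction_nonneg[OF q, of j] edge(3)[OF that] by fastforce
    then have qe: "q \<in> edge i" using junction_nonneg[OF q] by (simp add: edge_iff)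
    have qi: "norm q = q $ i" using norm_edge[OF qe] .
    have sum: "(\<Sum>i\<in>UNIV. partial_a (l i) (q $ i) (w $ i) s * (w' $ i - w $ i))
        = partial_a (l i) (q $ i) (w $ i) s * (w' $ i - w $ i)"
    proof -
      have "(\<Sum>j\<in>UNIV. partial_a (l j) (q $ j) (w $ j) s * (w' $ j - w $ j))
        = (\<Sum>j\<in>UNIV. if j = i then partial_a (l i) (q $ i) (w $ i) s * (w' $ i - w $ i) else 0)"
        using qj w w' edge(3) by (intro sum.cong) auto
      then show ?thesis by simp
    qed
    have nw': "norm w' = \<bar>w' $ i\<bar>" by (rule norm_component_edge[OF q' edge(2) w'])
    have "\<bar>q' $ i - q $ i\<bar> \<le> norm (q' - q)" using component_le_norm_cart[of "q' - q" i] by simp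
    then have "c * (norm w' powr p + 1) * \<bar>q' $ i - q $ i\<bar> \<le> c * (norm w' powr p + 1) * norm (q' - q)"
      using c(1) by (intro mult_left_mono) auto
    then have 1: "l i (q $ i) (w' $ i) s - c * (norm w' powr p + 1) * norm (q' - q) \<le> l i (q' $ i) (w' $ i) s"
      using c(2)[of "q' $ i" "q $ i" s i "w' $ i"] qr s edge qi junction_nonneg[OF q, of i] unfolding nw' by auto
    have 2: "l i (q $ i) (w $ i) s + partial_a (l i) (q $ i) (w $ i) s * (w' $ i - w $ i) \<le> l i (q $ i) (w' $ i) s"
      using s junction_nonneg[OF q] by (intro tangent_line)
    \<comment> \<open>The inequality may be strict only at the vertex, where it expresses that the
      vertex cost is a minimum over the edges at zero velocity.\<close>
    have 3: "lagrangian l ls q w s \<le> l i (q $ i) (w $ i) s"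
    proof (cases "q = 0")
      case True
      then have "w = 0" using w by (simp add: vec_eq_iff)
      moreover have "vertex_cost l ls s \<le> l i 0 0 s"
        unfolding vertex_cost_def by (rule min.coboundedI2[OF Min_range_le])
      ultimately show ?thesis using True by (simp add: lagrangian_vertex)
    next
      case False
      then have "0 < q $ i" using qi by (metis zero_less_norm_iff)
      then show ?thesis by (simp add: lagrangian_edge[OF qe])
    qed
    show ?thesis
      using 1 2 3 unfolding sum lagrangian_edge[OF edge(1,2)] by linarith
  qed
  with c(1) that show ?thesis by blast
qed

end

section \<open>Lower semicontinuity\<close>

lemma terminal_cost_vertex: "terminal_cost g gs 0 = min gs (MIN i. g i 0)"
  by (simp add: terminal_cost_def)

lemma terminal_cost_edge: "z \<in> edge i \<Longrightarrow> z \<noteq> 0 \<Longrightarrow> terminal_cost g gs z = g i (norm z)"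
  using indicator_edge_sum[of z i "\<lambda>i. g i (norm z)"] by (simp add: terminal_cost_def)

lemma terminal_cost_bounded_below:
  fixes g :: "'n::finite \<Rightarrow> real \<Rightarrow> real"
  assumes "\<And>i. bounded (g i ` {0..})"
  obtains G where "\<And>z. z \<in> junction \<Longrightarrow> - G \<le> terminal_cost g gs z"
proof -
  have "\<exists>b. \<forall>s\<ge>0. \<bar>g i s\<bar> \<le> b" for i
    using assms[of i] by (auto simp: bounded_iff)
  then obtain b where b: "\<And>i s. 0 \<le> s \<Longrightarrow> \<bar>g i s\<bar> \<le> b i" by metis
  define G where "G = (\<Sum>i\<in>UNIV. \<bar>b i\<bar>) + \<bar>gs\<bar>"
  have "\<bar>b i\<bar> \<le> (\<Sum>i\<in>UNIV. \<bar>b i\<bar>)" for i by (rule member_le_sum) auto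
  then have G: "- G \<le> g i s" if "0 \<le> s" for i s
    using b[OF that, of i] unfolding G_def by (smt (verit) abs_ge_zero)
  have "0 \<le> (\<Sum>i\<in>UNIV. \<bar>b i\<bar>)" by (intro sum_nonneg) auto
  then have Ggs: "- G \<le> gs" unfolding G_def by linarith
  have "- G \<le> terminal_cost g gs z" if "z \<in> junction" for z
    using that
  proof (cases rule: junction_cases)
    case vertex
    then show ?thesis
      unfolding vertex terminal_cost_vertex using Ggs G by (intro min.boundedI le_Min_range) auto
  next
    case (edge i)
    then show ?thesis using G by (simp add: terminal_cost_edge)
  qed
  then show ?thesis by (rule that)
qed

text \<open>At the vertex the minimum in the terminal cost allows an approach along any edge.
  Elsewhere \<open>zs n\<close> is eventually on the edge of \<open>z\<close>, where
  \<open>g i\<close> is continuous.\<close>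

lemma terminal_cost_lsc:
  fixes g :: "'n::finite \<Rightarrow> real \<Rightarrow> real"
  assumes g: "\<And>i. continuous_on {0..} (g i)" and z: "\<And>n. zs n \<in> junction" "z \<in> junction"
    and lim: "zs \<longlonglongrightarrow> z" and e: "0 < e"
  shows "\<forall>\<^sub>F n in sequentially. terminal_cost g gs z - e \<le> terminal_cost g gs (zs n)"
proof -
  have n: "(\<lambda>n. norm (zs n)) \<longlonglongrightarrow> norm z" by (intro tendsto_norm lim)
  have "(\<lambda>n. g i (norm (zs n))) \<longlonglongrightarrow> g i (norm z)" for i
    by (rule continuous_on_tendsto_compose[OF g n]) auto
  then have "\<forall>\<^sub>F n in sequentially. g i (norm z) - e < g i (norm (zs n))" for i
    using e by (intro order_tendstoD(1)) auto
  then have ev: "\<forall>\<^sub>F n in sequentially. \<forall>i. g i (norm z) - e < g i (norm (zs n))"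
    by (simp add: eventually_all_finite)
  show ?thesis
    using z(2)
  proof (cases rule: junction_cases)
    case vertex
    from ev show ?thesis
    proof eventually_elim
      case (elim n)
      from z(1)[of n] show ?case
      proof (cases rule: junction_cases)
        case (edge i)
        have "min gs (MIN i. g i 0) \<le> g i 0" by (rule min.coboundedI2[OF Min_range_le])
        then show ?thesis
          using elim[rule_format, of i] vertex edge by (simp add: terminal_cost_vertex terminal_cost_edge)
      qed (use vertex e in simp)
    qed
  next
    case (edge i)
    have "(\<lambda>n. zs n $ i) \<longlonglongrightarrow> z $ i" using lim by (rule tendsto_vec_nth)
    then have "\<forall>\<^sub>F n in sequentially. 0 < zs n $ i" using edge(2) by (rule order_tendstoD(1))
    with ev show ?thesis
    proof eventually_elim
      case (elim n)
      have "zs n \<in> edge i" "zs n \<noteq> 0"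
      proof -
        show "zs n \<noteq> 0" using elim(2) by auto
        from z(1)[of n] show "zs n \<in> edge i"
        proof (cases rule: junction_cases)
          case (edge k)
          then show ?thesis using elim(2) by (cases "i = k") auto
        qed simp
      qed
      then show ?case using elim(1)[rule_format, of i] edge by (simp add: terminal_cost_edge)
    qed
  qed
qed

section \<open>Joining trajectories and estimating their displacement\<close>

lemma velocity_has_integral:
  fixes y v :: "real \<Rightarrow> 'a::euclidean_space"
  assumes v: "velocity T p y v" and st: "0 \<le> s" "s \<le> t" "t \<le> T"
  shows "(v has_integral (y t - y s)) {s..t}"
proof -
  have t: "(v has_integral (y t - y 0)) {0..t}" and s: "(v has_integral (y s - y 0)) {0..s}"
    using v st by (auto simp: velocity_def)
  have "v integrable_on {s..t}"
    using has_integral_integrable[OF t] st by (auto intro: integrable_subinterval_real)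
  moreover have "integral {0..s} v + integral {s..t} v = integral {0..t} v"
    using st has_integral_integrable[OF t] by (intro Henstock_Kurzweil_Integration.integral_combine) auto
  ultimately show ?thesis
    using integral_unique[OF t] integral_unique[OF s] by (simp add: has_integral_iff algebra_simps)
qed

lemma velocity_line:
  fixes q w :: "'a::euclidean_space"
  shows "velocity T p (\<lambda>t. q + t *\<^sub>R w) (\<lambda>_. w)"
proof -
  interpret finite_measure "leb T" by (rule finite_measure_leb)
  have "((\<lambda>_. w) has_integral (t *\<^sub>R w)) {0..t}" if "0 \<le> t" for t :: real
    using has_integral_const_real[of w 0 t] that by simp
  then show ?thesis by (auto simp: velocity_def Lp_def)
qed

lemma velocity_concat:
  fixes u u' y v :: "real \<Rightarrow> 'a::euclidean_space"
  assumes u: "velocity T p u u'" and v: "velocity T p y v" and a: "0 \<le> a" "a \<le> T" and eq: "u a = y a"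
  shows "velocity T p (\<lambda>t. if t \<le> a then u t else y t) (\<lambda>t. if t \<le> a then u' t else v t)"
    (is "velocity T p ?y ?v")
  unfolding velocity_def
proof (intro conjI ballI)
  have [measurable]: "u' \<in> borel_measurable (leb T)" "v \<in> borel_measurable (leb T)"
    using u v by (auto simp: velocity_def Lp_def)
  have [measurable]: "(\<lambda>t. t) \<in> borel_measurable (leb T)"
    by (intro borel_measurable_leb_continuous continuous_intros)
  show "?v \<in> Lp T p"
  proof (rule Lp_dominated)
    show "?v \<in> borel_measurable (leb T)" by measurable
    show "integrable (leb T) (\<lambda>t. norm (u' t) powr p + norm (v t) powr p)"
      using u v by (auto simp: velocity_def Lp_def)
  qed (intro AE_I2, auto)
  fix t assume t: "t \<in> {0..T}"
  show "(?v has_integral (?y t - ?y 0)) {0..t}"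
  proof (cases "t \<le> a")
    case True
    have "(u' has_integral (u t - u 0)) {0..t}" using u t by (simp add: velocity_def)
    then show ?thesis using True t a by (subst has_integral_cong[where g = u']) auto
  next
    case False
    have "(u' has_integral (u a - u 0)) {0..a}" using u a by (simp add: velocity_def)
    then have 1: "(?v has_integral (u a - u 0)) {0..a}" by (subst has_integral_cong[where g = u']) auto
    have "(v has_integral (y t - y a)) {a..t}" using v a t False by (intro velocity_has_integral) auto
    then have 2: "(?v has_integral (y t - y a)) {a..t}"
      by (rule has_integral_spike_finite[of "{a}", rotated 2]) auto
    show ?thesis
      using has_integral_combine[OF _ _ 1 2] a t False eq by simp
  qed
qed

text \<open>A point closer to \<open>x\<close> than the vertex is keeps a positive coordinate along
  the edge of \<open>x\<close>. At the vertex every edge is shared.\<close>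

lemma same_edge:
  assumes "x \<in> junction" "w \<in> junction" "x = 0 \<or> norm (w - x) < norm x"
  obtains i where "x \<in> edge i" "w \<in> edge i"
  using assms(1)
proof (cases rule: junction_cases)
  case vertex
  then show ?thesis using assms(2) that by (auto simp: junction_iff)
next
  case (edge i)
  have "\<bar>w $ i - x $ i\<bar> < x $ i"
    using assms(3) edge component_le_norm_cart[of "w - x" i] by auto
  then have wi: "0 < w $ i" by linarith
  from assms(2) have "w \<in> edge i"
  proof (cases rule: junction_cases)
    case (edge k)
    then show ?thesis using wi by (cases "i = k") auto
  qed simp
  then show ?thesis using that edge by blast
qed

text \<open>A Jensen inequality up to constants: covering the displacement of \<open>y\<close> along
  a straight line in time \<open>d / 2\<close> needs speed \<open>2 / d * norm (y d - y 0)\<close>,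
  and the energy of doing so is controlled by the energy of \<open>y\<close> itself on
  \<open>{0..d}\<close>.\<close>

lemma displacement_powr_le:
  fixes y v :: "real \<Rightarrow> 'a::euclidean_space"
  assumes v: "velocity T p y v" and p: "1 \<le> p" and d: "0 < d" "d \<le> T"
  shows "d * (2 / d * norm (y d - y 0)) powr p \<le> 4 powr p * (integral {0..d} (\<lambda>t. norm (v t) powr p) + d)"
proof -
  define E where "E = integral {0..d} (\<lambda>t. norm (v t) powr p)"
  have "v \<in> Lp T p" using v by (simp add: velocity_def)
  then have "(\<lambda>t. norm (v t) powr p) absolutely_integrable_on {0..T}"
    by (simp add: Lp_def flip: integrable_leb_iff)
  then have ip: "(\<lambda>t. norm (v t) powr p) integrable_on {0..d}"
    using d by (intro integrable_subinterval_real[OF set_lebesgue_integral_eq_integral(1)]) auto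
  have E0: "0 \<le> E" unfolding E_def by (intro Henstock_Kurzweil_Integration.integral_nonneg ip) auto
  \<comment> \<open>Balances the two terms of \<open>le_add_powr\<close> after integration, as
    \<open>c powr p * d = E + d\<close>; the summand \<open>d\<close> keeps \<open>c\<close>
    positive when \<open>E = 0\<close>.\<close>
  define c where "c = ((E + d) / d) powr (1 / p)"
  have c: "0 < c" using E0 d by (simp add: c_def)
  have cp: "c powr p = (E + d) / d" using p E0 d by (simp add: c_def powr_powr)
  have vi: "(v has_integral (y d - y 0)) {0..d}" using v d by (simp add: velocity_def)
  have "norm (integral {0..d} v) \<le> integral {0..d} (\<lambda>t. c + c powr (1 - p) * norm (v t) powr p)"
    using le_add_powr[OF norm_ge_zero c p] ip vi
    by (intro integral_norm_bound_integral integrable_add integrable_on_mult_right) auto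
  also have "\<dots> = c * d + c powr (1 - p) * E"
    using ip d by (subst Henstock_Kurzweil_Integration.integral_add) (auto simp: E_def integrable_on_mult_right)
  also have "\<dots> \<le> c * d + c powr (1 - p) * (c powr p * d)"
    using d cp by (intro add_left_mono mult_left_mono) auto
  also have "c powr (1 - p) * (c powr p * d) = c * d"
    using c by (simp flip: powr_add mult.assoc)
  finally have "norm (y d - y 0) \<le> 2 * (c * d)" using integral_unique[OF vi] by simp
  then have "2 / d * norm (y d - y 0) \<le> 4 * c" using d by (simp add: field_simps)
  then have "(2 / d * norm (y d - y 0)) powr p \<le> (4 * c) powr p" using p d by (intro powr_mono2) auto
  also have "\<dots> = 4 powr p * ((E + d) / d)" using c by (simp add: powr_mult cp)
  finally have "d * (2 / d * norm (y d - y 0)) powr p \<le> d * (4 powr p * ((E + d) / d))"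
    using d by (intro mult_left_mono) auto
  also have "\<dots> = 4 powr p * (E + d)" using d by simp
  finally show ?thesis by (simp add: E_def)
qed

context standing_assumptions
begin

text \<open>Four errors of \<open>e / 4\<close> each: restricting the limit cost to the good set,
  the bound \<open>- C\<close> off that set, the slopes tested against \<open>vs n - v\<close>, and
  the Lipschitz error from the distance between \<open>ys n\<close> and \<open>y\<close>. The first
  two fix \<open>m\<close>; only then are the slopes bounded and the last two small for large
  \<open>n\<close>.\<close>

lemma lower_semicontinuous_running_cost:
  fixes ys vs :: "nat \<Rightarrow> real \<Rightarrow> real ^ 'n" and y v :: "real \<Rightarrow> real ^ 'n"
  assumes T: "0 < T" and p: "1 < p"
    and vs: "\<And>n. velocity T p (ys n) (vs n)" and ysj: "\<And>n. ys n ` {0..T} \<subseteq> junction"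
    and v: "velocity T p y v" and yj: "y ` {0..T} \<subseteq> junction"
    and K: "\<And>n. (\<integral>t. norm (vs n t) powr p \<partial>leb T) \<le> K"
    and lim: "uniform_limit {0..T} ys y sequentially" and e: "0 < e"
  shows "\<forall>\<^sub>F n in sequentially. (\<integral>t. lagrangian l ls (y t) (v t) t \<partial>leb T) - e
    \<le> (\<integral>t. lagrangian l ls (ys n t) (vs n t) t \<partial>leb T)"
proof -
  interpret finite_measure "leb T" by (rule finite_measure_leb)
  let ?lag = "\<lambda>t. lagrangian l ls (y t) (v t) t"
  have yc: "continuous_on {0..T} y" using v by (rule velocity_continuous)
  have ym[measurable]: "y \<in> borel_measurable (leb T)" using yc by (rule borel_measurable_leb_continuous)
  have vLp: "v \<in> Lp T p" using v by (simp add: velocity_def)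
  have vm[measurable]: "v \<in> borel_measurable (leb T)" using vLp by (simp add: Lp_def)
  have vsLp: "vs n \<in> Lp T p" for n using vs by (simp add: velocity_def)
  have vsp: "integrable (leb T) (\<lambda>t. norm (vs n t) powr p)" for n using vsLp[of n] by (simp add: Lp_def)
  have vp: "integrable (leb T) (\<lambda>t. norm (v t) powr p)" using vLp by (simp add: Lp_def)
  have K0: "0 \<le> K" using K[of 0] by (rule order_trans[rotated]) simp
  have ilag: "integrable (leb T) ?lag" by (rule lagrangian_integrable[OF p v yj])
  obtain R where R: "0 < R" "\<And>t. t \<in> {0..T} \<Longrightarrow> norm (y t) \<le> R"
    using compact_imp_bounded[OF compact_continuous_image[OF yc compact_Icc]]
    unfolding bounded_pos by blast
  define r where "r = R + 1"
  have r: "0 < r" using R by (simp add: r_def)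
  obtain c0 C where C: "0 < c0" "0 \<le> C"
    "\<And>q w s. q \<in> junction \<Longrightarrow> (\<And>j. q $ j = 0 \<Longrightarrow> w $ j = 0) \<Longrightarrow> s \<in> {0..T} \<Longrightarrow>
      c0 * norm w powr p - C \<le> lagrangian l ls q w s"
    using lagrangian_ge p by (metis less_trans zero_less_one)
  obtain c where c: "0 \<le> c"
    "\<And>q w q' w' s. q \<in> junction \<Longrightarrow> q' \<in> junction \<Longrightarrow> norm q \<le> r \<Longrightarrow> norm q' \<le> r \<Longrightarrow> s \<in> {0..T} \<Longrightarrow>
      (\<And>j. q $ j = 0 \<Longrightarrow> w $ j = 0) \<Longrightarrow> (\<And>j. q' $ j = 0 \<Longrightarrow> w' $ j = 0) \<Longrightarrow> (\<And>j. 0 < q $ j \<Longrightarrow> 0 < q' $ j) \<Longrightarrow>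
      lagrangian l ls q w s + (\<Sum>i\<in>UNIV. partial_a (l i) (q $ i) (w $ i) s * (w' $ i - w $ i))
        - c * (norm w' powr p + 1) * norm (q' - q) \<le> lagrangian l ls q' w' s"
    using lagrangian_lower_semicontinuous[OF r] by blast
  obtain k where k: "0 \<le> k"
    "\<And>i y a s. y \<in> {0..r} \<Longrightarrow> s \<in> {0..T} \<Longrightarrow> \<bar>partial_a (l i) y a s\<bar> \<le> k * (\<bar>a\<bar> powr (p - 1) + 1)"
    using partial_bounds[OF r] by metis
  \<comment> \<open>The first condition bounds the slopes. The second keeps \<open>ys n t\<close> on
    the edge of \<open>y t\<close> once it is closer than \<open>1 / (m + 1)\<close>; at
    \<open>y t = 0\<close> nothing of the kind is demanded.\<close>
  define good where "good m t \<longleftrightarrow> norm (v t) \<le> real m \<and> (y t = 0 \<or> 1 / real (Suc m) \<le> norm (y t))" for m t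
  define \<zeta> where "\<zeta> m t = (if good m t then (1::real) else 0)" for m t
  have \<zeta>m[measurable]: "\<zeta> m \<in> borel_measurable (leb T)" for m
    unfolding \<zeta>_def[abs_def] good_def by measurable
  have \<zeta>01: "0 \<le> \<zeta> m t" "\<zeta> m t \<le> 1" for m t by (auto simp: \<zeta>_def)
  have i\<zeta>: "integrable (leb T) (\<zeta> m)" for m
    using \<zeta>01 by (intro integrable_const_bound[where B = 1] AE_I2 \<zeta>m) auto
  have \<zeta>lim: "(\<lambda>m. \<zeta> m t) \<longlonglongrightarrow> 1" for t
  proof (rule tendsto_eventually)
    obtain m1 :: nat where m1: "norm (v t) \<le> m1" using real_arch_simple by blast
    have "\<exists>m2. y t = 0 \<or> 1 / real (Suc m2) \<le> norm (y t)"
    proof (cases "y t = 0")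
      case False
      then show ?thesis
        using reals_Archimedean[of "norm (y t)"] by (auto simp: inverse_eq_divide intro: less_imp_le)
    qed auto
    then obtain m2 where m2: "y t = 0 \<or> 1 / real (Suc m2) \<le> norm (y t)" by blast
    show "\<forall>\<^sub>F m in sequentially. \<zeta> m t = 1"
    proof (rule eventually_sequentiallyI[of "max m1 m2"])
      fix m assume m: "max m1 m2 \<le> m"
      then have "1 / real (Suc m) \<le> 1 / real (Suc m2)" by (intro divide_left_mono) auto
      then have "good m t" using m1 m2 m unfolding good_def by force
      then show "\<zeta> m t = 1" by (simp add: \<zeta>_def)
    qed
  qed
  have "(\<lambda>m. \<integral>t. \<zeta> m t * ?lag t \<partial>leb T) \<longlonglongrightarrow> (\<integral>t. ?lag t \<partial>leb T)"
  proof (rule integral_dominated_convergence[where w = "\<lambda>t. \<bar>?lag t\<bar>"])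
    show "AE t in leb T. (\<lambda>m. \<zeta> m t * ?lag t) \<longlonglongrightarrow> ?lag t"
      using tendsto_mult[OF \<zeta>lim tendsto_const] by (intro AE_I2) simp
    show "AE t in leb T. norm (\<zeta> m t * ?lag t) \<le> \<bar>?lag t\<bar>" for m
      by (intro AE_I2) (auto simp: \<zeta>_def)
    show "?lag \<in> borel_measurable (leb T)" using ilag by simp
    then show "(\<lambda>t. \<zeta> m t * ?lag t) \<in> borel_measurable (leb T)" for m by measurable
  qed (use ilag in simp)
  then have ev1: "\<forall>\<^sub>F m in sequentially. (\<integral>t. ?lag t \<partial>leb T) - e / 4 < (\<integral>t. \<zeta> m t * ?lag t \<partial>leb T)"
    using e by (intro order_tendstoD(1)) auto
  have "(\<lambda>m. \<integral>t. \<zeta> m t \<partial>leb T) \<longlonglongrightarrow> (\<integral>t. 1 \<partial>leb T)"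
    by (rule integral_dominated_convergence[where w = "\<lambda>t. 1"]) (use \<zeta>lim \<zeta>01 in auto)
  then have "(\<lambda>m. C * (T - (\<integral>t. \<zeta> m t \<partial>leb T))) \<longlonglongrightarrow> C * (T - (\<integral>t. 1 \<partial>leb T))"
    by (intro tendsto_intros)
  also have "C * (T - (\<integral>t. 1 \<partial>leb T)) = 0" using measure_leb[of T] T by simp
  finally have "\<forall>\<^sub>F m in sequentially. C * (T - (\<integral>t. \<zeta> m t \<partial>leb T)) < e / 4"
    using e by (intro order_tendstoD(2)) auto
  with ev1 obtain m where m: "(\<integral>t. ?lag t \<partial>leb T) - e / 4 < (\<integral>t. \<zeta> m t * ?lag t \<partial>leb T)"
    "C * (T - (\<integral>t. \<zeta> m t \<partial>leb T)) < e / 4"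
    using eventually_happens'[OF sequentially_bot eventually_conj[OF ev1]] by blast
  \<comment> \<open>\<open>bounded_test_small\<close> wants a bound at every real \<open>t\<close>,
    hence the value 0 outside the time interval as well as off the good set.\<close>
  define h where "h i t = (if t \<in> {0<..<T} \<and> good m t then partial_a (l i) (y t $ i) (v t $ i) t else 0)" for i t
  have comp: "(\<lambda>t. f t $ i) \<in> borel_measurable (leb T)" if "f \<in> borel_measurable (leb T)"
    for f :: "real \<Rightarrow> real ^ 'n" and i
    by (intro measurable_compose[OF that] borel_measurable_continuous_onI linear_continuous_on bounded_linear_vec_nth)
  have hm: "h i \<in> borel_measurable (leb T)" for i
  proof -
    have "(\<lambda>t. partial_a (l i) (y t $ i) (v t $ i) t) \<in> borel_measurable (leb T)"
      by (rule borel_measurable_leb_compose[OF partial_a_continuous comp[OF ym] comp[OF vm]])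
        (use yj in \<open>auto intro!: junction_nonneg\<close>)
    then have "(\<lambda>t. \<zeta> m t * partial_a (l i) (y t $ i) (v t $ i) t) \<in> borel_measurable (leb T)" by measurable
    then show ?thesis by (rule measurable_cong[THEN iffD1, rotated]) (auto simp: h_def \<zeta>_def)
  qed
  have hB: "\<bar>h i t\<bar> \<le> k * (real m powr (p - 1) + 1)" for i t
  proof (cases "t \<in> {0<..<T} \<and> good m t")
    case True
    have yt: "y t \<in> junction" "norm (y t) \<le> R" using yj R True by auto
    have "\<bar>y t $ i\<bar> \<le> r" using component_le_norm_cart[of "y t" i] yt by (simp add: r_def)
    then have "\<bar>partial_a (l i) (y t $ i) (v t $ i) t\<bar> \<le> k * (\<bar>v t $ i\<bar> powr (p - 1) + 1)"
      using junction_nonneg[OF yt(1), of i] True by (intro k(2)) auto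
    also have "\<dots> \<le> k * (real m powr (p - 1) + 1)"
      using component_le_norm_cart[of "v t" i] True k(1) p
      by (intro mult_left_mono add_right_mono powr_mono2) (auto simp: good_def)
    finally show ?thesis using True by (simp add: h_def)
  qed (use k(1) in \<open>auto simp: h_def\<close>)
  have small: "(\<lambda>n. \<integral>t. h i t * (vs n t $ i - v t $ i) \<partial>leb T) \<longlonglongrightarrow> 0" for i
  proof (rule bounded_test_small[OF T p _ _ _ hm hB])
    show Lp: "(\<lambda>t. vs n t $ i - v t $ i) \<in> Lp T p" for n
      using Lp_bounded_linear[OF bounded_linear_vec_nth[of i] Lp_diff[OF vsLp vLp]] p by simp
    show "(\<integral>t. \<bar>vs n t $ i - v t $ i\<bar> powr p \<partial>leb T) \<le> 2 powr p * (K + (\<integral>t. norm (v t) powr p \<partial>leb T))" for n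
    proof -
      have "(\<integral>t. \<bar>vs n t $ i - v t $ i\<bar> powr p \<partial>leb T)
          \<le> (\<integral>t. 2 powr p * (norm (vs n t) powr p + norm (v t) powr p) \<partial>leb T)"
      proof (rule integral_mono)
        show "integrable (leb T) (\<lambda>t. \<bar>vs n t $ i - v t $ i\<bar> powr p)" using Lp[of n] by (simp add: Lp_def)
        show "integrable (leb T) (\<lambda>t. 2 powr p * (norm (vs n t) powr p + norm (v t) powr p))"
          using vsp vp by simp
        fix t
        have "\<bar>vs n t $ i - v t $ i\<bar> \<le> norm (vs n t) + norm (v t)"
          using component_le_norm_cart[of "vs n t" i] component_le_norm_cart[of "v t" i] by linarith
        then have "\<bar>vs n t $ i - v t $ i\<bar> powr p \<le> (norm (vs n t) + norm (v t)) powr p"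
          using p by (intro powr_mono2) auto
        also have "\<dots> \<le> 2 powr p * (norm (vs n t) powr p + norm (v t) powr p)"
          using p by (intro powr_add_le) auto
        finally show "\<bar>vs n t $ i - v t $ i\<bar> powr p \<le> 2 powr p * (norm (vs n t) powr p + norm (v t) powr p)" .
      qed
      also have "\<dots> = 2 powr p * ((\<integral>t. norm (vs n t) powr p \<partial>leb T) + (\<integral>t. norm (v t) powr p \<partial>leb T))"
        using vsp vp by simp
      also have "\<dots> \<le> 2 powr p * (K + (\<integral>t. norm (v t) powr p \<partial>leb T))"
        using K[of n] by (intro mult_left_mono) auto
      finally show ?thesis .
    qed
    show "uniform_limit {0..T} (\<lambda>n t. integral {0..t} (\<lambda>t. vs n t $ i - v t $ i)) (\<lambda>_. 0) sequentially"
    proof (rule uniform_limitI)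
      fix d :: real assume "0 < d"
      then have "\<forall>\<^sub>F n in sequentially. \<forall>t\<in>{0..T}. dist (ys n t) (y t) < d / 2"
        using lim by (intro uniform_limitD) auto
      then show "\<forall>\<^sub>F n in sequentially. \<forall>t\<in>{0..T}. dist (integral {0..t} (\<lambda>t. vs n t $ i - v t $ i)) 0 < d"
      proof eventually_elim
        case (elim n)
        show ?case
        proof
          fix t assume t: "t \<in> {0..T}"
          have "((\<lambda>t. vs n t - v t) has_integral (ys n t - ys n 0 - (y t - y 0))) {0..t}"
            using vs v t by (intro has_integral_diff) (auto simp: velocity_def)
          from has_integral_linear[OF this bounded_linear_vec_nth[of i]]
          have "integral {0..t} (\<lambda>t. vs n t $ i - v t $ i) = (ys n t - ys n 0 - (y t - y 0)) $ i"
            by (intro integral_unique) (simp add: comp_def)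
          also have "\<bar>\<dots>\<bar> \<le> norm (ys n t - y t) + norm (ys n 0 - y 0)"
            using component_le_norm_cart[of "ys n t - y t" i] component_le_norm_cart[of "ys n 0 - y 0" i]
            by simp
          also have "\<dots> < d / 2 + d / 2"
            using elim t T by (intro add_strict_mono) (auto simp: dist_norm)
          finally show "dist (integral {0..t} (\<lambda>t. vs n t $ i - v t $ i)) 0 < d" by simp
        qed
      qed
    qed
  qed
  have "(\<lambda>n. \<Sum>i\<in>UNIV. \<integral>t. h i t * (vs n t $ i - v t $ i) \<partial>leb T) \<longlonglongrightarrow> (\<Sum>i\<in>(UNIV :: 'n set). 0)"
    by (intro tendsto_sum small)
  then have ev2: "\<forall>\<^sub>F n in sequentially. - (e / 4) < (\<Sum>i\<in>UNIV. \<integral>t. h i t * (vs n t $ i - v t $ i) \<partial>leb T)"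
    using e by (intro order_tendstoD(1)) auto
  \<comment> \<open>Three roles: 1 keeps \<open>ys n\<close> in the ball of radius
    \<open>r = R + 1\<close>, \<open>1 / (m + 1)\<close> keeps it on the edge of \<open>y\<close>,
    and the last entry makes the Lipschitz error at most \<open>e / 4\<close>.\<close>
  define \<eta> where "\<eta> = min (min 1 (1 / real (Suc m))) (e / (4 * (c * (K + T) + 1)))"
  have cKT: "0 < c * (K + T) + 1" using c K0 T by (intro add_nonneg_pos) auto
  have \<eta>: "0 < \<eta>" "\<eta> \<le> 1" "\<eta> \<le> 1 / real (Suc m)"
  proof -
    show "0 < \<eta>" using e cKT by (simp add: \<eta>_def)
    show "\<eta> \<le> 1" "\<eta> \<le> 1 / real (Suc m)"
      unfolding \<eta>_def by (rule min.coboundedI1, simp only: min.cobounded1 min.cobounded2)+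
  qed
  have \<eta>c: "c * (K + T) * \<eta> \<le> e / 4"
  proof -
    have "c * (K + T) * \<eta> \<le> (c * (K + T) + 1) * (e / (4 * (c * (K + T) + 1)))"
      using c K0 T \<eta> by (intro mult_mono) (auto simp: \<eta>_def)
    also have "\<dots> = e / 4"
    proof -
      have "x * (e / (4 * x)) = e / 4" if "0 < x" for x using that by simp
      from this[OF cKT] show ?thesis .
    qed
    finally show ?thesis .
  qed
  have ev3: "\<forall>\<^sub>F n in sequentially. \<forall>t\<in>{0..T}. dist (ys n t) (y t) < \<eta>"
    using lim \<eta> by (intro uniform_limitD) auto
  from ev2 ev3 show ?thesis
  proof eventually_elim
    case (elim n)
    let ?F = "\<lambda>t. \<zeta> m t * ?lag t + (\<Sum>i\<in>UNIV. h i t * (vs n t $ i - v t $ i))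
      - c * \<eta> * (norm (vs n t) powr p + 1) - C * (1 - \<zeta> m t)"
    have ih: "integrable (leb T) (\<lambda>t. h i t * (vs n t $ i - v t $ i))" for i
    proof (rule Bochner_Integration.integrable_bound)
      have "(\<lambda>t. vs n t $ i - v t $ i) \<in> Lp T p"
        using Lp_bounded_linear[OF bounded_linear_vec_nth[of i] Lp_diff[OF vsLp vLp]] p by simp
      from Lp_imp_integrable[OF this] p
      have w: "integrable (leb T) (\<lambda>t. vs n t $ i - v t $ i)" by simp
      then show "integrable (leb T) (\<lambda>t. k * (real m powr (p - 1) + 1) * (vs n t $ i - v t $ i))" by simp
      show "(\<lambda>t. h i t * (vs n t $ i - v t $ i)) \<in> borel_measurable (leb T)"
        by (intro borel_measurable_times hm borel_measurable_integrable[OF w])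
      show "AE t in leb T. norm (h i t * (vs n t $ i - v t $ i))
          \<le> norm (k * (real m powr (p - 1) + 1) * (vs n t $ i - v t $ i))"
        using order_trans[OF hB abs_ge_self] unfolding real_norm_def abs_mult
        by (intro AE_I2 mult_right_mono) (auto simp flip: abs_mult)
    qed
    have i\<zeta>lag: "integrable (leb T) (\<lambda>t. \<zeta> m t * ?lag t)"
    proof (rule Bochner_Integration.integrable_bound[OF ilag])
      show "(\<lambda>t. \<zeta> m t * ?lag t) \<in> borel_measurable (leb T)"
        by (intro borel_measurable_times \<zeta>m borel_measurable_integrable[OF ilag])
    qed (intro AE_I2, auto simp: \<zeta>_def)
    have "(\<integral>t. ?F t \<partial>leb T) \<le> (\<integral>t. lagrangian l ls (ys n t) (vs n t) t \<partial>leb T)"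
    proof (rule integral_mono_AE)
      show "integrable (leb T) ?F" using i\<zeta>lag ih vsp i\<zeta> by auto
      show "integrable (leb T) (\<lambda>t. lagrangian l ls (ys n t) (vs n t) t)"
        by (rule lagrangian_integrable[OF p vs ysj])
      have "AE t in leb T. t \<in> {0<..<T}" by (rule AE_I2) simp
      with AE_velocity_eq_0[OF T p vs ysj, of n] AE_velocity_eq_0[OF T p v yj]
      show "AE t in leb T. ?F t \<le> lagrangian l ls (ys n t) (vs n t) t"
      proof eventually_elim
        case (elim t)
        then have t: "t \<in> {0..T}" by auto
        have yt: "y t \<in> junction" "norm (y t) \<le> R" using yj R t by auto
        have nt: "ys n t \<in> junction" "norm (ys n t - y t) < \<eta>"
          using ysj[of n] t \<open>\<forall>t\<in>{0..T}. dist (ys n t) (y t) < \<eta>\<close> by (auto simp: dist_norm)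
        have c1: "0 \<le> c * (norm (vs n t) powr p + 1)" using c(1) by simp
        show ?case
        proof (cases "good m t")
          case True
          have pos: "0 < ys n t $ j" if "0 < y t $ j" for j
          proof -
            have "norm (y t) = y t $ j"
              using yt(1)
            proof (cases rule: junction_cases)
              case (edge i)
              then show ?thesis using that by (cases "i = j") auto
            qed (use that in simp)
            moreover have "1 / real (Suc m) \<le> norm (y t)" using True that by (auto simp: good_def)
            ultimately have "\<eta> \<le> y t $ j" using \<eta> by linarith
            then show ?thesis using component_le_norm_cart[of "ys n t - y t" j] nt(2) by simp
          qed
          have "norm (ys n t) \<le> r"
            using nt(2) yt(2) \<eta> norm_triangle_sub[of "ys n t" "y t"] by (simp add: r_def)
          then have "?lag t + (\<Sum>i\<in>UNIV. partial_a (l i) (y t $ i) (v t $ i) t * (vs n t $ i - v t $ i))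
              - c * (norm (vs n t) powr p + 1) * norm (ys n t - y t) \<le> lagrangian l ls (ys n t) (vs n t) t"
            using yt nt t elim pos by (intro c(2)) (auto simp: r_def)
          moreover have "c * (norm (vs n t) powr p + 1) * norm (ys n t - y t) \<le> c * (norm (vs n t) powr p + 1) * \<eta>"
            using c1 nt(2) by (intro mult_left_mono) auto
          moreover have "(\<Sum>i\<in>UNIV. h i t * (vs n t $ i - v t $ i))
              = (\<Sum>i\<in>UNIV. partial_a (l i) (y t $ i) (v t $ i) t * (vs n t $ i - v t $ i))"
            using True elim by (simp add: h_def)
          ultimately show ?thesis using True by (simp add: \<zeta>_def algebra_simps)
        next
          case False
          have "c0 * norm (vs n t) powr p - C \<le> lagrangian l ls (ys n t) (vs n t) t"
            using nt t elim by (intro C(3)) auto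
          moreover have "0 \<le> c0 * norm (vs n t) powr p" using C(1) by simp
          moreover have "0 \<le> c * \<eta> * (norm (vs n t) powr p + 1)" using c(1) \<eta> by simp
          ultimately show ?thesis using False by (simp add: \<zeta>_def h_def)
        qed
      qed
    qed
    moreover have "(\<integral>t. ?F t \<partial>leb T) = (\<integral>t. \<zeta> m t * ?lag t \<partial>leb T)
        + (\<Sum>i\<in>UNIV. \<integral>t. h i t * (vs n t $ i - v t $ i) \<partial>leb T)
        - c * \<eta> * ((\<integral>t. norm (vs n t) powr p \<partial>leb T) + T) - C * (T - (\<integral>t. \<zeta> m t \<partial>leb T))"
      using i\<zeta>lag ih vsp i\<zeta> measure_leb[of T] T by simp
    moreover have "c * \<eta> * ((\<integral>t. norm (vs n t) powr p \<partial>leb T) + T) \<le> e / 4"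
    proof -
      have "c * \<eta> * ((\<integral>t. norm (vs n t) powr p \<partial>leb T) + T) \<le> c * \<eta> * (K + T)"
        using K[of n] c \<eta> by (intro mult_left_mono) auto
      also have "\<dots> = c * (K + T) * \<eta>" by (simp only: mult_ac)
      finally show ?thesis using \<eta>c by linarith
    qed
    ultimately show ?case using elim m by linarith
  qed
qed

end

section \<open>Competitors from nearby points\<close>

context standing_assumptions
begin

text \<open>The competitor runs linearly from \<open>xs n\<close> to \<open>x\<close> during the first half of a short interval of length \<open>d\<close>,
  then linearly to the point \<open>z d\<close>, and follows \<open>z\<close> afterwards; the second piece costs no more than a multiple
  of the energy of \<open>z\<close> on that interval.\<close>

lemma recovery:
  fixes xs :: "nat \<Rightarrow> real ^ 'n" and x :: "real ^ 'n" and z :: "real \<Rightarrow> real ^ 'n"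
  assumes T: "0 < T" and p: "1 < p" and xs: "\<And>n. xs n \<in> junction" and x: "x \<in> junction"
    and lim: "xs \<longlonglongrightarrow> x" and z: "z \<in> trajectories T p x" and e: "0 < e"
  shows "\<forall>\<^sub>F n in sequentially. \<exists>z'\<in>trajectories T p (xs n). cost T p l ls g gs z' \<le> cost T p l ls g gs z + e"
proof -
  interpret finite_measure "leb T" by (rule finite_measure_leb)
  obtain v where v: "velocity T p z v" and zj: "z ` {0..T} \<subseteq> junction" and z0: "z 0 = x"
    using z by (auto simp: trajectories_iff[OF T p])
  have zc: "continuous_on {0..T} z" using v by (rule velocity_continuous)
  have vLp: "v \<in> Lp T p" using v by (simp add: velocity_def)
  obtain R where R: "0 < R" "\<And>t. t \<in> {0..T} \<Longrightarrow> norm (z t) \<le> R"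
    using compact_imp_bounded[OF compact_continuous_image[OF zc compact_Icc]]
    unfolding bounded_pos by blast
  define r where "r = R + 1"
  have r: "0 < r" using R by (simp add: r_def)
  obtain C where C: "0 \<le> C"
    "\<And>q w s. q \<in> junction \<Longrightarrow> norm q \<le> r \<Longrightarrow> s \<in> {0..T} \<Longrightarrow>
      \<bar>lagrangian l ls q w s\<bar> \<le> C * (1 + norm w powr p)"
    using lagrangian_le[OF r p] by metis
  obtain c1 C1 where C1: "0 < c1" "0 \<le> C1"
    "\<And>q w s. q \<in> junction \<Longrightarrow> (\<And>j. q $ j = 0 \<Longrightarrow> w $ j = 0) \<Longrightarrow> s \<in> {0..T} \<Longrightarrow>
      c1 * norm w powr p - C1 \<le> lagrangian l ls q w s"
    using lagrangian_ge p by (metis less_trans zero_less_one)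
  define E where "E d = integral {0..d} (\<lambda>t. norm (v t) powr p)" for d
  \<comment> \<open>A majorant, with generous constants, of the extra cost \<open>A * d\<close>
    below. It depends on \<open>z\<close> and \<open>d\<close> but not on \<open>n\<close>, so
    \<open>d\<close> can be fixed before \<open>n\<close>; it tends to 0 with \<open>d\<close>
    because \<open>E\<close> is continuous and \<open>E 0 = 0\<close>.\<close>
  define B where "B d = (3 * C + 2 * C1) * d + C * (4 powr p * (E d + d))" for d
  have "(\<lambda>t. norm (v t) powr p) absolutely_integrable_on {0..T}"
    using vLp by (simp add: Lp_def flip: integrable_leb_iff)
  then have "continuous_on {0..T} E"
    unfolding E_def by (intro indefinite_integral_continuous_1 set_lebesgue_integral_eq_integral(1))
  then have "continuous_on {0..T} B" unfolding B_def by (intro continuous_intros)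
  then have "((\<lambda>d. B d) \<longlongrightarrow> B 0) (at 0 within {0..T})" using T by (auto simp: continuous_on_def)
  then have "\<forall>\<^sub>F d in at 0 within {0..T}. B d < e"
    using e by (intro order_tendstoD(2)) (auto simp: B_def E_def)
  moreover have "\<forall>\<^sub>F d in at 0 within {0..T}. x = 0 \<or> norm (z d - x) < norm x"
  proof (cases "x = 0")
    case False
    have "((\<lambda>d. norm (z d - x)) \<longlongrightarrow> norm (z 0 - x)) (at 0 within {0..T})"
      using zc T by (intro tendsto_intros) (auto simp: continuous_on_def)
    then have "\<forall>\<^sub>F d in at 0 within {0..T}. norm (z d - x) < norm x"
      using z0 False by (intro order_tendstoD(2)) auto
    then show ?thesis by eventually_elim simp
  qed simp
  ultimately have "\<forall>\<^sub>F d in at 0 within {0..T}. B d < e \<and> (x = 0 \<or> norm (z d - x) < norm x)"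
    by (rule eventually_conj)
  then obtain \<delta> where \<delta>: "0 < \<delta>" "\<And>d. d \<in> {0..T} \<Longrightarrow> d \<noteq> 0 \<Longrightarrow> dist d 0 < \<delta> \<Longrightarrow>
      B d < e \<and> (x = 0 \<or> norm (z d - x) < norm x)"
    unfolding eventually_at by blast
  define d where "d = min \<delta> T / 2"
  have d: "0 < d" "d < T" "d < \<delta>" using \<delta>(1) T by (auto simp: d_def min_def)
  have Bd: "B d < e" and xd: "x = 0 \<or> norm (z d - x) < norm x" using \<delta>(2)[of d] d by auto
  have zd: "z d \<in> junction" using zj d by auto
  \<comment> \<open>If \<open>x\<close> is the vertex, \<open>xs n\<close> and \<open>z d\<close>
    may lie on different edges, so the segment between them may leave the junction. Each of them
    shares an edge with \<open>x\<close>, and edges are convex; hence the detour through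
    \<open>x\<close>.\<close>
  obtain i where i: "x \<in> edge i" "z d \<in> edge i" using same_edge[OF x zd xd] by blast
  have "(\<lambda>n. norm (xs n - x)) \<longlonglongrightarrow> norm (x - x)" by (intro tendsto_intros lim)
  then have n0: "(\<lambda>n. norm (xs n - x)) \<longlonglongrightarrow> 0" by simp
  have "\<forall>\<^sub>F n in sequentially. norm (xs n - x) < min 1 (d / 2)"
    using d by (intro order_tendstoD(2)[OF n0]) auto
  moreover have "\<forall>\<^sub>F n in sequentially. x = 0 \<or> norm (xs n - x) < norm x"
  proof (cases "x = 0")
    case False
    then have "\<forall>\<^sub>F n in sequentially. norm (xs n - x) < norm x" by (intro order_tendstoD(2)[OF n0]) auto
    then show ?thesis by eventually_elim simp
  qed simp
  ultimately show ?thesis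
  proof eventually_elim
    case (elim n)
    obtain j where j: "x \<in> edge j" "xs n \<in> edge j" using same_edge[OF x xs elim(2)] by blast
    \<comment> \<open>Each segment takes the time \<open>d / 2\<close>. Since
      \<open>norm (xs n - x) < d / 2\<close>, the first speed is at most 1; the second is paid for
      by the energy of \<open>z\<close>.\<close>
    define w1 w2 where "w1 = (2 / d) *\<^sub>R (x - xs n)" and "w2 = (2 / d) *\<^sub>R (z d - x)"
    \<comment> \<open>Both pieces are affine functions on the whole interval, as
      \<open>velocity_concat\<close> expects; the second is extended backwards so that it passes
      through \<open>x\<close> at \<open>d / 2\<close> and through \<open>z d\<close> at
      \<open>d\<close>.\<close>
    define u1 u2 where "u1 t = xs n + t *\<^sub>R w1" and "u2 t = (x - (d / 2) *\<^sub>R w2) + t *\<^sub>R w2" for t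
    define y where "y t = (if t \<le> d / 2 then u1 t else if t \<le> d then u2 t else z t)" for t
    define w where "w t = (if t \<le> d / 2 then w1 else if t \<le> d then w2 else v t)" for t
    have dw: "d *\<^sub>R w2 = 2 *\<^sub>R (z d - x)" "(d / 2) *\<^sub>R w2 = z d - x" "(d / 2) *\<^sub>R w1 = x - xs n"
      using d by (simp_all add: w1_def w2_def)
    have u2d: "u2 d = z d" unfolding u2_def dw by (simp add: algebra_simps scaleR_2)
    have u2h: "u2 (d / 2) = x" by (simp add: u2_def)
    have u1h: "u1 (d / 2) = x" by (simp add: u1_def dw)
    have vel: "velocity T p y w"
      unfolding y_def w_def
    proof (rule velocity_concat)
      show "velocity T p u1 (\<lambda>_. w1)" unfolding u1_def by (rule velocity_line)
      show "velocity T p (\<lambda>t. if t \<le> d then u2 t else z t) (\<lambda>t. if t \<le> d then w2 else v t)"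
      proof (rule velocity_concat[OF _ v])
        show "velocity T p u2 (\<lambda>_. w2)" unfolding u2_def by (rule velocity_line)
      qed (use d u2d in auto)
    qed (use d u1h u2h in auto)
    have xr: "norm x \<le> r" "norm (z d) \<le> r" "norm (xs n) \<le> r"
      using R(2)[of 0] R(2)[of d] d z0 elim(1) norm_triangle_sub[of "xs n" x] by (auto simp: r_def)
    have early: "y t \<in> junction \<and> norm (y t) \<le> r" if t: "0 \<le> t" "t \<le> d" for t
    proof (cases "t \<le> d / 2")
      case True
      have "y t = (1 - 2 * t / d) *\<^sub>R xs n + (2 * t / d) *\<^sub>R x"
        using True by (simp add: y_def u1_def w1_def algebra_simps)
      moreover have "0 \<le> 1 - 2 * t / d" "0 \<le> 2 * t / d" "(1 - 2 * t / d) + 2 * t / d = 1"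
        using True t d by (auto simp: field_simps)
      ultimately have "y t \<in> edge j \<and> y t \<in> cball 0 r"
        using convexD[OF convex_edge j(2,1), of "1 - 2 * t / d" "2 * t / d"]
          convexD[OF convex_cball, of "xs n" 0 r x "1 - 2 * t / d" "2 * t / d"] xr by auto
      then show ?thesis by (auto simp: junction_iff)
    next
      case False
      have "y t = (2 - 2 * t / d) *\<^sub>R x + (2 * t / d - 1) *\<^sub>R z d"
        using False t d by (simp add: y_def u2_def w2_def algebra_simps scaleR_2)
      moreover have "0 \<le> 2 - 2 * t / d" "0 \<le> 2 * t / d - 1" "(2 - 2 * t / d) + (2 * t / d - 1) = 1"
        using False t d by (auto simp: field_simps)
      ultimately have "y t \<in> edge i \<and> y t \<in> cball 0 r"
        using convexD[OF convex_edge i, of "2 - 2 * t / d" "2 * t / d - 1"]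
          convexD[OF convex_cball, of x 0 r "z d" "2 - 2 * t / d" "2 * t / d - 1"] xr by auto
      then show ?thesis by (auto simp: junction_iff)
    qed
    have late: "y t = z t" if "d < t" for t using that d by (simp add: y_def)
    have yj: "y ` {0..T} \<subseteq> junction"
    proof safe
      fix t assume "t \<in> {0..T}"
      then show "y t \<in> junction" using early[of t] late[of t] zj by (cases "t \<le> d") auto
    qed
    have "y 0 = xs n" using d by (simp add: y_def u1_def)
    then have traj: "y \<in> trajectories T p (xs n)"
      using vel yj by (auto simp: trajectories_iff[OF T p])
    \<comment> \<open>Bounds the surplus per unit of time before \<open>d\<close>: the growth bound
      with \<open>norm (w t) powr p \<le> 1 + norm w2 powr p\<close>, plus \<open>C1\<close> because
      the cost of \<open>z\<close> that is saved there is at least \<open>- C1\<close>.\<close>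
    define A where "A = C * (2 + norm w2 powr p) + C1"
    have A0: "0 \<le> A" using C C1 by (simp add: A_def)
    have "norm w1 = 2 / d * norm (xs n - x)" using d by (simp add: w1_def norm_minus_commute)
    also have "\<dots> \<le> 2 / d * (d / 2)" using elim(1) d by (intro mult_left_mono) auto
    finally have "norm w1 \<le> 1" using d by simp
    then have w1: "norm w1 powr p \<le> 1" using p powr_mono2[of p "norm w1" 1] by simp
    let ?G = "\<lambda>t. if t \<le> d then A else 0"
    have tm: "(\<lambda>t. t) \<in> borel_measurable (leb T)" by (intro borel_measurable_leb_continuous continuous_intros)
    have Gi: "integrable (leb T) ?G"
    proof (rule integrable_const_bound[where B = A])
      show "?G \<in> borel_measurable (leb T)" using tm by measurable
    qed (use A0 in auto)
    have "(?G has_integral A * d) {0..T}"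
    proof -
      have 1: "(?G has_integral A * d) {0..d}"
        using has_integral_const_real[of A 0 d] d
        by (subst has_integral_cong[where g = "\<lambda>_. A"]) (auto simp: mult.commute)
      have 2: "(?G has_integral 0) {d..T}"
        by (rule has_integral_spike_finite[of "{d}" _ _ "\<lambda>_. 0"]) auto
      show ?thesis using has_integral_combine[OF _ _ 1 2] d by simp
    qed
    then have GI: "(\<integral>t. ?G t \<partial>leb T) = A * d"
      using integral_leb[OF Gi] by (simp add: integral_unique)
    have zi: "integrable (leb T) (\<lambda>t. lagrangian l ls (z t) (v t) t)" by (rule lagrangian_integrable[OF p v zj])
    have "(\<integral>t. lagrangian l ls (y t) (w t) t \<partial>leb T) \<le> (\<integral>t. lagrangian l ls (z t) (v t) t + ?G t \<partial>leb T)"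
    proof (rule integral_mono_AE)
      show "integrable (leb T) (\<lambda>t. lagrangian l ls (y t) (w t) t)" by (rule lagrangian_integrable[OF p vel yj])
      show "integrable (leb T) (\<lambda>t. lagrangian l ls (z t) (v t) t + ?G t)" using zi Gi by simp
      have "AE t in leb T. t \<in> {0<..<T}" by (rule AE_I2) simp
      with AE_velocity_eq_0[OF T p v zj]
      show "AE t in leb T. lagrangian l ls (y t) (w t) t \<le> lagrangian l ls (z t) (v t) t + ?G t"
      proof eventually_elim
        case (elim t)
        show ?case
        proof (cases "t \<le> d")
          case True
          have "\<bar>lagrangian l ls (y t) (w t) t\<bar> \<le> C * (1 + norm (w t) powr p)"
            using early[of t] True elim by (intro C(2)) auto
          also have "\<dots> \<le> C * (2 + norm w2 powr p)"
          proof (rule mult_left_mono[OF _ C(1)])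
            show "1 + norm (w t) powr p \<le> 2 + norm w2 powr p"
              using True w1 by (auto simp: w_def intro: add_increasing2)
          qed
          finally have "lagrangian l ls (y t) (w t) t \<le> C * (2 + norm w2 powr p)" by simp
          moreover have "c1 * norm (v t) powr p - C1 \<le> lagrangian l ls (z t) (v t) t"
            using elim zj by (intro C1(3)) auto
          moreover have "0 \<le> c1 * norm (v t) powr p" using C1(1) by simp
          ultimately show ?thesis using True by (simp add: A_def)
        next
          case False
          then show ?thesis using late[of t] d by (simp add: w_def)
        qed
      qed
    qed
    also have "\<dots> = (\<integral>t. lagrangian l ls (z t) (v t) t \<partial>leb T) + A * d"
      using zi Gi GI by simp
    also have "A * d \<le> B d"
    proof -
      have "norm w2 = 2 / d * norm (z d - z 0)" using d z0 by (simp add: w2_def)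
      then have "d * norm w2 powr p \<le> 4 powr p * (E d + d)"
        using displacement_powr_le[OF v _ d(1)] p d unfolding E_def by simp
      then have "C * (d * norm w2 powr p) \<le> C * (4 powr p * (E d + d))" using C(1) by (rule mult_left_mono)
      moreover have "0 \<le> C * d" "0 \<le> C1 * d" using C(1) C1(2) d by auto
      ultimately show ?thesis by (simp add: A_def B_def algebra_simps)
    qed
    finally have "cost T p l ls g gs y \<le> cost T p l ls g gs z + e"
      using Bd late[OF d(2)] cost_eq[OF T p vel yj] cost_eq[OF T p v zj] by simp
    with traj show ?case by blast
  qed
qed

section \<open>Coercivity and optimality\<close>

lemma trajectory_cost_ge:
  assumes T: "0 < T" and p: "1 < p"
  obtains c C where "0 < c"
    "\<And>x y v. velocity T p y v \<Longrightarrow> y ` {0..T} \<subseteq> junction \<Longrightarrow>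
      c * (\<integral>t. norm (v t) powr p \<partial>leb T) - C \<le> cost T p l ls g gs y"
proof -
  interpret finite_measure "leb T" by (rule finite_measure_leb)
  obtain c C where C: "0 < c" "0 \<le> C"
    "\<And>q w s. q \<in> junction \<Longrightarrow> (\<And>j. q $ j = 0 \<Longrightarrow> w $ j = 0) \<Longrightarrow> s \<in> {0..T} \<Longrightarrow>
      c * norm w powr p - C \<le> lagrangian l ls q w s"
    using lagrangian_ge p by (metis less_trans zero_less_one)
  obtain G where G: "\<And>z. z \<in> junction \<Longrightarrow> - G \<le> terminal_cost g gs z"
    using terminal_cost_bounded_below[where g = g and gs = gs, OF g_bounded] by blast
  have "c * (\<integral>t. norm (v t) powr p \<partial>leb T) - (C * T + G) \<le> cost T p l ls g gs y"
    if v: "velocity T p y v" and y: "y ` {0..T} \<subseteq> junction" for y v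
  proof -
    have vp: "integrable (leb T) (\<lambda>t. norm (v t) powr p)" using v by (simp add: velocity_def Lp_def)
    have "(\<integral>t. c * norm (v t) powr p - C \<partial>leb T) \<le> (\<integral>t. lagrangian l ls (y t) (v t) t \<partial>leb T)"
    proof (rule integral_mono_AE)
      show "integrable (leb T) (\<lambda>t. c * norm (v t) powr p - C)" using vp by simp
      show "integrable (leb T) (\<lambda>t. lagrangian l ls (y t) (v t) t)" by (rule lagrangian_integrable[OF p v y])
      have "AE t in leb T. t \<in> {0<..<T}" by (rule AE_I2) simp
      with AE_velocity_eq_0[OF T p v y]
      show "AE t in leb T. c * norm (v t) powr p - C \<le> lagrangian l ls (y t) (v t) t"
        by eventually_elim (use y in \<open>auto intro!: C(3)\<close>)
    qed
    moreover have "(\<integral>t. c * norm (v t) powr p - C \<partial>leb T) = c * (\<integral>t. norm (v t) powr p \<partial>leb T) - C * T"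
      using vp measure_leb[of T] T by simp
    moreover have "- G \<le> terminal_cost g gs (y T)" using y T by (intro G) auto
    ultimately show ?thesis using cost_eq[OF T p v y] by simp
  qed
  with C(1) that show ?thesis by blast
qed

text \<open>\<open>INF\<close> over the reals is a genuine lower bound only for a set that is
  bounded below; coercivity of the cost provides this.\<close>

lemma optimal_trajectories_iff:
  fixes y :: "real \<Rightarrow> real ^ 'n"
  assumes T: "0 < T" and p: "1 < p"
  shows "y \<in> optimal_trajectories T p l ls g gs x \<longleftrightarrow>
    y \<in> trajectories T p x \<and> (\<forall>z\<in>trajectories T p x. cost T p l ls g gs y \<le> cost T p l ls g gs z)"
proof -
  obtain c C where C: "0 < c"
    "\<And>x y v. velocity T p y v \<Longrightarrow> y ` {0..T} \<subseteq> junction \<Longrightarrow>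
      c * (\<integral>t. norm (v t) powr p \<partial>leb T) - C \<le> cost T p l ls g gs y"
    using trajectory_cost_ge[OF T p] by metis
  have "- C \<le> cost T p l ls g gs z" if z: "z \<in> trajectories T p x" for z
  proof -
    obtain v where v: "velocity T p z v" "z ` {0..T} \<subseteq> junction" using z by (auto simp: trajectories_iff[OF T p])
    have "0 \<le> c * (\<integral>t. norm (v t) powr p \<partial>leb T)" using C(1) by simp
    with C(2)[OF v] show ?thesis by linarith
  qed
  then have bdd: "bdd_below (cost T p l ls g gs ` trajectories T p x)" by (intro bdd_belowI[of _ "- C"]) auto
  show ?thesis
    unfolding optimal_trajectories_def
  proof safe
    fix z assume "z \<in> trajectories T p x"
      "cost T p l ls g gs y = (INF z \<in> trajectories T p x. cost T p l ls g gs z)"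
    then show "cost T p l ls g gs y \<le> cost T p l ls g gs z" using cINF_lower[OF bdd] by simp
  next
    assume y: "y \<in> trajectories T p x" "\<forall>z\<in>trajectories T p x. cost T p l ls g gs y \<le> cost T p l ls g gs z"
    show "cost T p l ls g gs y = (INF z \<in> trajectories T p x. cost T p l ls g gs z)"
    proof (rule antisym)
      show "cost T p l ls g gs y \<le> (INF z \<in> trajectories T p x. cost T p l ls g gs z)"
        using y by (intro cINF_greatest) auto
      show "(INF z \<in> trajectories T p x. cost T p l ls g gs z) \<le> cost T p l ls g gs y"
        using y bdd by (intro cINF_lower)
    qed
  qed
qed

end

theorem proposition2p14:
  fixes T p gs :: real
    and l :: "'n::finite \<Rightarrow> real \<Rightarrow> real \<Rightarrow> real \<Rightarrow> real"
    and ls :: "real \<Rightarrow> real"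
    and g :: "'n \<Rightarrow> real \<Rightarrow> real"
    and xs :: "nat \<Rightarrow> real ^ 'n" and x :: "real ^ 'n"
    and ys :: "nat \<Rightarrow> real \<Rightarrow> real ^ 'n" and y :: "real \<Rightarrow> real ^ 'n"
  assumes "CARD('n) > 1" and "T > 0" and "p > 1"
    and "standing_assumptions T p l ls g"
    and "\<And>n. xs n \<in> junction" and "x \<in> junction" and "xs \<longlonglongrightarrow> x"
    and "\<And>n. ys n \<in> optimal_trajectories T p l ls g gs (xs n)"
    and "uniform_limit {0..T} ys y sequentially"
  shows "y \<in> optimal_trajectories T p l ls g gs x"
proof -
  note T = assms(2) and p = assms(3) and lim = assms(9)
  interpret standing_assumptions T p l ls g by (rule assms(4))
  have opt: "ys n \<in> trajectories T p (xs n)"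
    "\<And>z. z \<in> trajectories T p (xs n) \<Longrightarrow> cost T p l ls g gs (ys n) \<le> cost T p l ls g gs z" for n
    using iffD1[OF optimal_trajectories_iff[OF T p] assms(8)[of n]] by blast+
  \<comment> \<open>The comparison with recovered competitors is used twice: for the constant
    trajectory at \<open>x\<close>, which bounds the energies, and for an arbitrary
    \<open>z\<close>, which gives minimality of \<open>y\<close>.\<close>
  have le: "\<forall>\<^sub>F n in sequentially. cost T p l ls g gs (ys n) \<le> cost T p l ls g gs z + e"
    if "z \<in> trajectories T p x" "0 < e" for z e
    using recovery[OF T p assms(5,6,7) that, of gs]
    by eventually_elim (use opt(2) order_trans in blast)
  have "\<exists>v. velocity T p (ys n) v" for n using opt(1)[of n] by (simp add: trajectories_iff[OF T p])
  then obtain vs where vs: "\<And>n. velocity T p (ys n) (vs n)" by metis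
  have ysj: "ys n ` {0..T} \<subseteq> junction" and ys0: "ys n 0 = xs n" for n
    using opt(1)[of n] by (simp_all add: trajectories_iff[OF T p])
  have pw: "(\<lambda>n. ys n t) \<longlonglongrightarrow> y t" if "t \<in> {0..T}" for t
    using lim that by (rule tendsto_uniform_limitI)
  have yj: "y ` {0..T} \<subseteq> junction"
  proof safe
    fix t assume t: "t \<in> {0..T}"
    then have "ys n t \<in> junction" for n using ysj[of n] by auto
    then show "y t \<in> junction" by (rule closed_sequentially[OF closed_junction _ pw[OF t]])
  qed
  have y0: "y 0 = x"
  proof (rule LIMSEQ_unique)
    show "(\<lambda>n. ys n 0) \<longlonglongrightarrow> y 0" using T by (intro pw) auto
    show "(\<lambda>n. ys n 0) \<longlonglongrightarrow> x" using assms(7) by (simp add: ys0)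
  qed
  obtain c C where C: "0 < c"
    "\<And>x y v. velocity T p y v \<Longrightarrow> y ` {0..T} \<subseteq> junction \<Longrightarrow>
      c * (\<integral>t. norm (v t) powr p \<partial>leb T) - C \<le> cost T p l ls g gs y"
    using trajectory_cost_ge[OF T p] by metis
  have const: "(\<lambda>_. x) \<in> trajectories T p x"
    using velocity_line[of T p x 0] assms(6) by (auto simp: trajectories_iff[OF T p])
  \<comment> \<open>Solves the coercivity estimate for the energy, with the cost of
    \<open>ys n\<close> replaced by its bound from the constant competitor.\<close>
  define K where "K = (cost T p l ls g gs (\<lambda>_. x) + 1 + C) / c"
  obtain n0 where n0: "\<And>n. n \<ge> n0 \<Longrightarrow> cost T p l ls g gs (ys n) \<le> cost T p l ls g gs (\<lambda>_. x) + 1"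
    using le[OF const zero_less_one] by (auto simp: eventually_sequentially)
  \<comment> \<open>The energy bound holds from \<open>n0\<close> on, while the limit lemmas require
    it for every index.\<close>
  define ys' vs' where "ys' n = ys (n + n0)" and "vs' n = vs (n + n0)" for n
  have K: "(\<integral>t. norm (vs' n t) powr p \<partial>leb T) \<le> K" for n
    using C(2)[OF vs ysj, of "n + n0"] n0[of "n + n0"] C(1)
    by (simp add: K_def vs'_def pos_le_divide_eq mult.commute)
  have lim': "uniform_limit {0..T} ys' y sequentially"
    using lim eventually_sequentially_seg[of "\<lambda>n. \<forall>t\<in>{0..T}. dist (ys n t) (y t) < e" n0 for e]
    by (simp add: uniform_limit_iff ys'_def)
  have vs': "velocity T p (ys' n) (vs' n)" and ysj': "ys' n ` {0..T} \<subseteq> junction" for n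
    using vs ysj by (simp_all add: ys'_def vs'_def)
  have vsLp: "vs' n \<in> Lp T p" for n using vs' by (simp add: velocity_def)
  have "uniform_limit {0..T} (\<lambda>n t. integral {0..t} (vs' n)) (\<lambda>t. y t - y 0) sequentially"
  proof (rule uniform_limitI)
    fix e :: real assume "0 < e"
    then have "\<forall>\<^sub>F n in sequentially. \<forall>t\<in>{0..T}. dist (ys' n t) (y t) < e / 2"
      using lim' by (intro uniform_limitD) auto
    then show "\<forall>\<^sub>F n in sequentially. \<forall>t\<in>{0..T}. dist (integral {0..t} (vs' n)) (y t - y 0) < e"
    proof eventually_elim
      case (elim n)
      show ?case
      proof
        fix t assume t: "t \<in> {0..T}"
        have int: "integral {0..t} (vs' n) = ys' n t - ys' n 0"
          using vs'[of n] t by (auto simp: velocity_def intro: integral_unique)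
        have "dist (integral {0..t} (vs' n)) (y t - y 0) = norm ((ys' n t - y t) - (ys' n 0 - y 0))"
          unfolding int dist_norm by (simp add: algebra_simps)
        also have "\<dots> \<le> norm (ys' n t - y t) + norm (ys' n 0 - y 0)" by (rule norm_triangle_ineq4)
        also have "\<dots> < e / 2 + e / 2" using elim t T by (intro add_strict_mono) (auto simp: dist_norm)
        finally show "dist (integral {0..t} (vs' n)) (y t - y 0) < e" by simp
      qed
    qed
  qed
  from velocity_limit[where vs = vs' and u = y, OF T p vsLp K this]
  obtain v where v: "velocity T p y v" by blast
  have yt: "y \<in> trajectories T p x" using v yj y0 by (auto simp: trajectories_iff[OF T p])
  have "cost T p l ls g gs y \<le> cost T p l ls g gs z" if z: "z \<in> trajectories T p x" for z
  proof (rule field_le_epsilon)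
    fix e :: real assume "0 < e"
    then have e3: "0 < e / 3" by simp
    have "\<forall>\<^sub>F n in sequentially. cost T p l ls g gs (ys' n) \<le> cost T p l ls g gs z + e / 3"
      unfolding ys'_def using le[OF z e3]
      by (rule iffD2[OF eventually_sequentially_seg[of "\<lambda>n. cost T p l ls g gs (ys n) \<le> cost T p l ls g gs z + e / 3" n0]])
    moreover have "\<forall>\<^sub>F n in sequentially. terminal_cost g gs (y T) - e / 3 \<le> terminal_cost g gs (ys' n T)"
    proof (rule terminal_cost_lsc[OF g_continuous _ _ _ e3])
      show "ys' n T \<in> junction" for n using ysj'[of n] T by auto
      show "y T \<in> junction" using yj T by auto
      show "(\<lambda>n. ys' n T) \<longlonglongrightarrow> y T" using lim' T by (intro tendsto_uniform_limitI) auto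
    qed
    moreover have "\<forall>\<^sub>F n in sequentially. (\<integral>t. lagrangian l ls (y t) (v t) t \<partial>leb T) - e / 3
        \<le> (\<integral>t. lagrangian l ls (ys' n t) (vs' n t) t \<partial>leb T)"
      by (rule lower_semicontinuous_running_cost[OF T p vs' ysj' v yj K lim' e3])
    ultimately have "\<forall>\<^sub>F n in sequentially. cost T p l ls g gs y \<le> cost T p l ls g gs z + e"
    proof eventually_elim
      case (elim n)
      then show ?case using cost_eq[OF T p v yj] cost_eq[OF T p vs' ysj', of gs n] by simp
    qed
    then show "cost T p l ls g gs y \<le> cost T p l ls g gs z + e" by simp
  qed
  with yt show ?thesis by (simp add: optimal_trajectories_iff[OF T p])
qed

end
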